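(* If $\mathbf{A}^\#$ is a computable presentation of a UHF algebra $\mathbf{A}$, then $K_0(\mathbf{A}^\#)$ is a computable presentation of $K_0(\mathbf{A})$ and the positive cone $K_0(\mathbf{A})^+$ is a computable subset of $K_0(\mathbf{A}^\#)$.
   Context: A UHF algebra is a unital $\mathrm{C}^*$-algebra isomorphic to an inductive limit of full matrix algebras $M_{n_k}(\mathbb{C})$ with unital connecting embeddings. A presentation $\mathbf{A}^\#$ of $\mathbf{A}$ is a sequence in $\mathbf{A}$ (special points) generating a dense $*$-subalgebra; rational points are $*$-polynomials with $\mathbb{Q}(i)$ coefficients and no constant term in the special points, effectively enumerated. $\mathbf{A}^\#$ is computable if there is an algorithm which, given a rational point $q$ and $k$, outputs a rational $r$ with $|\|q\|-r|<2^{-k}$; it is c.e. if an algorithm enumerates, given $q$, a decreasing sequence of rationals converging to $\|q\|$. An element $a$ is a computable point of $\mathbf{A}^\#$ if some algorithm, given $k$, outputs a rational point within $2^{-k}$ of $a$ (a code is an $\mathbf{A}^\#$-index of $a$). $M_n(\mathbf{A}^\#)$ is the presentation of $M_n(\mathbf{A})$ whose special points are the matrices having one special point $v$ of $\mathbf{A}^\#$ in some entry $(r,s)$ and $0$ elsewhere. Let $D_\omega$, $F_\omega$ be the free semigroup and free group on $x_0,x_1,\ldots$, identified with $\mathbb{N}$ computably. A presentation of a semigroup $S$ (resp. group $G$) is a pair $(S,\nu)$ with $\nu:D_\omega\to S$ (resp. $\nu:F_\omega\to G$) an epimorphism; $w$ is a label of $\nu(w)$; the kernel is $\{(w,w'):\nu(w)=\nu(w')\}$;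 the presentation is c.e. (computable) if the kernel is c.e. (computable). A homomorphism is a computable map between presentations if a computable function on words sends each label of $a$ to a label of the image of $a$; presentations are computably isomorphic if some isomorphism is computable in both directions. A subset $X$ is a computable subset of $(S,\nu)$ if the set of labels of elements of $X$ is computable. $\mathcal{D}(\mathbf{A})$ is the abelian semigroup of Murray–von Neumann classes of projections in $\bigcup_n M_n(\mathbf{A})$ with operation induced by $p\oplus q=\mathrm{diag}(p,q)$; $K_0(\mathbf{A})$ is its Grothendieck group with canonical map $\gamma$, and $K_0(\mathbf{A})^+=\{\gamma([p])\}$. A presentation $S^\#$ of $\mathcal{D}(\mathbf{A})$ is computably supported by $\mathbf{A}^\#$ if there is an algorithm which, given $w\in D_\omega$, computes $n,e$ such that $e$ is an $M_n(\mathbf{A}^\#)$-index of a projection $p\in M_n(\mathbf{A})$ with $w$ an $S^\#$-label of $[p]$. For a presentation $S^\#$ of an abelian semigroup $S$, a presentation of its Grothendieck group is $S^\#$-universal if the canonical map $\gamma_S$ is computable from $S^\#$ to it and, for every c.e. presentation $H^\#$ of an abelian group and computable semigroup homomorphism $\phi:S^\#\to H^\#$, the induced group homomorphism $\psi_\phi$ (with $\psi_\phi\circ\gamma_S=\phi$) is computable with index computable from an index of $\phi$. For c.e. $\mathbf{A}^\#$, $K_0(\mathbf{A}^\#)$ denotes a c.e. presentation of $K_0(\mathbf{A})$ that is $S^\#$-universal, where $S^\#$ is a c.e. presentation of $\mathcal{D}(\mathbf{A})$ computably supported by $\mathbf{A}^\#$ (these exist and are unique up to computable isomorphism). *)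

theory Defs
  imports Complex_Main "HOL-Library.Nat_Bijection" "HOL-Library.Countable"
    "HOL-Algebra.Group" "HOL-Algebra.Ring" "Jordan_Normal_Form.Matrix"
begin

section \<open>Partial recursive functions\<close>

text \<open>
  Unary partial recursive functions on \<open>nat\<close>; several arguments are packed with the Cantor
  pairing \<^const>\<open>prod_encode\<close>.  The identity is \<open>CPair CFst CSnd\<close>.
\<close>

datatype code =
    CZero | CSucc | CFst | CSnd
  | CPair code code | CComp code code | CPrec code code | CMu code

inductive runs :: "code \<Rightarrow> nat \<Rightarrow> nat \<Rightarrow> bool" where
  zero: "runs CZero x 0"
| succ: "runs CSucc x (Suc x)"
| fst: "runs CFst (prod_encode (x, y)) x"
| snd: "runs CSnd (prod_encode (x, y)) y"
| pair: "\<lbrakk>runs f x y; runs g x z\<rbrakk> \<Longrightarrow> runs (CPair f g) x (prod_encode (y, z))"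
| comp: "\<lbrakk>runs g x y; runs f y z\<rbrakk> \<Longrightarrow> runs (CComp f g) x z"
| prec_0: "runs f x y \<Longrightarrow> runs (CPrec f g) (prod_encode (x, 0)) y"
| prec_Suc: "\<lbrakk>runs (CPrec f g) (prod_encode (x, n)) y;
              runs g (prod_encode (x, prod_encode (n, y))) z\<rbrakk>
             \<Longrightarrow> runs (CPrec f g) (prod_encode (x, Suc n)) z"
| mu: "\<lbrakk>runs f (prod_encode (x, n)) 0; \<forall>m<n. \<exists>y. runs f (prod_encode (x, m)) (Suc y)\<rbrakk>
       \<Longrightarrow> runs (CMu f) x n"

primrec code_nat :: "code \<Rightarrow> nat" where
  "code_nat CZero = 0"
| "code_nat CSucc = 1"
| "code_nat CFst = 2"
| "code_nat CSnd = 3"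
| "code_nat (CPair f g) = 4 * prod_encode (code_nat f, code_nat g) + 4"
| "code_nat (CComp f g) = 4 * prod_encode (code_nat f, code_nat g) + 5"
| "code_nat (CPrec f g) = 4 * prod_encode (code_nat f, code_nat g) + 6"
| "code_nat (CMu f) = 4 * code_nat f + 7"

text \<open>\<open>phi e x y\<close>: the partial recursive function with index \<open>e\<close> halts on input \<open>x\<close> with output \<open>y\<close>.\<close>

definition phi :: "nat \<Rightarrow> nat \<Rightarrow> nat \<Rightarrow> bool" where
  "phi e x y \<longleftrightarrow> (\<exists>c. code_nat c = e \<and> runs c x y)"

definition computable_set :: "nat set \<Rightarrow> bool" where
  "computable_set X \<longleftrightarrow> (\<exists>e. \<forall>x. phi e x (if x \<in> X then 1 else 0))"

definition ce_set :: "nat set \<Rightarrow> bool" where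
  "ce_set X \<longleftrightarrow> (\<exists>e. \<forall>x. x \<in> X \<longleftrightarrow> (\<exists>y. phi e x y))"

lemma code_nat_inject: "code_nat c = code_nat d \<Longrightarrow> c = d"
proof (induction c arbitrary: d)
  case CZero then show ?case by (cases d) auto
next
  case CSucc then show ?case by (cases d) auto
next
  case CFst then show ?case by (cases d) auto
next
  case CSnd then show ?case by (cases d) auto
next
  case (CPair f g) then show ?case by (cases d) (auto, presburger+)
next
  case (CComp f g) then show ?case by (cases d) (auto, presburger+)
next
  case (CPrec f g) then show ?case by (cases d) (auto, presburger+)
next
  case (CMu f) then show ?case by (cases d) (auto, presburger+)
qed

lemma runs_deterministic: "runs c x y \<Longrightarrow> runs c x z \<Longrightarrow> y = z"
proof (induction arbitrary: z rule: runs.induct)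
  case (pair f x y g z)
  from pair.prems pair.IH show ?case by cases blast
next
  case (comp g x y f w)
  from comp.prems obtain u where "runs g x u" "runs f u z" by cases auto
  with comp.IH show ?case by blast
next
  case (prec_0 f x y g)
  from prec_0.prems prec_0.IH show ?case by cases auto
next
  case (prec_Suc f g x n y w)
  from prec_Suc.prems prec_Suc.IH show ?case by cases auto
next
  case (mu f x n)
  from mu.prems obtain "runs f (prod_encode (x, z)) 0"
    and "\<forall>m<z. \<exists>y. runs f (prod_encode (x, m)) (Suc y)"
    by cases auto
  then show ?case
    using mu.IH by (metis linorder_neqE_nat nat.distinct(1))
qed (auto elim: runs.cases)

lemma phi_deterministic: "phi e x y \<Longrightarrow> phi e x z \<Longrightarrow> y = z"
  unfolding phi_def using code_nat_inject runs_deterministic by blast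

section \<open>Unital C*-algebras\<close>

class cstar_algebra_1 = real_normed_algebra_1 + banach +
  fixes cscale :: "complex \<Rightarrow> 'a \<Rightarrow> 'a"
    and star :: "'a \<Rightarrow> 'a"
  assumes cscale_add_right: "cscale c (x + y) = cscale c x + cscale c y"
    and cscale_add_left: "cscale (c + d) x = cscale c x + cscale d x"
    and cscale_cscale: "cscale c (cscale d x) = cscale (c * d) x"
    and cscale_of_real: "cscale (complex_of_real r) x = r *\<^sub>R x"
    and cscale_mult_left: "cscale c x * y = cscale c (x * y)"
    and cscale_mult_right: "x * cscale c y = cscale c (x * y)"
    and norm_cscale: "norm (cscale c x) = cmod c * norm x"
    and star_star: "star (star x) = x"
    and star_add: "star (x + y) = star x + star y"
    and star_cscale: "star (cscale c x) = cscale (cnj c) (star x)"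
    and star_mult: "star (x * y) = star y * star x"
    and cstar_identity: "norm (star x * x) = (norm x)\<^sup>2"

instantiation complex :: cstar_algebra_1
begin

definition cscale_complex :: "complex \<Rightarrow> complex \<Rightarrow> complex" where
  "cscale_complex c z = c * z"

definition star_complex :: "complex \<Rightarrow> complex" where
  "star_complex z = cnj z"

instance
  by standard
    (simp_all add: cscale_complex_def star_complex_def algebra_simps scaleR_conv_of_real
      norm_mult power2_eq_square)

end

text \<open>
  Matrix algebras of varying size are not types, so the notions that are needed both for a
  C*-algebra and for its matrix algebras are stated for records of operations.
\<close>

record 'b star_alg = "'b ring" +
  adj :: "'b \<Rightarrow> 'b"
  scal :: "complex \<Rightarrow> 'b \<Rightarrow> 'b"
  nrm :: "'b \<Rightarrow> real"

definition type_alg :: "'a::cstar_algebra_1 star_alg" where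
  "type_alg = \<lparr>carrier = UNIV, mult = (*), one = 1, zero = 0, add = (+),
     adj = star, scal = cscale, nrm = norm\<rparr>"

definition mat_star :: "'a::cstar_algebra_1 mat \<Rightarrow> 'a mat" where
  "mat_star M = mat (dim_col M) (dim_row M) (\<lambda>(i, j). star (M $$ (j, i)))"

definition vec_inner :: "'a::cstar_algebra_1 vec \<Rightarrow> 'a" where
  "vec_inner x = (\<Sum>i<dim_vec x. star (x $ i) * x $ i)"

text \<open>
  The C*-norm of \<open>M\<^sub>n(A)\<close>: the operator norm of its action on the Hilbert \<open>A\<close>-module \<open>A\<^sup>n\<close>, which is
  normed by the square root of the norm of \<open>\<Sum>i. x\<^sub>i\<^sup>* x\<^sub>i\<close>.
\<close>

definition mat_norm :: "'a::cstar_algebra_1 mat \<Rightarrow> real" where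
  "mat_norm M = (SUP x \<in> {x \<in> carrier_vec (dim_col M). norm (vec_inner x) \<le> 1}.
                   sqrt (norm (vec_inner (M *\<^sub>v x))))"

definition mat_alg :: "nat \<Rightarrow> 'a::cstar_algebra_1 mat star_alg" where
  "mat_alg n = ring_mat TYPE('a) n
     \<lparr>adj = mat_star, scal = (\<lambda>c. map_mat (cscale c)), nrm = mat_norm\<rparr>"

definition alg_dist :: "'b star_alg \<Rightarrow> 'b \<Rightarrow> 'b \<Rightarrow> real" where
  "alg_dist A a b = nrm A (a \<oplus>\<^bsub>A\<^esub> scal A (-1) b)"

text \<open>\<^const>\<open>ring_hom\<close> preserves the unit.\<close>

definition unital_star_hom :: "'b star_alg \<Rightarrow> 'c star_alg \<Rightarrow> ('b \<Rightarrow> 'c) set" where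
  "unital_star_hom A B = {h \<in> ring_hom A B. \<forall>a\<in>carrier A.
     h (adj A a) = adj B (h a) \<and> (\<forall>c. h (scal A c a) = scal B c (h a))}"

primrec connecting :: "(nat \<Rightarrow> 'b \<Rightarrow> 'b) \<Rightarrow> nat \<Rightarrow> nat \<Rightarrow> 'b \<Rightarrow> 'b" where
  "connecting \<phi> k 0 a = a"
| "connecting \<phi> k (Suc m) a = \<phi> (k + m) (connecting \<phi> k m a)"

text \<open>
  \<open>A\<close> with the maps \<open>\<mu> k\<close> is (up to isomorphism) the inductive limit of
  \<open>B 0 \<rightarrow> B 1 \<rightarrow> \<dots>\<close>, i.e. the completion of the algebraic direct limit in the seminorm
  \<open>\<parallel>a\<parallel> = lim\<^sub>m \<parallel>\<phi>\<^sub>k\<^sub>+\<^sub>m\<^sub>-\<^sub>1 (\<dots> (\<phi>\<^sub>k a))\<parallel>\<close>: the \<open>\<mu> k\<close> induce a map on the direct limit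
  that is isometric for this seminorm and has dense range.
\<close>

definition inductive_limit ::
  "(nat \<Rightarrow> 'b star_alg) \<Rightarrow> (nat \<Rightarrow> 'b \<Rightarrow> 'b) \<Rightarrow> 'c star_alg \<Rightarrow> (nat \<Rightarrow> 'b \<Rightarrow> 'c) \<Rightarrow> bool" where
  "inductive_limit B \<phi> A \<mu> \<longleftrightarrow>
     (\<forall>k. \<mu> k \<in> unital_star_hom (B k) A) \<and>
     (\<forall>k. \<forall>a\<in>carrier (B k). \<mu> (Suc k) (\<phi> k a) = \<mu> k a) \<and>
     (\<forall>k. \<forall>a\<in>carrier (B k). (\<lambda>m. nrm (B (k + m)) (connecting \<phi> k m a)) \<longlonglongrightarrow> nrm A (\<mu> k a)) \<and>
     (\<forall>a\<in>carrier A. \<forall>\<epsilon>>0. \<exists>k. \<exists>b\<in>carrier (B k). alg_dist A (\<mu> k b) a < \<epsilon>)"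

definition UHF :: "'a::cstar_algebra_1 itself \<Rightarrow> bool" where
  "UHF _ \<longleftrightarrow> (\<exists>(d :: nat \<Rightarrow> nat) (\<phi> :: nat \<Rightarrow> complex mat \<Rightarrow> complex mat)
                (\<mu> :: nat \<Rightarrow> complex mat \<Rightarrow> 'a).
     (\<forall>k. 0 < d k) \<and>
     (\<forall>k. \<phi> k \<in> unital_star_hom (mat_alg (d k)) (mat_alg (d (Suc k))) \<and>
          inj_on (\<phi> k) (carrier_mat (d k) (d k))) \<and>
     inductive_limit (\<lambda>k. mat_alg (d k)) \<phi> type_alg \<mu>)"

section \<open>Presentations of C*-algebras\<close>

text \<open>
  Every natural number codes a rational point.  A number \<open>j\<close> codes the letter \<open>v (j div 2)\<close> or its
  adjoint, according to the parity of \<open>j\<close>; monomials are nonempty lists of letters, and a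
  *-polynomial without constant term is a list of pairs of a coefficient from the rational complex
  numbers and a monomial.
\<close>

definition letter :: "'b star_alg \<Rightarrow> (nat \<Rightarrow> 'b) \<Rightarrow> nat \<Rightarrow> 'b" where
  "letter A v j = (if even j then v (j div 2) else adj A (v (j div 2)))"

fun monomial :: "'b star_alg \<Rightarrow> (nat \<Rightarrow> 'b) \<Rightarrow> nat \<Rightarrow> nat list \<Rightarrow> 'b" where
  "monomial A v j [] = letter A v j"
| "monomial A v j (k # ks) = letter A v j \<otimes>\<^bsub>A\<^esub> monomial A v k ks"

definition gauss_rat :: "nat \<Rightarrow> complex" where
  "gauss_rat n = (case prod_decode n of (a, b) \<Rightarrow>
     Complex (of_rat (nat_to_rat_surj a)) (of_rat (nat_to_rat_surj b)))"

definition poly_term :: "'b star_alg \<Rightarrow> (nat \<Rightarrow> 'b) \<Rightarrow> nat \<Rightarrow> 'b" where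
  "poly_term A v t = (case prod_decode t of (c, m) \<Rightarrow> case prod_decode m of (j, ks) \<Rightarrow>
     scal A (gauss_rat c) (monomial A v j (list_decode ks)))"

definition rational_point :: "'b star_alg \<Rightarrow> (nat \<Rightarrow> 'b) \<Rightarrow> nat \<Rightarrow> 'b" where
  "rational_point A v q = foldr (\<lambda>t s. poly_term A v t \<oplus>\<^bsub>A\<^esub> s) (list_decode q) \<zero>\<^bsub>A\<^esub>"

inductive_set star_subalgebra_gen :: "'b star_alg \<Rightarrow> (nat \<Rightarrow> 'b) \<Rightarrow> 'b set"
  for A :: "'b star_alg" and v :: "nat \<Rightarrow> 'b" where
  zero: "\<zero>\<^bsub>A\<^esub> \<in> star_subalgebra_gen A v"
| gen: "v j \<in> star_subalgebra_gen A v"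
| add: "\<lbrakk>a \<in> star_subalgebra_gen A v; b \<in> star_subalgebra_gen A v\<rbrakk>
        \<Longrightarrow> a \<oplus>\<^bsub>A\<^esub> b \<in> star_subalgebra_gen A v"
| mult: "\<lbrakk>a \<in> star_subalgebra_gen A v; b \<in> star_subalgebra_gen A v\<rbrakk>
        \<Longrightarrow> a \<otimes>\<^bsub>A\<^esub> b \<in> star_subalgebra_gen A v"
| adj: "a \<in> star_subalgebra_gen A v \<Longrightarrow> adj A a \<in> star_subalgebra_gen A v"
| scal: "a \<in> star_subalgebra_gen A v \<Longrightarrow> scal A c a \<in> star_subalgebra_gen A v"

definition cstar_presentation :: "'b star_alg \<Rightarrow> (nat \<Rightarrow> 'b) \<Rightarrow> bool" where
  "cstar_presentation A v \<longleftrightarrow> range v \<subseteq> carrier A \<and>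
     (\<forall>a\<in>carrier A. \<forall>\<epsilon>>0. \<exists>b\<in>star_subalgebra_gen A v. alg_dist A b a < \<epsilon>)"

definition computable_cstar_presentation :: "'b star_alg \<Rightarrow> (nat \<Rightarrow> 'b) \<Rightarrow> bool" where
  "computable_cstar_presentation A v \<longleftrightarrow> cstar_presentation A v \<and>
     (\<exists>e. \<forall>q k. \<exists>r. phi e (prod_encode (q, k)) r \<and>
        \<bar>nrm A (rational_point A v q) - of_rat (nat_to_rat_surj r)\<bar> < 1 / 2 ^ k)"

definition point_index :: "'b star_alg \<Rightarrow> (nat \<Rightarrow> 'b) \<Rightarrow> nat \<Rightarrow> 'b \<Rightarrow> bool" where
  "point_index A v e a \<longleftrightarrow> a \<in> carrier A \<and>
     (\<forall>k. \<exists>q. phi e k q \<and> alg_dist A (rational_point A v q) a < 1 / 2 ^ k)"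

text \<open>The special points of the induced presentation of \<open>M\<^sub>n(A)\<close>, listed uniformly in \<open>n\<close>.\<close>

definition mat_special :: "nat \<Rightarrow> (nat \<Rightarrow> 'a::cstar_algebra_1) \<Rightarrow> nat \<Rightarrow> 'a mat" where
  "mat_special n v k = mat n n (\<lambda>(r, s).
     if r = k mod n \<and> s = (k div n) mod n then v (k div (n * n)) else 0)"

section \<open>Presentations of semigroups and groups\<close>

text \<open>
  Semigroups are given by HOL-Algebra's \<open>monoid\<close> records with the unit ignored
  (\<^const>\<open>hom\<close> and \<^const>\<open>epi\<close> do not refer to it).
\<close>

definition free_semigroup :: "nat list monoid" where
  "free_semigroup = \<lparr>carrier = {w. w \<noteq> []}, mult = (@), one = []\<rparr>"

text \<open>Free group: reduced words, with \<open>(i, True)\<close> for \<open>x\<^sub>i\<close> and \<open>(i, False)\<close> for its inverse.\<close>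

type_synonym gword = "(nat \<times> bool) list"

definition inverse_letters :: "nat \<times> bool \<Rightarrow> nat \<times> bool \<Rightarrow> bool" where
  "inverse_letters a b \<longleftrightarrow> fst a = fst b \<and> snd a \<noteq> snd b"

definition cons_reduce :: "nat \<times> bool \<Rightarrow> gword \<Rightarrow> gword" where
  "cons_reduce a w = (case w of [] \<Rightarrow> [a] | b # u \<Rightarrow> if inverse_letters a b then u else a # w)"

definition free_group :: "gword monoid" where
  "free_group = \<lparr>carrier = {w. successively (\<lambda>a b. \<not> inverse_letters a b) w},
     mult = foldr cons_reduce, one = []\<rparr>"

text \<open>
  Words are identified with natural numbers through the injective codings \<^const>\<open>list_encode\<close>
  and \<open>gword_encode\<close>, whose ranges on the two carriers are computable sets.
\<close>

definition gword_encode :: "gword \<Rightarrow> nat" where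
  "gword_encode w = list_encode (map (\<lambda>(i, b). if b then 2 * i else 2 * i + 1) w)"

definition kernel_codes :: "'w monoid \<Rightarrow> ('w \<Rightarrow> nat) \<Rightarrow> ('w \<Rightarrow> 's) \<Rightarrow> nat set" where
  "kernel_codes F c \<nu> =
     {prod_encode (c w, c w') | w w'. w \<in> carrier F \<and> w' \<in> carrier F \<and> \<nu> w = \<nu> w'}"

definition label_codes :: "'w monoid \<Rightarrow> ('w \<Rightarrow> nat) \<Rightarrow> ('w \<Rightarrow> 's) \<Rightarrow> 's set \<Rightarrow> nat set" where
  "label_codes F c \<nu> X = {c w | w. w \<in> carrier F \<and> \<nu> w \<in> X}"

definition ce_semigroup_presentation :: "'s monoid \<Rightarrow> (nat list \<Rightarrow> 's) \<Rightarrow> bool" where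
  "ce_semigroup_presentation S \<sigma> \<longleftrightarrow> \<sigma> \<in> epi free_semigroup S \<and>
     ce_set (kernel_codes free_semigroup list_encode \<sigma>)"

definition ce_group_presentation :: "'g monoid \<Rightarrow> (gword \<Rightarrow> 'g) \<Rightarrow> bool" where
  "ce_group_presentation G \<kappa> \<longleftrightarrow> \<kappa> \<in> epi free_group G \<and>
     ce_set (kernel_codes free_group gword_encode \<kappa>)"

definition computable_group_presentation :: "'g monoid \<Rightarrow> (gword \<Rightarrow> 'g) \<Rightarrow> bool" where
  "computable_group_presentation G \<kappa> \<longleftrightarrow> \<kappa> \<in> epi free_group G \<and>
     computable_set (kernel_codes free_group gword_encode \<kappa>)"

definition computable_group_subset :: "'g monoid \<Rightarrow> (gword \<Rightarrow> 'g) \<Rightarrow> 'g set \<Rightarrow> bool" where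
  "computable_group_subset G \<kappa> X \<longleftrightarrow> X \<subseteq> carrier G \<and>
     computable_set (label_codes free_group gword_encode \<kappa> X)"

definition semigroup_group_map_index ::
  "(nat list \<Rightarrow> 's) \<Rightarrow> (gword \<Rightarrow> 'g) \<Rightarrow> ('s \<Rightarrow> 'g) \<Rightarrow> nat \<Rightarrow> bool" where
  "semigroup_group_map_index \<sigma> \<kappa> h e \<longleftrightarrow>
     (\<forall>w\<in>carrier free_semigroup. \<exists>u\<in>carrier free_group.
        phi e (list_encode w) (gword_encode u) \<and> \<kappa> u = h (\<sigma> w))"

definition group_map_index ::
  "(gword \<Rightarrow> 'g) \<Rightarrow> (gword \<Rightarrow> 'h) \<Rightarrow> ('g \<Rightarrow> 'h) \<Rightarrow> nat \<Rightarrow> bool" where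
  "group_map_index \<kappa> \<eta> h e \<longleftrightarrow>
     (\<forall>w\<in>carrier free_group. \<exists>u\<in>carrier free_group.
        phi e (gword_encode w) (gword_encode u) \<and> \<eta> u = h (\<kappa> w))"

section \<open>Grothendieck groups\<close>

definition groth_rel :: "'s monoid \<Rightarrow> (('s \<times> 's) \<times> ('s \<times> 's)) set" where
  "groth_rel S = {((x, y), (x', y')). {x, y, x', y'} \<subseteq> carrier S \<and>
     (\<exists>z\<in>carrier S. (x \<otimes>\<^bsub>S\<^esub> y') \<otimes>\<^bsub>S\<^esub> z = (x' \<otimes>\<^bsub>S\<^esub> y) \<otimes>\<^bsub>S\<^esub> z)}"

definition grothendieck :: "'s monoid \<Rightarrow> ('s \<times> 's) set monoid" where
  "grothendieck S = \<lparr>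
     carrier = (carrier S \<times> carrier S) // groth_rel S,
     mult = (\<lambda>X Y. \<Union>(x, y)\<in>X. \<Union>(x', y')\<in>Y. groth_rel S `` {(x \<otimes>\<^bsub>S\<^esub> x', y \<otimes>\<^bsub>S\<^esub> y')}),
     one = groth_rel S `` {(x, x) | x. x \<in> carrier S}\<rparr>"

definition groth_map :: "'s monoid \<Rightarrow> 's \<Rightarrow> ('s \<times> 's) set" where
  "groth_map S x = groth_rel S `` {(x \<otimes>\<^bsub>S\<^esub> x, x)}"

text \<open>
  A presented group is countable, so the test groups \<open>H\<close> may be taken with carrier contained in
  \<open>nat\<close>.  The index of the induced map \<open>\<psi>\<close> is obtained from an index \<open>e\<close> of \<open>\<phi>\<close> by a single
  partial recursive function, with index \<open>d\<close>.
\<close>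

definition universal_presentation ::
  "'s monoid \<Rightarrow> (nat list \<Rightarrow> 's) \<Rightarrow> (gword \<Rightarrow> ('s \<times> 's) set) \<Rightarrow> bool" where
  "universal_presentation S \<sigma> \<kappa> \<longleftrightarrow>
     (\<exists>e. semigroup_group_map_index \<sigma> \<kappa> (groth_map S) e) \<and>
     (\<exists>d. \<forall>(H :: nat monoid) \<eta> \<phi> e \<psi>.
        comm_group H \<longrightarrow> ce_group_presentation H \<eta> \<longrightarrow>
        \<phi> \<in> hom S H \<longrightarrow> semigroup_group_map_index \<sigma> \<eta> \<phi> e \<longrightarrow>
        \<psi> \<in> hom (grothendieck S) H \<longrightarrow> (\<forall>x\<in>carrier S. \<psi> (groth_map S x) = \<phi> x) \<longrightarrow>
        (\<exists>e'. phi d e e' \<and> group_map_index \<kappa> \<eta> \<psi> e'))"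

section \<open>Projections and K-theory\<close>

definition projections :: "nat \<Rightarrow> 'a::cstar_algebra_1 mat set" where
  "projections n = {p \<in> carrier_mat n n. p * p = p \<and> mat_star p = p}"

definition all_projections :: "'a::cstar_algebra_1 mat set" where
  "all_projections = (\<Union>n\<in>{0<..}. projections n)"

definition mvn_rel :: "('a::cstar_algebra_1 mat \<times> 'a mat) set" where
  "mvn_rel = {(p, q). p \<in> all_projections \<and> q \<in> all_projections \<and>
     (\<exists>v\<in>carrier_mat (dim_row q) (dim_row p). p = mat_star v * v \<and> q = v * mat_star v)}"

definition mvn_class :: "'a::cstar_algebra_1 mat \<Rightarrow> 'a mat set" where
  "mvn_class p = mvn_rel `` {p}"

definition diag_sum :: "'a::cstar_algebra_1 mat \<Rightarrow> 'a mat \<Rightarrow> 'a mat" where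
  "diag_sum p q = four_block_mat p (0\<^sub>m (dim_row p) (dim_col q)) (0\<^sub>m (dim_row q) (dim_col p)) q"

definition MvN :: "'a::cstar_algebra_1 mat set monoid" where
  "MvN = \<lparr>carrier = all_projections // mvn_rel,
     mult = (\<lambda>X Y. \<Union>p\<in>X. \<Union>q\<in>Y. mvn_class (diag_sum p q)),
     one = mvn_class (0\<^sub>m 1 1)\<rparr>"

definition K0 :: "('a::cstar_algebra_1 mat set \<times> 'a mat set) set monoid" where
  "K0 = grothendieck MvN"

definition K0_pos :: "('a::cstar_algebra_1 mat set \<times> 'a mat set) set set" where
  "K0_pos = groth_map MvN ` carrier MvN"

definition computably_supported ::
  "(nat \<Rightarrow> 'a::cstar_algebra_1) \<Rightarrow> (nat list \<Rightarrow> 'a mat set) \<Rightarrow> bool" where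
  "computably_supported v \<sigma> \<longleftrightarrow> (\<exists>d. \<forall>w\<in>carrier free_semigroup. \<exists>n e p.
     phi d (list_encode w) (prod_encode (n, e)) \<and> 0 < n \<and> p \<in> projections n \<and>
     point_index (mat_alg n) (mat_special n v) e p \<and> \<sigma> w = mvn_class p)"

text \<open>
  \<open>\<kappa>\<close> represents \<open>K\<^sub>0\<close> of the presentation \<open>v\<close>; such a presentation is determined only up to
  computable isomorphism.
\<close>

definition K0_presentation ::
  "(nat \<Rightarrow> 'a::cstar_algebra_1) \<Rightarrow> (gword \<Rightarrow> ('a mat set \<times> 'a mat set) set) \<Rightarrow> bool" where
  "K0_presentation v \<kappa> \<longleftrightarrow> ce_group_presentation K0 \<kappa> \<and>
     (\<exists>\<sigma>. ce_semigroup_presentation MvN \<sigma> \<and> computably_supported v \<sigma> \<and>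
          universal_presentation MvN \<sigma> \<kappa>)"

end

theory Submission
  imports Defs "Jordan_Normal_Form.Determinant"
begin

text \<open>
  The \<open>K\<^sub>0\<close>-group of a UHF algebra embeds into the rational numbers, the positive cone being the
  elements with nonnegative image.  For a presentation of a subgroup of the rational numbers a c.e.
  kernel is already enough: if the generator \<open>x\<^sub>j\<close> is not trivial, then for every generator \<open>x\<^sub>i\<close>
  a relation \<open>x\<^sub>i\<^sup>m = x\<^sub>j\<^sup>k\<close> with \<open>m > 0\<close> is found by search, which gives the ratio of the two
  generators, and then equality and sign of words are decided by rational arithmetic.

  For the embedding, let \<open>\<zeta>\<^sub>k\<close> be the class of a minimal projection at the \<open>k\<close>-th level, of matrix
  size \<open>d\<^sub>k\<close>.  A projection over the algebra is close to a matrix with entries at some level, hence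
  equivalent to a projection with entries there, and so its class is \<open>r \<zeta>\<^sub>k\<close> for some \<open>r\<close>.  Its
  image is \<open>r / d\<^sub>k\<close>, because \<open>d\<^sub>k \<zeta>\<^sub>k = [1]\<close> and the multiples of \<open>[1]\<close> are distinct.
\<close>

section \<open>Total computable functions\<close>

text \<open>The decision procedures are non-uniform: they contain the number of one generator with
  nonzero value, if there is one, while the embedding into the rational numbers enters only in the
  proof of their correctness. Ratios suffice because equality and sign of words do not change when
  all values are divided by one positive number. For the embedding, the obstacle is to move a
  projection to a finite level without functional calculus. Inverse square roots near 1 are limits
  of a contraction. Whatever must be known about such a limit (selfadjoint, commuting with given
  elements, of bounded size, with entries at a given level) is expressed as membership in a closed
  subalgebra, which the iteration never leaves. A submultiplicative norm with isometric adjoint,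
  complete on each fixed size, is enough for this, so the sum of the norms of the entries replaces
  the operator norm. No trace on the algebra is constructed: the multiples of [1] are separated by
  counting dimensions at a finite level, and the number r is the trace of a complex
  projection.\<close>

definition tc :: "(nat \<Rightarrow> nat) \<Rightarrow> bool" where
  "tc f \<longleftrightarrow> (\<exists>c. \<forall>x. runs c x (f x))"

abbreviation pair_fst :: "nat \<Rightarrow> nat" where "pair_fst z \<equiv> fst (prod_decode z)"
abbreviation pair_snd :: "nat \<Rightarrow> nat" where "pair_snd z \<equiv> snd (prod_decode z)"

lemma runs_pair_fst: "runs CFst z (pair_fst z)"
  using runs.fst[of "pair_fst z" "pair_snd z"] by simp

lemma runs_pair_snd: "runs CSnd z (pair_snd z)"
  using runs.snd[of "pair_fst z" "pair_snd z"] by simp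

lemma tc_id: "tc (\<lambda>x. x)"
proof -
  have "runs (CPair CFst CSnd) x x" for x
    using runs.pair[OF runs_pair_fst runs_pair_snd] by (metis prod.collapse prod_decode_inverse)
  then show ?thesis unfolding tc_def by blast
qed

lemma tc_comp:
  assumes "tc f" "tc g"
  shows "tc (\<lambda>x. f (g x))"
proof -
  obtain c d where "\<forall>x. runs c x (f x)" "\<forall>x. runs d x (g x)"
    using assms unfolding tc_def by blast
  then have "\<forall>x. runs (CComp c d) x (f (g x))" by (blast intro: runs.comp)
  then show ?thesis unfolding tc_def by blast
qed

lemma tc_Suc: "tc f \<Longrightarrow> tc (\<lambda>x. Suc (f x))"
  using tc_comp[of Suc f] unfolding tc_def by (blast intro: runs.succ)

lemma tc_const: "tc (\<lambda>x. k)"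
proof (induction k)
  case 0
  show ?case unfolding tc_def by (blast intro: runs.zero)
qed (rule tc_Suc)

lemma tc_fst: "tc f \<Longrightarrow> tc (\<lambda>x. pair_fst (f x))"
  using tc_comp[of pair_fst f] runs_pair_fst unfolding tc_def by blast

lemma tc_snd: "tc f \<Longrightarrow> tc (\<lambda>x. pair_snd (f x))"
  using tc_comp[of pair_snd f] runs_pair_snd unfolding tc_def by blast

lemma tc_pair: "tc f \<Longrightarrow> tc g \<Longrightarrow> tc (\<lambda>x. prod_encode (f x, g x))"
  unfolding tc_def by (blast intro: runs.pair)

lemma tc_rec_aux:
  assumes "tc b" "tc s"
  shows "tc (\<lambda>z. rec_nat (b (pair_fst z))
           (\<lambda>i y. s (prod_encode (pair_fst z, prod_encode (i, y)))) (pair_snd z))"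
proof -
  obtain c d where c: "\<And>x. runs c x (b x)" and d: "\<And>x. runs d x (s x)"
    using assms unfolding tc_def by blast
  have "runs (CPrec c d) (prod_encode (x, n))
      (rec_nat (b x) (\<lambda>i y. s (prod_encode (x, prod_encode (i, y)))) n)" for x n
  proof (induction n)
    case 0
    show ?case using runs.prec_0[OF c] by simp
  next
    case (Suc n)
    show ?case using runs.prec_Suc[OF Suc d] by simp
  qed
  then have "runs (CPrec c d) z (rec_nat (b (pair_fst z))
      (\<lambda>i y. s (prod_encode (pair_fst z, prod_encode (i, y)))) (pair_snd z))" for z
    by (metis prod.collapse prod_decode_inverse)
  then show ?thesis unfolding tc_def by blast
qed

text \<open>\<open>CPrec\<close> carries a fixed parameter through the recursion. Passing x itself
  as the parameter lets start value, step and number of iterations all depend on x.\<close>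

lemma tc_rec:
  assumes "tc b" "tc n"
    and "tc (\<lambda>z. s (pair_fst z) (pair_fst (pair_snd z)) (pair_snd (pair_snd z)))"
  shows "tc (\<lambda>x. rec_nat (b x) (s x) (n x))"
  using tc_comp[OF tc_rec_aux[OF assms(1,3)] tc_pair[OF tc_id assms(2)]] by simp

text \<open>A run of \<open>CMu\<close> needs a successor value at every place before the first
  zero. Totality of f provides these values, and the assumed zero stops the search.\<close>

lemma tc_Least:
  assumes "tc (\<lambda>z. f (pair_fst z) (pair_snd z))" and ex: "\<And>x. \<exists>n. f x n = 0"
  shows "tc (\<lambda>x. LEAST n. f x n = 0)"
proof -
  obtain c where c: "\<And>z. runs c z (f (pair_fst z) (pair_snd z))"
    using assms unfolding tc_def by blast
  have "runs (CMu c) x (LEAST n. f x n = 0)" for x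
  proof (rule runs.mu)
    show "runs c (prod_encode (x, LEAST n. f x n = 0)) 0"
      using c[of "prod_encode (x, LEAST n. f x n = 0)"] LeastI_ex[OF ex] by simp
    show "\<forall>m<LEAST n. f x n = 0. \<exists>y. runs c (prod_encode (x, m)) (Suc y)"
    proof (intro allI impI)
      fix m assume "m < (LEAST n. f x n = 0)"
      then have "f x m \<noteq> 0" using not_less_Least by blast
      then show "\<exists>y. runs c (prod_encode (x, m)) (Suc y)"
        using c[of "prod_encode (x, m)"] by (metis fst_conv not0_implies_Suc prod_encode_inverse snd_conv)
    qed
  qed
  then show ?thesis unfolding tc_def by blast
qed

text \<open>Case distinction is a recursion whose step ignores the previous value.\<close>

lemma tc_if_eq_0:
  assumes "tc c" "tc f" "tc g"
  shows "tc (\<lambda>x. if c x = 0 then f x else g x)"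
proof -
  have "(\<lambda>x. if c x = 0 then f x else g x) = (\<lambda>x. rec_nat (f x) (\<lambda>_ _. g x) (c x))"
    by (rule ext, rename_tac x, case_tac "c x") auto
  moreover have "tc (\<lambda>x. rec_nat (f x) (\<lambda>_ _. g x) (c x))"
    by (rule tc_rec) (intro assms tc_comp[OF assms(3)] tc_fst tc_id)+
  ultimately show ?thesis by simp
qed

lemma tc_add:
  assumes "tc f" "tc g"
  shows "tc (\<lambda>x. f x + g x)"
proof -
  have "rec_nat a (\<lambda>_ y. Suc y) n = a + n" for a n :: nat by (induction n) auto
  moreover have "tc (\<lambda>x. rec_nat (f x) (\<lambda>_ y. Suc y) (g x))"
    by (rule tc_rec) (intro assms tc_Suc tc_snd tc_id)+
  ultimately show ?thesis by simp
qed

lemma tc_mult: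
  assumes "tc f" "tc g"
  shows "tc (\<lambda>x. f x * g x)"
proof -
  have "rec_nat 0 (\<lambda>_ y. a + y) n = a * n" for a n :: nat by (induction n) auto
  moreover have "tc (\<lambda>x. rec_nat 0 (\<lambda>_ y. f x + y) (g x))"
    by (rule tc_rec) (intro assms tc_add tc_comp[OF assms(1)] tc_const tc_fst tc_snd tc_id)+
  ultimately show ?thesis by simp
qed

lemma tc_minus_1:
  assumes "tc f"
  shows "tc (\<lambda>x. f x - 1)"
proof -
  have "rec_nat 0 (\<lambda>i _. i) n = n - 1" for n :: nat by (induction n) auto
  moreover have "tc (\<lambda>x. rec_nat 0 (\<lambda>i _. i) (f x))"
    by (rule tc_rec) (intro assms tc_const tc_fst tc_snd tc_id)+
  ultimately show ?thesis by simp
qed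

lemma tc_diff:
  assumes "tc f" "tc g"
  shows "tc (\<lambda>x. f x - g x)"
proof -
  have "rec_nat a (\<lambda>_ y. y - 1) n = a - n" for a n :: nat by (induction n) auto
  moreover have "tc (\<lambda>x. rec_nat (f x) (\<lambda>_ y. y - 1) (g x))"
    by (rule tc_rec) (intro assms tc_minus_1 tc_snd tc_id)+
  ultimately show ?thesis by simp
qed

definition tc_pred :: "(nat \<Rightarrow> bool) \<Rightarrow> bool" where
  "tc_pred P \<longleftrightarrow> tc (\<lambda>x. if P x then 1 else 0)"

lemma tc_if:
  assumes "tc_pred P" "tc f" "tc g"
  shows "tc (\<lambda>x. if P x then f x else g x)"
proof -
  have "(\<lambda>x. if P x then f x else g x) = (\<lambda>x. if (if P x then 1 else 0 :: nat) = 0 then g x else f x)"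
    by auto
  then show ?thesis using tc_if_eq_0[OF assms(1)[unfolded tc_pred_def] assms(3,2)] by simp
qed

lemma tc_pred_not:
  assumes "tc_pred P"
  shows "tc_pred (\<lambda>x. \<not> P x)"
proof -
  have "(\<lambda>x. if \<not> P x then 1 else 0 :: nat) = (\<lambda>x. if P x then 0 else 1)" by auto
  then show ?thesis using tc_if[OF assms tc_const tc_const, of 0 1] unfolding tc_pred_def by simp
qed

lemma tc_pred_conj: "tc_pred P \<Longrightarrow> tc_pred Q \<Longrightarrow> tc_pred (\<lambda>x. P x \<and> Q x)"
proof -
  assume "tc_pred P" "tc_pred Q"
  then have "tc (\<lambda>x. if P x then if Q x then 1 else 0 else 0)"
    using tc_if[OF _ _ tc_const] unfolding tc_pred_def by blast
  moreover have "(\<lambda>x. if P x then if Q x then 1 else 0 else 0 :: nat) = (\<lambda>x. if P x \<and> Q x then 1 else 0)"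
    by auto
  ultimately show ?thesis unfolding tc_pred_def by simp
qed

lemma tc_pred_disj: "tc_pred P \<Longrightarrow> tc_pred Q \<Longrightarrow> tc_pred (\<lambda>x. P x \<or> Q x)"
  using tc_pred_not[OF tc_pred_conj[OF tc_pred_not tc_pred_not, of P Q]] by simp

lemma tc_pred_le:
  assumes "tc f" "tc g"
  shows "tc_pred (\<lambda>x. f x \<le> g x)"
proof -
  have "(\<lambda>x. if f x \<le> g x then 1 else 0 :: nat) = (\<lambda>x. if f x - g x = 0 then 1 else 0)" by auto
  then show ?thesis unfolding tc_pred_def
    using tc_if_eq_0[OF tc_diff[OF assms] tc_const tc_const, of 1 0] by simp
qed

lemma tc_pred_eq: "tc f \<Longrightarrow> tc g \<Longrightarrow> tc_pred (\<lambda>x. f x = g x)"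
  using tc_pred_conj[OF tc_pred_le[of f g] tc_pred_le[of g f]] by (simp add: eq_iff)

lemmas tc_intros = tc_id tc_const tc_Suc tc_fst tc_snd tc_pair tc_add tc_mult tc_diff tc_if
  tc_pred_not tc_pred_conj tc_pred_disj tc_pred_le tc_pred_eq

lemma computable_setI: "tc_pred (\<lambda>x. x \<in> X) \<Longrightarrow> computable_set X"
  unfolding tc_pred_def tc_def computable_set_def phi_def by blast

lemma tc_Least_pred:
  assumes "tc_pred (\<lambda>z. P (pair_fst z) (pair_snd z))" and "\<And>x. \<exists>n. P x n"
  shows "tc (\<lambda>x. LEAST n. P x n)"
proof -
  have "(if P x n then 0 else 1 :: nat) = 0 \<longleftrightarrow> P x n" for x n by simp
  then show ?thesis
    using tc_Least[of "\<lambda>x n. if P x n then 0 else 1"] tc_if[OF assms(1) tc_const tc_const, of 0 1] assms(2)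
    by presburger
qed

section \<open>Step-bounded evaluation\<close>

text \<open>The value \<open>0\<close> means that no result was found within the bound, and \<open>Suc y\<close> is the result \<open>y\<close>.\<close>

primrec bounded_eval :: "code \<Rightarrow> nat \<Rightarrow> nat \<Rightarrow> nat" where
  "bounded_eval CZero x t = 1"
| "bounded_eval CSucc x t = Suc (Suc x)"
| "bounded_eval CFst x t = Suc (pair_fst x)"
| "bounded_eval CSnd x t = Suc (pair_snd x)"
| "bounded_eval (CPair f g) x t =
     (if bounded_eval f x t = 0 \<or> bounded_eval g x t = 0 then 0
      else Suc (prod_encode (bounded_eval f x t - 1, bounded_eval g x t - 1)))"
| "bounded_eval (CComp f g) x t =
     (if bounded_eval g x t = 0 then 0 else bounded_eval f (bounded_eval g x t - 1) t)"
| "bounded_eval (CPrec f g) x t =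
     rec_nat (bounded_eval f (pair_fst x) t)
       (\<lambda>n r. if r = 0 then 0
              else bounded_eval g (prod_encode (pair_fst x, prod_encode (n, r - 1))) t) (pair_snd x)"
| "bounded_eval (CMu f) x t =
     (let n = (LEAST n. t \<le> n \<or> bounded_eval f (prod_encode (x, n)) t \<le> 1)
      in if n < t \<and> bounded_eval f (prod_encode (x, n)) t = 1 then Suc n else 0)"

text \<open>The induction is on the structure of a fixed code, so one function is built for each
  code instead of a universal one. Only \<open>CMu\<close> uses the bound t; the disjunct
  \<open>t \<le> n\<close> supplies a witness for the least number and so makes the search
  total.\<close>

lemma tc_bounded_eval: "tc (\<lambda>z. bounded_eval c (pair_fst z) (pair_snd z))"
proof (induction c)
  case (CPair f g)
  then show ?case by (simp only: bounded_eval.simps) (intro tc_intros)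
next
  case (CComp f g)
  have "tc (\<lambda>z. bounded_eval f (bounded_eval g (pair_fst z) (pair_snd z) - 1) (pair_snd z))"
    using tc_comp[OF CComp(1) tc_pair[OF tc_diff[OF CComp(2) tc_const[of 1]] tc_snd[OF tc_id]]] by simp
  then show ?case using CComp by (simp only: bounded_eval.simps) (intro tc_intros)
next
  case (CPrec f g)
  have f: "tc h \<Longrightarrow> tc k \<Longrightarrow> tc (\<lambda>z. bounded_eval f (h z) (k z))" for h k
    using tc_comp[OF CPrec(1) tc_pair] by simp
  have g: "tc h \<Longrightarrow> tc k \<Longrightarrow> tc (\<lambda>z. bounded_eval g (h z) (k z))" for h k
    using tc_comp[OF CPrec(2) tc_pair] by simp
  show ?case by (simp only: bounded_eval.simps) (rule tc_rec; intro f g tc_intros)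
next
  case (CMu f)
  have f: "tc h \<Longrightarrow> tc k \<Longrightarrow> tc (\<lambda>z. bounded_eval f (h z) (k z))" for h k
    using tc_comp[OF CMu tc_pair] by simp
  have "tc (\<lambda>z. LEAST n. pair_snd z \<le> n \<or> bounded_eval f (prod_encode (pair_fst z, n)) (pair_snd z) \<le> 1)"
    by (rule tc_Least_pred) (intro f tc_intros, auto)
  then show ?case unfolding bounded_eval.simps Let_def less_le
    by (intro f tc_intros)
qed (simp only: bounded_eval.simps, intro tc_intros)+

lemma bounded_eval_mono: "bounded_eval c x t = Suc y \<Longrightarrow> t \<le> t' \<Longrightarrow> bounded_eval c x t' = Suc y"
proof (induction c arbitrary: x y)
  case (CPair f g)
  then obtain a b where "bounded_eval f x t = Suc a" "bounded_eval g x t = Suc b"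
    by (auto split: if_splits simp: gr0_conv_Suc)
  with CPair show ?case by simp
next
  case (CComp f g)
  then obtain a where "bounded_eval g x t = Suc a"
    by (auto split: if_splits simp: gr0_conv_Suc)
  with CComp show ?case by simp
next
  case (CPrec f g)
  define R where "R t n = rec_nat (bounded_eval f (pair_fst x) t)
       (\<lambda>n r. if r = 0 then 0
              else bounded_eval g (prod_encode (pair_fst x, prod_encode (n, r - 1))) t) n" for t n
  have "R t n = Suc y \<Longrightarrow> R t' n = Suc y" for n y
  proof (induction n arbitrary: y)
    case 0
    then show ?case using CPrec.IH(1) CPrec.prems(2) by (simp add: R_def)
  next
    case (Suc n)
    then obtain a where "R t n = Suc a" by (auto simp: R_def gr0_conv_Suc split: if_splits)
    with Suc CPrec.IH(2) CPrec.prems(2) show ?case by (simp add: R_def)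
  qed
  with CPrec.prems show ?case by (simp add: R_def)
next
  case (CMu f)
  let ?P = "\<lambda>t n. t \<le> n \<or> bounded_eval f (prod_encode (x, n)) t \<le> 1"
  have y: "y < t" "bounded_eval f (prod_encode (x, y)) t = 1" "y = (LEAST n. ?P t n)"
    using CMu.prems(1) by (auto simp: Let_def split: if_splits)
  \<comment> \<open>Before the point found, every value is at least 2, that is, a computed positive
    result. These values persist for the larger bound, so the search cannot stop earlier
    there.\<close>
  have less: "\<exists>a. bounded_eval f (prod_encode (x, m)) t = Suc (Suc a)" if "m < y" for m
    using not_less_Least[of m "?P t"] that y(3)
    by (cases "bounded_eval f (prod_encode (x, m)) t") (auto simp: gr0_conv_Suc)
  have y': "bounded_eval f (prod_encode (x, y)) t' = 1"
    using CMu.IH[of "prod_encode (x, y)" 0] y(2) CMu.prems(2) by simp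
  have "(LEAST n. ?P t' n) = y"
  proof (rule Least_equality)
    fix m assume m: "?P t' m"
    show "y \<le> m"
    proof (rule ccontr)
      assume "\<not> y \<le> m"
      then obtain a where "bounded_eval f (prod_encode (x, m)) t = Suc (Suc a)" using less[of m] by auto
      then have "bounded_eval f (prod_encode (x, m)) t' = Suc (Suc a)" using CMu by blast
      with m \<open>\<not> y \<le> m\<close> y(1) CMu.prems(2) show False by simp
    qed
  qed (simp add: y')
  then show ?case using y(1) y' CMu.prems(2) by (simp add: Let_def)
qed auto

lemma bounded_eval_sound: "bounded_eval c x t = Suc y \<Longrightarrow> runs c x y"
proof (induction c arbitrary: x y)
  case CZero then show ?case by (auto intro: runs.intros)
next
  case CSucc then show ?case by (auto intro: runs.intros)
next
  case CFst then show ?case using runs_pair_fst by auto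
next
  case CSnd then show ?case using runs_pair_snd by auto
next
  case (CPair f g)
  then obtain a b where "bounded_eval f x t = Suc a" "bounded_eval g x t = Suc b"
    by (auto split: if_splits simp: gr0_conv_Suc)
  with CPair show ?case by (auto intro: runs.intros)
next
  case (CComp f g)
  then obtain a where "bounded_eval g x t = Suc a"
    by (auto split: if_splits simp: gr0_conv_Suc)
  moreover have "bounded_eval f a t = Suc y" using CComp.prems calculation by simp
  ultimately show ?case using CComp.IH by (blast intro: runs.comp)
next
  case (CPrec f g)
  define R where "R n = rec_nat (bounded_eval f (pair_fst x) t)
       (\<lambda>n r. if r = 0 then 0
              else bounded_eval g (prod_encode (pair_fst x, prod_encode (n, r - 1))) t) n" for n
  have "R n = Suc y \<Longrightarrow> runs (CPrec f g) (prod_encode (pair_fst x, n)) y" for n y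
  proof (induction n arbitrary: y)
    case 0
    then show ?case using CPrec.IH(1) by (auto simp: R_def intro: runs.intros)
  next
    case (Suc n)
    then obtain a where "R n = Suc a" by (auto simp: R_def gr0_conv_Suc split: if_splits)
    with Suc CPrec.IH(2) show ?case by (auto simp: R_def intro: runs.intros)
  qed
  from this[of "pair_snd x" y] CPrec.prems show ?case by (simp add: R_def)
next
  case (CMu f)
  let ?P = "\<lambda>n. t \<le> n \<or> bounded_eval f (prod_encode (x, n)) t \<le> 1"
  have y: "bounded_eval f (prod_encode (x, y)) t = Suc 0" "y = (LEAST n. ?P n)"
    using CMu.prems by (auto simp: Let_def split: if_splits)
  show ?case
  proof (rule runs.mu)
    show "runs f (prod_encode (x, y)) 0" using CMu.IH y(1) by simp
    show "\<forall>m<y. \<exists>z. runs f (prod_encode (x, m)) (Suc z)"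
    proof (intro allI impI)
      fix m assume "m < y"
      then have "\<not> ?P m" using not_less_Least y(2) by blast
      then obtain a where "bounded_eval f (prod_encode (x, m)) t = Suc (Suc a)"
        by (metis One_nat_def not0_implies_Suc not_less_eq_eq zero_le le_SucI)
      then show "\<exists>z. runs f (prod_encode (x, m)) (Suc z)" using CMu.IH by blast
    qed
  qed
qed

lemma bounded_eval_complete: "runs c x y \<Longrightarrow> \<exists>t. bounded_eval c x t = Suc y"
proof (induction rule: runs.induct)
  case (pair f x y g z)
  then obtain s t where "bounded_eval f x s = Suc y" "bounded_eval g x t = Suc z" by blast
  then have "bounded_eval f x (max s t) = Suc y" "bounded_eval g x (max s t) = Suc z"
    by (auto intro: bounded_eval_mono)
  then show ?case by (intro exI[of _ "max s t"]) simp
next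
  case (comp g x y f z)
  then obtain s t where "bounded_eval g x s = Suc y" "bounded_eval f y t = Suc z" by blast
  then have "bounded_eval g x (max s t) = Suc y" "bounded_eval f y (max s t) = Suc z"
    by (auto intro: bounded_eval_mono)
  then show ?case by (intro exI[of _ "max s t"]) simp
next
  case (prec_Suc f g x n y z)
  then obtain s t where "bounded_eval (CPrec f g) (prod_encode (x, n)) s = Suc y"
    "bounded_eval g (prod_encode (x, prod_encode (n, y))) t = Suc z" by blast
  then have "bounded_eval (CPrec f g) (prod_encode (x, n)) (max s t) = Suc y"
    "bounded_eval g (prod_encode (x, prod_encode (n, y))) (max s t) = Suc z"
    by (blast intro: bounded_eval_mono max.cobounded1 max.cobounded2)+
  then show ?case by (intro exI[of _ "max s t"]) (simp cong: if_cong)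
next
  case (mu f x n)
  then obtain t0 where t0: "bounded_eval f (prod_encode (x, n)) t0 = Suc 0" by blast
  have "\<forall>m. \<exists>t. m < n \<longrightarrow> (\<exists>a. bounded_eval f (prod_encode (x, m)) t = Suc (Suc a))"
    using mu by blast
  then obtain T where T: "\<And>m. m < n \<Longrightarrow> \<exists>a. bounded_eval f (prod_encode (x, m)) (T m) = Suc (Suc a)"
    by metis
  \<comment> \<open>\<open>Suc n\<close> lets the search reach n; the other summands dominate the
    bounds that belong to the single values.\<close>
  define t where "t = Suc n + t0 + (\<Sum>m<n. T m)"
  have n: "bounded_eval f (prod_encode (x, n)) t = Suc 0"
    by (rule bounded_eval_mono[OF t0]) (simp add: t_def)
  have less: "\<exists>a. bounded_eval f (prod_encode (x, m)) t = Suc (Suc a)" if "m < n" for m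
  proof -
    have "T m \<le> (\<Sum>m<n. T m)" using that by (intro member_le_sum) auto
    then have "T m \<le> t" by (simp add: t_def)
    with T[OF that] show ?thesis by (blast intro: bounded_eval_mono)
  qed
  have "(LEAST k. t \<le> k \<or> bounded_eval f (prod_encode (x, k)) t \<le> 1) = n"
  proof (rule Least_equality)
    fix m assume m: "t \<le> m \<or> bounded_eval f (prod_encode (x, m)) t \<le> 1"
    show "n \<le> m"
    proof (rule ccontr)
      assume "\<not> n \<le> m"
      with less[of m] m show False by (auto simp: t_def)
    qed
  qed (simp add: n)
  with n show ?case by (intro exI[of _ t]) (simp add: Let_def t_def)
qed auto

text \<open>Dovetailing: one search runs over pairs of a candidate and a step bound for the
  procedure that enumerates W, and it ends because for every i some candidate lies in W.\<close>

lemma ce_search: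
  assumes "ce_set W" and P: "tc (\<lambda>z. P (pair_fst z) (pair_snd z))" and ex: "\<And>i. \<exists>n. P i n \<in> W"
  obtains s where "tc s" "\<And>i. P i (s i) \<in> W"
proof -
  obtain c where "\<And>x. x \<in> W \<longleftrightarrow> (\<exists>y. runs c x y)"
  proof -
    obtain e where e: "\<And>x. x \<in> W \<longleftrightarrow> (\<exists>y. phi e x y)"
      using assms(1) unfolding ce_set_def by blast
    show ?thesis
    proof (cases "\<exists>c. code_nat c = e")
      case True
      then show ?thesis using that e unfolding phi_def by (metis code_nat_inject)
    next
      \<comment> \<open>A number that is not the number of a code is an index of the nowhere defined
        function.\<close>
      case False
      then have "W = {}" using e unfolding phi_def by blast
      with ex show ?thesis by blast
    qed
  qed
  then have W: "x \<in> W \<longleftrightarrow> (\<exists>t. bounded_eval c x t \<noteq> 0)" for x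
    using bounded_eval_sound bounded_eval_complete by (metis nat.distinct(1) not0_implies_Suc)
  define Q where "Q i z \<longleftrightarrow> \<not> bounded_eval c (P i (pair_fst z)) (pair_snd z) = 0" for i z
  have Q: "\<exists>z. Q i z" for i
    using ex[of i] unfolding W Q_def by (metis fst_conv prod_encode_inverse snd_conv)
  show ?thesis
  proof
    show "tc (\<lambda>i. pair_fst (LEAST z. Q i z))"
    proof (intro tc_fst tc_Least_pred Q)
      have e: "tc h \<Longrightarrow> tc k \<Longrightarrow> tc (\<lambda>z. bounded_eval c (h z) (k z))" for h k
        using tc_comp[OF tc_bounded_eval tc_pair] by simp
      have p: "tc h \<Longrightarrow> tc k \<Longrightarrow> tc (\<lambda>z. P (h z) (k z))" for h k
        using tc_comp[OF P tc_pair] by simp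
      show "tc_pred (\<lambda>z. Q (pair_fst z) (pair_snd z))"
        unfolding Q_def by (intro e p tc_intros)
    qed
    show "P i (pair_fst (LEAST z. Q i z)) \<in> W" for i
      using LeastI_ex[OF Q, of i] unfolding W Q_def by blast
  qed
qed

section \<open>Computations with coded words\<close>

text \<open>The code of a nonempty list is the successor of the paired head and coded tail, so a
  list is consumed directly from its code, the state being the rest together with the accumulator. A
  code is at least the length of its list, hence x itself is a sufficient number of
  iterations.\<close>

lemma tc_fold:
  assumes "tc (\<lambda>z. g (pair_fst z) (pair_snd z))"
  shows "tc (\<lambda>x. fold g (list_decode x) a)"
proof -
  define step where "step z = (if pair_fst z = 0 then z else
      prod_encode (pair_snd (pair_fst z - 1), g (pair_fst (pair_fst z - 1)) (pair_snd z)))" for z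
  define R where "R x n = rec_nat (prod_encode (x, a)) (\<lambda>_. step) n" for x n
  \<comment> \<open>A state with exhausted list is a fixed point, so surplus iterations are
    harmless.\<close>
  have stop: "(step ^^ n) (prod_encode (0, b)) = prod_encode (0, b)" for n b
    by (induction n) (auto simp: step_def)
  have iter: "length xs \<le> n \<Longrightarrow> (step ^^ n) (prod_encode (list_encode xs, b)) = prod_encode (0, fold g xs b)"
    for xs n b
  proof (induction xs arbitrary: n b)
    case Nil
    show ?case by (simp add: stop)
  next
    case (Cons y ys)
    then obtain m where m: "n = Suc m" "length ys \<le> m" by (cases n) auto
    have "step (prod_encode (list_encode (y # ys), b)) = prod_encode (list_encode ys, g y b)"
      by (simp add: step_def)
    then show ?case unfolding m(1) using Cons.IH[OF m(2)] by (simp add: funpow_swap1[symmetric] funpow_Suc_right del: funpow.simps list_encode.simps)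
  qed
  have length: "length xs \<le> list_encode xs" for xs
  proof (induction xs)
    case (Cons y ys)
    then show ?case using le_prod_encode_2[of "list_encode ys" y] by simp
  qed simp
  have R: "R x n = (step ^^ n) (prod_encode (x, a))" for x n
    unfolding R_def by (induction n) auto
  have "R x x = prod_encode (0, fold g (list_decode x) a)" for x
    unfolding R using iter[of "list_decode x" x a] length[of "list_decode x"] by simp
  then have "fold g (list_decode x) a = pair_snd (R x x)" for x by simp
  moreover have "tc (\<lambda>x. pair_snd (R x x))"
  proof -
    have g: "tc h \<Longrightarrow> tc k \<Longrightarrow> tc (\<lambda>z. g (h z) (k z))" for h k
      using tc_comp[OF assms tc_pair] by simp
    show ?thesis unfolding R_def step_def by (intro tc_snd tc_rec; intro g tc_intros)
  qed
  ultimately show ?thesis by simp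
qed


lemma tc_div_2:
  assumes "tc f"
  shows "tc (\<lambda>x. f x div 2)"
proof -
  have "(LEAST n. f x \<le> 2 * n + 1) = f x div 2" for x
    by (rule Least_equality) auto
  moreover have "tc (\<lambda>x. LEAST n. f x \<le> 2 * n + 1)"
  proof (rule tc_Least_pred)
    show "tc_pred (\<lambda>z. f (pair_fst z) \<le> 2 * pair_snd z + 1)"
      by (intro tc_intros tc_comp[OF assms])
    show "\<exists>n. f x \<le> 2 * n + 1" for x by (intro exI[of _ "f x"]) simp
  qed
  ultimately show ?thesis by simp
qed

lemma tc_list_encode_replicate:
  assumes "tc f" "tc g"
  shows "tc (\<lambda>x. list_encode (replicate (f x) (g x)))"
proof -
  have "list_encode (replicate n l) = rec_nat 0 (\<lambda>_ y. Suc (prod_encode (l, y))) n" for n l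
    by (induction n) auto
  then show ?thesis
    by (simp only:) (intro tc_rec; intro assms tc_comp[OF assms(2)] tc_intros)
qed

section \<open>Codes of letters and the test for reduced words\<close>

definition letter_code :: "nat \<times> bool \<Rightarrow> nat" where
  "letter_code = (\<lambda>(i, b). if b then 2 * i else 2 * i + 1)"

definition code_letter :: "nat \<Rightarrow> nat \<times> bool" where
  "code_letter l = (l div 2, even l)"

lemma code_letter_letter_code [simp]: "code_letter (letter_code a) = a"
  by (cases a) (auto simp: letter_code_def code_letter_def)

lemma letter_code_code_letter [simp]: "letter_code (code_letter l) = l"
  by (auto simp: letter_code_def code_letter_def)

lemma gword_encode_eq: "gword_encode w = list_encode (map letter_code w)"
  by (simp add: gword_encode_def letter_code_def)

text \<open>Decoding is total and may produce a word that is not reduced, so membership in the free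
  group has to be decided separately.\<close>

definition word_of :: "nat \<Rightarrow> gword" where
  "word_of x = map code_letter (list_decode x)"

lemma gword_encode_word_of [simp]: "gword_encode (word_of x) = x"
  by (simp add: gword_encode_eq word_of_def o_def)

lemma word_of_gword_encode [simp]: "word_of (gword_encode w) = w"
  by (simp add: gword_encode_eq word_of_def o_def)

text \<open>The state is \<open>0\<close> after a cancelling pair, \<open>1\<close> at the start and \<open>l + 2\<close> after the letter \<open>l\<close>.\<close>

definition reduced_step :: "nat \<Rightarrow> nat \<Rightarrow> nat" where
  "reduced_step l s =
     (if s = 0 \<or> (2 \<le> s \<and> \<not> s - 2 = l \<and> (s - 2) div 2 = l div 2) then 0 else l + 2)"

lemma inverse_letters_code: "inverse_letters (code_letter k) (code_letter l) \<longleftrightarrow> k \<noteq> l \<and> k div 2 = l div 2"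
proof -
  have "k div 2 = l div 2 \<Longrightarrow> even k = even l \<Longrightarrow> k = l"
    by presburger
  then show ?thesis unfolding inverse_letters_def code_letter_def by auto
qed

text \<open>The test compares each letter with its predecessor, so the induction has to carry the
  last letter k along. State 0 is absorbing: a cancelling pair is never forgotten.\<close>

lemma fold_reduced_step:
  "fold reduced_step xs (k + 2) \<noteq> 0 \<longleftrightarrow>
     successively (\<lambda>a b. \<not> inverse_letters a b) (map code_letter (k # xs))"
proof (induction xs arbitrary: k)
  case (Cons l xs)
  have bad: "fold reduced_step xs 0 = 0" for xs
    by (induction xs) (auto simp: reduced_step_def)
  show ?case
  proof (cases "inverse_letters (code_letter k) (code_letter l)")
    case True
    then have "reduced_step l (k + 2) = 0" unfolding inverse_letters_code by (simp add: reduced_step_def)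
    then show ?thesis using True bad by simp
  next
    case False
    then have "reduced_step l (k + 2) = l + 2" unfolding inverse_letters_code by (auto simp: reduced_step_def)
    then show ?thesis using False Cons.IH[of l] by simp
  qed
qed simp

lemma word_of_reduced: "word_of x \<in> carrier free_group \<longleftrightarrow> fold reduced_step (list_decode x) 1 \<noteq> 0"
proof (cases "list_decode x")
  case (Cons l xs)
  have "reduced_step l 1 = l + 2" by (simp add: reduced_step_def)
  then show ?thesis using fold_reduced_step[of xs l] by (simp add: word_of_def Cons free_group_def)
qed (simp add: word_of_def free_group_def)

lemma tc_pred_reduced: "tc_pred (\<lambda>x. word_of x \<in> carrier free_group)"
  unfolding word_of_reduced reduced_step_def
  by (intro tc_pred_not tc_pred_eq tc_fold tc_const, intro tc_intros tc_div_2)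

section \<open>Groups embedded in the rational numbers\<close>

text \<open>F occurs only in correctness proofs; the algorithms read everything from the kernel.
  Injectivity of F turns equality in G into equality of numbers, and rationality of F produces the
  relations between generators that are searched for.\<close>

locale rational_group_presentation =
  fixes G :: "'g monoid" and \<kappa> :: "gword \<Rightarrow> 'g" and F :: "'g \<Rightarrow> real"
  assumes epi: "\<kappa> \<in> epi free_group G"
    and F_mult: "x \<in> carrier G \<Longrightarrow> y \<in> carrier G \<Longrightarrow> F (x \<otimes>\<^bsub>G\<^esub> y) = F x + F y"
    and F_inj: "inj_on F (carrier G)"
    and F_rat: "x \<in> carrier G \<Longrightarrow> F x \<in> \<rat>"
begin

definition letter_value :: "nat \<Rightarrow> real" where
  "letter_value l = F (\<kappa> [code_letter l])"

lemma closed: "w \<in> carrier free_group \<Longrightarrow> \<kappa> w \<in> carrier G"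
  using epi unfolding epi_def hom_def by blast

lemma F_mult_words:
  assumes "u \<in> carrier free_group" "w \<in> carrier free_group"
  shows "F (\<kappa> (u \<otimes>\<^bsub>free_group\<^esub> w)) = F (\<kappa> u) + F (\<kappa> w)"
  using epi assms F_mult closed unfolding epi_def hom_def by simp

lemma reduced_Cons: "a # w \<in> carrier free_group \<Longrightarrow> w \<in> carrier free_group"
  by (cases w) (auto simp: free_group_def)

lemma reduced_singleton: "[a] \<in> carrier free_group"
  by (simp add: free_group_def)

lemma reduced_Nil: "[] \<in> carrier free_group"
  by (simp add: free_group_def)

lemma F_Nil: "F (\<kappa> []) = 0"
  using F_mult_words[OF reduced_Nil reduced_Nil] by (simp add: free_group_def)

lemma F_word: "w \<in> carrier free_group \<Longrightarrow> F (\<kappa> w) = sum_list (map (\<lambda>a. letter_value (letter_code a)) w)"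
proof (induction w)
  case Nil
  show ?case by (simp add: F_Nil)
next
  case (Cons a w)
  have "[a] \<otimes>\<^bsub>free_group\<^esub> w = a # w"
    using Cons.prems by (cases w) (auto simp: free_group_def cons_reduce_def)
  then have "F (\<kappa> (a # w)) = F (\<kappa> [a]) + F (\<kappa> w)"
    using F_mult_words[OF reduced_singleton reduced_Cons[OF Cons.prems]] by metis
  then show ?case using Cons.IH[OF reduced_Cons[OF Cons.prems]] by (simp add: letter_value_def)
qed

lemma F_word_of:
  "word_of x \<in> carrier free_group \<Longrightarrow> F (\<kappa> (word_of x)) = sum_list (map letter_value (list_decode x))"
  by (simp add: F_word word_of_def o_def)

lemma letter_value_inverse: "letter_value (letter_code (i, False)) = - letter_value (letter_code (i, True))"
proof -
  have "[(i, True)] \<otimes>\<^bsub>free_group\<^esub> [(i, False)] = []"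
    by (simp add: free_group_def cons_reduce_def inverse_letters_def)
  then have "F (\<kappa> [(i, True)]) + F (\<kappa> [(i, False)]) = 0"
    using F_mult_words[OF reduced_singleton reduced_singleton] F_Nil by metis
  then show ?thesis by (simp add: letter_value_def)
qed

text \<open>A letter is not its own inverse, so its powers are reduced as they stand. The relations
  that are searched for consist of such powers.\<close>

lemma word_of_replicate:
  "word_of (list_encode (replicate m l)) \<in> carrier free_group"
  "F (\<kappa> (word_of (list_encode (replicate m l)))) = m * letter_value l"
proof -
  have "successively (\<lambda>a b. \<not> inverse_letters a b) (replicate m (code_letter l))"
  proof (induction m)
    case (Suc m)
    then show ?case by (cases m) (auto simp: inverse_letters_def)
  qed simp
  then show red: "word_of (list_encode (replicate m l)) \<in> carrier free_group"
    by (simp add: word_of_def free_group_def)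
  show "F (\<kappa> (word_of (list_encode (replicate m l)))) = m * letter_value l"
    using F_word_of[OF red] by (simp add: sum_list_replicate)
qed

lemma kernel_iff:
  "prod_encode (x, y) \<in> kernel_codes free_group gword_encode \<kappa> \<longleftrightarrow>
     word_of x \<in> carrier free_group \<and> word_of y \<in> carrier free_group \<and>
     F (\<kappa> (word_of x)) = F (\<kappa> (word_of y))"
proof -
  have "prod_encode (x, y) \<in> kernel_codes free_group gword_encode \<kappa> \<longleftrightarrow>
     word_of x \<in> carrier free_group \<and> word_of y \<in> carrier free_group \<and> \<kappa> (word_of x) = \<kappa> (word_of y)"
    unfolding kernel_codes_def
    by (auto, metis gword_encode_word_of)
  then show ?thesis using closed F_inj by (metis inj_on_def)
qed

lemma label_iff:
  assumes "X = {g \<in> carrier G. 0 \<le> F g}"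
  shows "x \<in> label_codes free_group gword_encode \<kappa> X \<longleftrightarrow>
    word_of x \<in> carrier free_group \<and> 0 \<le> F (\<kappa> (word_of x))"
  unfolding label_codes_def assms using closed by (auto, metis gword_encode_word_of)

text \<open>The factor \<beta> is the value of one fixed letter, known only to be positive. Writing
  the ratio as a difference of natural numbers over a successor keeps the arithmetic in the natural
  numbers and excludes a zero denominator.\<close>

lemma computable_letter_values:
  assumes ce: "ce_set (kernel_codes free_group gword_encode \<kappa>)"
  obtains \<beta> a b c where "0 < \<beta>" "tc a" "tc b" "tc c"
    "\<And>l. letter_value l = \<beta> * (real (a l) - real (b l)) / real (Suc (c l))"
proof (cases "\<forall>l. letter_value l = 0")
  \<comment> \<open>All values vanish, and any positive \<beta> will do.\<close>
  case True
  then show ?thesis using that[of 1 "\<lambda>_. 0" "\<lambda>_. 0" "\<lambda>_. 0"] tc_const by simp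
next
  case False
  then obtain l where "letter_value l \<noteq> 0" by blast
  moreover obtain i s where "l = letter_code (i, s)" by (metis letter_code_code_letter surj_pair)
  ultimately obtain i where "letter_value (letter_code (i, True)) \<noteq> 0"
    using letter_value_inverse by (cases s) auto
  \<comment> \<open>A generator and its inverse have opposite values, so one of them is positive. It
    becomes the unit of measurement, and the other one expresses negative ratios.\<close>
  then obtain j j' where j: "0 < letter_value j" "letter_value j' = - letter_value j"
    using letter_value_inverse[of i] by (metis linorder_neqE_linordered_idom minus_minus neg_0_less_iff_less)
  \<comment> \<open>The number n codes a possible relation: the left exponent minus one, the right
    exponent, and whether the right side is a power of j or of j'. The shift keeps the left exponent
    positive.\<close>
  define P where "P l n = prod_encode (list_encode (replicate (Suc (pair_fst n)) l),
    list_encode (replicate (pair_fst (pair_snd n)) (if pair_snd (pair_snd n) = 0 then j else j')))" for l n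
  have P: "P l n \<in> kernel_codes free_group gword_encode \<kappa> \<longleftrightarrow>
      Suc (pair_fst n) * letter_value l =
      pair_fst (pair_snd n) * (if pair_snd (pair_snd n) = 0 then letter_value j else - letter_value j)" for l n
    unfolding P_def kernel_iff by (simp add: word_of_replicate j(2) del: replicate_Suc)
  have "\<exists>n. P l n \<in> kernel_codes free_group gword_encode \<kappa>" for l
  proof -
    have "letter_value l / letter_value j \<in> \<rat>"
      unfolding letter_value_def using F_rat closed reduced_singleton by (intro Rats_divide) auto
    then obtain p q :: int where pq: "0 < q" "letter_value l / letter_value j = p / q"
      by (metis Rats_cases')
    \<comment> \<open>The ratio p / q is read as a relation between the q-th power of l and a power
      of j or j' with exponent the absolute value of p.\<close>
    define n where "n = prod_encode (nat q - 1, prod_encode (nat \<bar>p\<bar>, if 0 \<le> p then 0 else 1))"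
    have "q * letter_value l = p * letter_value j"
      using pq j(1) by (simp add: field_simps)
    moreover have "real (Suc (nat q - 1)) = q" using pq(1) by simp
    moreover have "real (nat \<bar>p\<bar>) = \<bar>real_of_int p\<bar>" by simp
    ultimately have "P l n \<in> kernel_codes free_group gword_encode \<kappa>"
      unfolding P n_def by (auto simp del: of_nat_Suc)
    then show ?thesis by blast
  qed
  moreover have "tc (\<lambda>z. P (pair_fst z) (pair_snd z))"
    unfolding P_def by (intro tc_intros tc_list_encode_replicate)
  ultimately obtain s where s: "tc s" "\<And>l. P l (s l) \<in> kernel_codes free_group gword_encode \<kappa>"
    using ce_search[OF ce] by blast
  show ?thesis
  proof (rule that[OF j(1)])
    let ?a = "\<lambda>l. if pair_snd (pair_snd (s l)) = 0 then pair_fst (pair_snd (s l)) else 0"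
    let ?b = "\<lambda>l. if pair_snd (pair_snd (s l)) = 0 then 0 else pair_fst (pair_snd (s l))"
    show "tc ?a" "tc ?b" "tc (\<lambda>l. pair_fst (s l))"
      by (intro tc_intros s(1))+
    show "letter_value l = letter_value j * (real (?a l) - real (?b l)) / real (Suc (pair_fst (s l)))" for l
      using s(2)[of l] unfolding P
      by (auto simp: field_simps simp del: of_nat_Suc split: if_splits)
  qed
qed

text \<open>The value of a word is kept as \<open>\<beta> (P - N) / D\<close> with the triple \<open>(P, N, D)\<close> of natural numbers.\<close>

theorem computable:
  assumes ce: "ce_set (kernel_codes free_group gword_encode \<kappa>)"
    and X: "X = {g \<in> carrier G. 0 \<le> F g}"
  shows "computable_group_presentation G \<kappa> \<and> computable_group_subset G \<kappa> X"
proof -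
  obtain \<beta> a b c where "0 < \<beta>" and abc: "tc a" "tc b" "tc c"
    and letter: "\<And>l. letter_value l = \<beta> * (real (a l) - real (b l)) / real (Suc (c l))"
    using computable_letter_values[OF ce] by blast
  \<comment> \<open>The fractions of the letter l are added to P / D and N / D over the common
    denominator, without cancelling.\<close>
  define step where "step l t = (let P = pair_fst t; N = pair_fst (pair_snd t); D = pair_snd (pair_snd t)
    in prod_encode (P * Suc (c l) + a l * D, prod_encode (N * Suc (c l) + b l * D, D * Suc (c l))))" for l t
  define T where "T x = fold step (list_decode x) (prod_encode (0, prod_encode (0, 1)))" for x
  define P N D where "P x = pair_fst (T x)" and "N x = pair_fst (pair_snd (T x))"
    and "D x = pair_snd (pair_snd (T x))" for x
  have "tc (\<lambda>z. step (pair_fst z) (pair_snd z))"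
    unfolding step_def Let_def
    by (intro tc_intros tc_comp[OF abc(1)] tc_comp[OF abc(2)] tc_comp[OF abc(3)])
  then have T: "tc T" unfolding T_def by (rule tc_fold)
  have P: "tc f \<Longrightarrow> tc (\<lambda>x. P (f x))" and N: "tc f \<Longrightarrow> tc (\<lambda>x. N (f x))"
    and D: "tc f \<Longrightarrow> tc (\<lambda>x. D (f x))" for f
    unfolding P_def N_def D_def by (intro tc_intros tc_comp[OF T]; assumption)+
  \<comment> \<open>The invariant is stated for an arbitrary start triple with positive denominator,
    because the fold changes its accumulator at every letter.\<close>
  have inv: "let t = fold step xs (prod_encode (p, prod_encode (n, d))) in
      0 < pair_snd (pair_snd t) \<and>
      \<beta> * (real p - real n) / real d + sum_list (map letter_value xs) =
      \<beta> * (real (pair_fst t) - real (pair_fst (pair_snd t))) / real (pair_snd (pair_snd t))"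
    if "0 < d" for xs p n d
    using that
  proof (induction xs arbitrary: p n d)
    case (Cons l xs)
    have "step l (prod_encode (p, prod_encode (n, d))) =
        prod_encode (p * Suc (c l) + a l * d, prod_encode (n * Suc (c l) + b l * d, d * Suc (c l)))"
      by (simp add: step_def)
    moreover have "\<beta> * (real (p * Suc (c l) + a l * d) - real (n * Suc (c l) + b l * d)) / real (d * Suc (c l)) =
        \<beta> * (real p - real n) / real d + letter_value l"
    proof -
      define e where "e = real (Suc (c l))"
      have "0 < e" by (simp add: e_def)
      then show ?thesis
        using Cons.prems unfolding letter of_nat_mult of_nat_add e_def[symmetric]
        by (simp add: field_simps)
    qed
    ultimately show ?case
      using Cons.IH[of "d * Suc (c l)" "p * Suc (c l) + a l * d" "n * Suc (c l) + b l * d"] Cons.prems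
      by (simp add: Let_def add.assoc)
  qed (simp add: Let_def)
  have D0: "0 < D x" and val: "word_of x \<in> carrier free_group \<Longrightarrow>
      F (\<kappa> (word_of x)) = \<beta> * (real (P x) - real (N x)) / real (D x)" for x
    using inv[of 1 "list_decode x" 0 0] F_word_of[of x]
    by (simp_all add: Let_def P_def N_def D_def T_def)
  have "computable_set (kernel_codes free_group gword_encode \<kappa>)"
  proof (rule computable_setI)
    \<comment> \<open>Cross multiplication, with the subtracted terms moved to the other side,
      avoids truncated subtraction.\<close>
    have "F (\<kappa> (word_of x)) = F (\<kappa> (word_of y)) \<longleftrightarrow>
        P x * D y + N y * D x = P y * D x + N x * D y"
      if "word_of x \<in> carrier free_group" "word_of y \<in> carrier free_group" for x y
    proof -
      have "F (\<kappa> (word_of x)) = F (\<kappa> (word_of y)) \<longleftrightarrow>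
          real (P x) * D y + real (N y) * D x = real (P y) * D x + real (N x) * D y"
        unfolding val[OF that(1)] val[OF that(2)]
        using D0[of x] D0[of y] \<open>0 < \<beta>\<close> by (simp add: divide_simps) (auto simp: algebra_simps)
      then show ?thesis by (simp flip: of_nat_mult of_nat_add)
    qed
    then have "z \<in> kernel_codes free_group gword_encode \<kappa> \<longleftrightarrow>
        (word_of (pair_fst z) \<in> carrier free_group \<and> word_of (pair_snd z) \<in> carrier free_group \<and>
         P (pair_fst z) * D (pair_snd z) + N (pair_snd z) * D (pair_fst z) =
         P (pair_snd z) * D (pair_fst z) + N (pair_fst z) * D (pair_snd z))" for z
      using kernel_iff[of "pair_fst z" "pair_snd z"] by auto
    moreover have red: "tc f \<Longrightarrow> tc_pred (\<lambda>x. word_of (f x) \<in> carrier free_group)" for f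
      using tc_pred_reduced tc_comp unfolding tc_pred_def by blast
    ultimately show "tc_pred (\<lambda>z. z \<in> kernel_codes free_group gword_encode \<kappa>)"
      by (simp only:) (intro red P N D tc_intros)
  qed
  moreover have "computable_set (label_codes free_group gword_encode \<kappa> X)"
  proof (rule computable_setI)
    \<comment> \<open>Both \<beta> and the denominator are positive, so the sign of the value is
      that of P - N.\<close>
    have "0 \<le> F (\<kappa> (word_of x)) \<longleftrightarrow> N x \<le> P x" if "word_of x \<in> carrier free_group" for x
      unfolding val[OF that] using D0[of x] \<open>0 < \<beta>\<close>
      by (simp add: zero_le_divide_iff zero_le_mult_iff)
    then have "x \<in> label_codes free_group gword_encode \<kappa> X \<longleftrightarrow>
        word_of x \<in> carrier free_group \<and> N x \<le> P x" for x
      unfolding label_iff[OF X] by blast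
    then show "tc_pred (\<lambda>x. x \<in> label_codes free_group gword_encode \<kappa> X)"
      by (simp only:) (intro tc_pred_reduced P N tc_intros)
  qed
  ultimately show ?thesis
    using epi X unfolding computable_group_presentation_def computable_group_subset_def by blast
qed

end

section \<open>Involutions and matrices over a C*-algebra\<close>

lemma star_0 [simp]: "star (0::'a::cstar_algebra_1) = 0"
  using star_add[of "0::'a" 0] by simp

lemma star_1 [simp]: "star (1::'a::cstar_algebra_1) = 1"
  using star_mult[of "star (1::'a)" 1] by (simp add: star_star)

lemma star_uminus: "star (- x) = - star (x::'a::cstar_algebra_1)"
  using star_add[of x "- x"] by (simp add: eq_neg_iff_add_eq_0 add.commute)

lemma star_diff: "star (x - y) = star x - star (y::'a::cstar_algebra_1)"
  using star_add[of x "- y"] by (simp add: star_uminus)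

lemma star_sum: "star (sum f S) = (\<Sum>x\<in>S. star (f x :: 'a::cstar_algebra_1))"
  by (induction S rule: infinite_finite_induct) (simp_all add: star_add)

lemma cscale_0_left [simp]: "cscale 0 (x::'a::cstar_algebra_1) = 0"
  using cscale_of_real[of 0 x] by simp

lemma cscale_0_right [simp]: "cscale c (0::'a::cstar_algebra_1) = 0"
  using cscale_add_right[of c "0::'a" 0] by simp

lemma cscale_1 [simp]: "cscale 1 (x::'a::cstar_algebra_1) = x"
  using cscale_of_real[of 1 x] by simp

lemma cscale_minus_1: "cscale (-1) (x::'a::cstar_algebra_1) = - x"
  using cscale_of_real[of "-1" x] by simp

lemma cscale_uminus_left: "cscale (- c) (x::'a::cstar_algebra_1) = - cscale c x"
  using cscale_add_left[of c "- c" x] by (simp add: eq_neg_iff_add_eq_0 add.commute)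

lemma cscale_diff_left: "cscale (c - d) (x::'a::cstar_algebra_1) = cscale c x - cscale d x"
  using cscale_add_left[of c "- d" x] by (simp add: cscale_uminus_left)

lemma cscale_sum_left: "cscale (sum c S) (x::'a::cstar_algebra_1) = (\<Sum>i\<in>S. cscale (c i) x)"
  by (induction S rule: infinite_finite_induct) (simp_all add: cscale_add_left)

lemma norm_star_le: "norm (x::'a::cstar_algebra_1) \<le> norm (star x)"
proof (cases "x = 0")
  case False
  have "norm x * norm x \<le> norm (star x) * norm x"
    using cstar_identity[of x] norm_mult_ineq[of "star x" x] by (simp add: power2_eq_square)
  with False show ?thesis by simp
qed simp

lemma norm_star [simp]: "norm (star x) = norm (x::'a::cstar_algebra_1)"
  using norm_star_le[of x] norm_star_le[of "star x"] by (simp add: star_star)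

lemma norm_projection:
  assumes "star e * e = e" "e \<noteq> 0"
  shows "norm (e::'a::cstar_algebra_1) = 1"
  using cstar_identity[of e] assms by (simp add: power2_eq_square)

lemma dim_mat_star [simp]: "dim_row (mat_star M) = dim_col M" "dim_col (mat_star M) = dim_row M"
  by (simp_all add: mat_star_def)

lemma mat_star_carrier [simp]: "mat_star M \<in> carrier_mat m n \<longleftrightarrow> M \<in> carrier_mat n m"
  by (metis carrier_matD carrier_matI dim_mat_star)

lemma index_mat_star [simp]:
  "i < dim_col M \<Longrightarrow> j < dim_row M \<Longrightarrow> mat_star M $$ (i, j) = star (M $$ (j, i))"
  by (simp add: mat_star_def)

lemma mat_star_star [simp]: "mat_star (mat_star M) = M"
  by (rule eq_matI) (simp_all add: star_star)

lemma index_mult_mat_sum: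
  "A \<in> carrier_mat n m \<Longrightarrow> B \<in> carrier_mat m k \<Longrightarrow> i < n \<Longrightarrow> j < k \<Longrightarrow>
   (A * B) $$ (i, j) = (\<Sum>l<m. A $$ (i, l) * B $$ (l, j))"
  by (auto simp: scalar_prod_def lessThan_atLeast0)

lemma mat_star_mult:
  assumes "A \<in> carrier_mat n m" "B \<in> carrier_mat m k"
  shows "mat_star (A * B) = mat_star B * mat_star (A :: 'a::cstar_algebra_1 mat)"
proof (rule eq_matI)
  fix i j assume "i < dim_row (mat_star B * mat_star A)" "j < dim_col (mat_star B * mat_star A)"
  then have ij: "i < k" "j < n" using assms by auto
  have "mat_star (A * B) $$ (i, j) = star (\<Sum>l<m. A $$ (j, l) * B $$ (l, i))"
    using ij assms by (subst index_mat_star) (auto simp: index_mult_mat_sum[OF assms] simp del: index_mult_mat(1))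
  also have "\<dots> = (\<Sum>l<m. mat_star B $$ (i, l) * mat_star A $$ (l, j))"
    unfolding star_sum using ij assms by (intro sum.cong) (auto simp: star_mult)
  also have "\<dots> = (mat_star B * mat_star A) $$ (i, j)"
    using ij assms by (subst index_mult_mat_sum[of _ k m _ n]) auto
  finally show "mat_star (A * B) $$ (i, j) = (mat_star B * mat_star A) $$ (i, j)" .
qed (use assms in auto)

lemma mat_star_add:
  assumes "A \<in> carrier_mat n m" "B \<in> carrier_mat n m"
  shows "mat_star (A + B) = mat_star A + mat_star (B :: 'a::cstar_algebra_1 mat)"
  by (rule eq_matI) (use assms in \<open>auto simp: star_add\<close>)

lemma mat_star_minus:
  assumes "A \<in> carrier_mat n m" "B \<in> carrier_mat n m"
  shows "mat_star (A - B) = mat_star A - mat_star (B :: 'a::cstar_algebra_1 mat)"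
  by (rule eq_matI) (use assms in \<open>auto simp: star_diff\<close>)

lemma mat_star_zero [simp]: "mat_star (0\<^sub>m n m) = (0\<^sub>m m n :: 'a::cstar_algebra_1 mat)"
  by (rule eq_matI) auto

lemma mat_star_one [simp]: "mat_star (1\<^sub>m n) = (1\<^sub>m n :: 'a::cstar_algebra_1 mat)"
  by (rule eq_matI) auto

lemma mat_star_four_block:
  assumes "A \<in> carrier_mat n1 m1" "B \<in> carrier_mat n1 m2" "C \<in> carrier_mat n2 m1" "D \<in> carrier_mat n2 m2"
  shows "mat_star (four_block_mat A B C D) =
    four_block_mat (mat_star A) (mat_star C) (mat_star B) (mat_star (D :: 'a::cstar_algebra_1 mat))"
  by (rule eq_matI) (use assms in auto)

section \<open>Murray--von Neumann equivalence\<close>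

lemma projectionsD:
  assumes "p \<in> projections n"
  shows "p \<in> carrier_mat n n" "p * p = p" "mat_star p = p" "dim_row p = n" "dim_col p = n"
  using assms by (auto simp: projections_def)

lemma all_projectionsI: "p \<in> projections n \<Longrightarrow> 0 < n \<Longrightarrow> p \<in> all_projections"
  by (auto simp: all_projections_def)

lemma mvn_relI:
  assumes "p \<in> projections n" "q \<in> projections m" "0 < n" "0 < m"
    and "v \<in> carrier_mat m n" "mat_star v * v = p" "v * mat_star v = q"
  shows "(p, q) \<in> mvn_rel"
  unfolding mvn_rel_def using assms projectionsD[OF assms(1)] projectionsD[OF assms(2)]
  by (auto intro: all_projectionsI)

text \<open>Replacing \<open>v\<close> by \<open>v p\<close> makes the partial isometry relations available without positivity.\<close>

lemma mvn_relE:
  assumes "(p, q :: 'a::cstar_algebra_1 mat) \<in> mvn_rel"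
  obtains n m v where "p \<in> projections n" "q \<in> projections m" "0 < n" "0 < m"
    "v \<in> carrier_mat m n" "mat_star v * v = p" "v * mat_star v = q" "v * p = v" "q * v = v"
proof -
  obtain n m where p: "p \<in> projections n" "0 < n" and q: "q \<in> projections m" "0 < m"
    using assms unfolding mvn_rel_def all_projections_def by auto
  obtain u where u: "u \<in> carrier_mat m n" "p = mat_star u * u" "q = u * mat_star u"
    using assms projectionsD[OF p(1)] projectionsD[OF q(1)] unfolding mvn_rel_def by auto
  note p' = projectionsD[OF p(1)] and q' = projectionsD[OF q(1)]
  have us: "mat_star u \<in> carrier_mat n m" using u by simp
  \<comment> \<open>Both sides are u times its adjoint times u.\<close>
  have qu: "q * u = u * p"
    unfolding u(2,3) by (rule assoc_mult_mat[OF u(1) us u(1)])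
  have c: "u * p \<in> carrier_mat m n" using u p' by simp
  have s: "mat_star (u * p) = p * mat_star u"
    using mat_star_mult[OF u(1) p'(1)] p' by simp
  have "mat_star (u * p) * (u * p) = p * (mat_star u * (u * p))"
    unfolding s by (rule assoc_mult_mat[OF p'(1) us c])
  also have "mat_star u * (u * p) = (mat_star u * u) * p"
    by (rule assoc_mult_mat[OF us u(1) p'(1), symmetric])
  also have "\<dots> = p" unfolding u(2)[symmetric] by (rule p'(2))
  finally have 1: "mat_star (u * p) * (u * p) = p" using p' by simp
  have "u * p * mat_star (u * p) = q * u * (p * mat_star u)" unfolding s qu ..
  also have "\<dots> = q * (u * (p * mat_star u))"
    by (rule assoc_mult_mat[OF q'(1) u(1) mult_carrier_mat[OF p'(1) us]])
  also have "u * (p * mat_star u) = (u * p) * mat_star u"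
    by (rule assoc_mult_mat[OF u(1) p'(1) us, symmetric])
  also have "\<dots> = q * q" unfolding qu[symmetric] u(3) by (rule assoc_mult_mat) (use u us in auto)
  finally have 2: "u * p * mat_star (u * p) = q" using q' by simp
  have 3: "u * p * p = u * p" using assoc_mult_mat[OF u(1) p'(1) p'(1)] p' by simp
  have "q * (u * p) = q * q * u" unfolding qu[symmetric] by (rule assoc_mult_mat[OF q'(1) q'(1) u(1), symmetric])
  then have 4: "q * (u * p) = u * p" using q' qu by simp
  show ?thesis by (rule that[OF p(1) q(1) p(2) q(2) c 1 2 3 4])
qed

text \<open>Symmetry passes to the adjoint of v, transitivity to the product w v. In the product the
  middle projection q cancels because q v = v and w q = w, which is why \<open>mvn_relE\<close>
  delivers normalised partial isometries.\<close>

lemma equiv_mvn_rel: "equiv all_projections (mvn_rel :: ('a::cstar_algebra_1 mat \<times> 'a mat) set)"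
proof (rule equivI)
  show "(mvn_rel :: ('a mat \<times> 'a mat) set) \<subseteq> all_projections \<times> all_projections"
    by (auto simp: mvn_rel_def)
  show "refl_on all_projections (mvn_rel :: ('a mat \<times> 'a mat) set)"
  proof (rule refl_onI)
    fix p :: "'a mat" assume "p \<in> all_projections"
    then obtain n where p: "p \<in> projections n" "0 < n" unfolding all_projections_def by auto
    show "(p, p) \<in> mvn_rel"
      by (rule mvn_relI[OF p(1) p(1) p(2) p(2)]) (use projectionsD[OF p(1)] in auto)
  qed
  show "sym (mvn_rel :: ('a mat \<times> 'a mat) set)"
  proof (rule symI)
    fix p q :: "'a mat" assume "(p, q) \<in> mvn_rel"
    then show "(q, p) \<in> mvn_rel"
    proof (rule mvn_relE)
      fix n m v assume *: "p \<in> projections n" "q \<in> projections m" "0 < n" "0 < m"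
        "v \<in> carrier_mat m n" "mat_star v * v = p" "v * mat_star v = q"
      show ?thesis by (rule mvn_relI[OF *(2,1,4,3), of "mat_star v"]) (use * in simp_all)
    qed
  qed
  show "trans (mvn_rel :: ('a mat \<times> 'a mat) set)"
  proof (rule transI)
    fix p q r :: "'a mat" assume "(p, q) \<in> mvn_rel" "(q, r) \<in> mvn_rel"
    from this(1) obtain n m v where v: "p \<in> projections n" "q \<in> projections m" "0 < n" "0 < m"
      "v \<in> carrier_mat m n" "mat_star v * v = p" "v * mat_star v = q" "v * p = v" "q * v = v"
      by (rule mvn_relE)
    from \<open>(q, r) \<in> mvn_rel\<close> obtain m' k w where w: "q \<in> projections m'" "r \<in> projections k" "0 < m'" "0 < k"
      "w \<in> carrier_mat k m'" "mat_star w * w = q" "w * mat_star w = r" "w * q = w" "r * w = w"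
      by (rule mvn_relE)
    have "m' = m" using projectionsD(4)[OF v(2)] projectionsD(4)[OF w(1)] by simp
    note w = w[unfolded this]
    have s: "mat_star v \<in> carrier_mat n m" "mat_star w \<in> carrier_mat m k" using v w by auto
    have sm: "mat_star (w * v) = mat_star v * mat_star w" by (rule mat_star_mult[OF w(5) v(5)])
    have "mat_star (w * v) * (w * v) = mat_star v * (mat_star w * (w * v))"
      unfolding sm by (rule assoc_mult_mat[OF s]) (use v w in auto)
    also have "mat_star w * (w * v) = v"
      using assoc_mult_mat[OF s(2) w(5) v(5)] w(6) v(9) by simp
    finally have 1: "mat_star (w * v) * (w * v) = p" using v by simp
    have "w * v * mat_star (w * v) = w * (v * (mat_star v * mat_star w))"
      unfolding sm by (rule assoc_mult_mat[OF w(5) v(5)]) (use s in auto)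
    also have "v * (mat_star v * mat_star w) = q * mat_star w"
      using assoc_mult_mat[OF v(5) s] v(7) by simp
    also have "w * (q * mat_star w) = w * mat_star w"
      using assoc_mult_mat[OF w(5) projectionsD(1)[OF v(2)] s(2)] w(8) by simp
    finally have 2: "w * v * mat_star (w * v) = r" using w by simp
    show "(p, r) \<in> mvn_rel"
      by (rule mvn_relI[OF v(1) w(2) v(3) w(4) _ 1 2]) (use v w in auto)
  qed
qed

lemma mvn_class_eq_iff:
  assumes "p \<in> all_projections" "q \<in> all_projections"
  shows "mvn_class p = mvn_class q \<longleftrightarrow> (p, q) \<in> mvn_rel"
  unfolding mvn_class_def using eq_equiv_class_iff[OF equiv_mvn_rel assms] .

lemma mvn_class_eqI: "(p, q) \<in> mvn_rel \<Longrightarrow> mvn_class p = mvn_class q"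
  unfolding mvn_class_def by (rule equiv_class_eq[OF equiv_mvn_rel])

lemma carrier_MvN: "carrier MvN = mvn_class ` all_projections"
  by (auto simp: MvN_def mvn_class_def quotient_def)

lemma carrier_MvNE:
  assumes "X \<in> carrier MvN"
  obtains n p where "0 < n" "p \<in> projections n" "X = mvn_class p"
  using assms unfolding carrier_MvN all_projections_def by auto

lemma mvn_class_closed: "p \<in> projections n \<Longrightarrow> 0 < n \<Longrightarrow> mvn_class p \<in> carrier MvN"
  unfolding carrier_MvN by (auto intro: all_projectionsI)

section \<open>Direct sums and the monoid of classes\<close>

lemma diag_sum_carrier:
  "p \<in> carrier_mat n n' \<Longrightarrow> q \<in> carrier_mat m m' \<Longrightarrow> diag_sum p q \<in> carrier_mat (n + m) (n' + m')"
  by (auto simp: diag_sum_def)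

lemma diag_sum_mult:
  assumes "a \<in> carrier_mat n m" "b \<in> carrier_mat n' m'" "c \<in> carrier_mat m k" "d \<in> carrier_mat m' k'"
  shows "diag_sum a b * diag_sum c d = diag_sum (a * c) (b * (d :: 'a::cstar_algebra_1 mat))"
proof -
  have "diag_sum a b * diag_sum c d = four_block_mat (a * c + 0\<^sub>m n m' * 0\<^sub>m m' k) (a * 0\<^sub>m m k' + 0\<^sub>m n m' * d)
      (0\<^sub>m n' m * c + b * 0\<^sub>m m' k) (0\<^sub>m n' m * 0\<^sub>m m k' + b * d)"
    unfolding diag_sum_def assms[THEN carrier_matD(1)] assms[THEN carrier_matD(2)]
    by (rule mult_four_block_mat) (use assms in auto)
  also have "\<dots> = diag_sum (a * c) (b * d)"
    using assms by (simp add: diag_sum_def)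
  finally show ?thesis .
qed

lemma mat_star_diag_sum: "mat_star (diag_sum a b) = diag_sum (mat_star a) (mat_star (b :: 'a::cstar_algebra_1 mat))"
  unfolding diag_sum_def
  by (subst mat_star_four_block[of _ "dim_row a" "dim_col a" _ "dim_col b" _ "dim_row b"]) auto

lemma diag_sum_projections:
  assumes "p \<in> projections n" "q \<in> projections m"
  shows "diag_sum p q \<in> projections (n + m)"
  using projectionsD[OF assms(1)] projectionsD[OF assms(2)]
  by (simp add: projections_def diag_sum_carrier mat_star_diag_sum diag_sum_mult[of _ n n _ m m _ n _ m])

lemma diag_sum_mvn:
  assumes "(p, p') \<in> mvn_rel" "(q, q') \<in> mvn_rel"
  shows "(diag_sum p q, diag_sum p' (q' :: 'a::cstar_algebra_1 mat)) \<in> mvn_rel"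
proof -
  from assms(1) obtain n m v where v: "p \<in> projections n" "p' \<in> projections m" "0 < n" "0 < m"
      "v \<in> carrier_mat m n" "mat_star v * v = p" "v * mat_star v = p'" by (rule mvn_relE)
  from assms(2) obtain k l w where w: "q \<in> projections k" "q' \<in> projections l" "0 < k" "0 < l"
      "w \<in> carrier_mat l k" "mat_star w * w = q" "w * mat_star w = q'" by (rule mvn_relE)
  show ?thesis
  proof (rule mvn_relI)
    show "diag_sum p q \<in> projections (n + k)" "diag_sum p' q' \<in> projections (m + l)"
      using diag_sum_projections v w by blast+
    show "diag_sum v w \<in> carrier_mat (m + l) (n + k)" by (rule diag_sum_carrier[OF v(5) w(5)])
    show "mat_star (diag_sum v w) * diag_sum v w = diag_sum p q"
      unfolding mat_star_diag_sum using v w by (subst diag_sum_mult[of _ n m _ k l _ n _ k]) auto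
    show "diag_sum v w * mat_star (diag_sum v w) = diag_sum p' q'"
      unfolding mat_star_diag_sum using v w by (subst diag_sum_mult[of _ m n _ l k _ m _ l]) auto
  qed (use v w in auto)
qed

lemma mult_MvN:
  assumes "p \<in> all_projections" "q \<in> all_projections"
  shows "mvn_class p \<otimes>\<^bsub>MvN\<^esub> mvn_class q = mvn_class (diag_sum p (q :: 'a::cstar_algebra_1 mat))"
proof -
  have "mvn_class (diag_sum p' q') = mvn_class (diag_sum p q)"
    if "p' \<in> mvn_class p" "q' \<in> mvn_class q" for p' q'
    using mvn_class_eqI[OF diag_sum_mvn] that unfolding mvn_class_def by blast
  moreover have "p \<in> mvn_class p" "q \<in> mvn_class q"
    using assms equiv_class_self[OF equiv_mvn_rel] unfolding mvn_class_def by blast+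
  ultimately have "(\<Union>p'\<in>mvn_class p. \<Union>q'\<in>mvn_class q. mvn_class (diag_sum p' q')) =
      mvn_class (diag_sum p q)"
    by blast
  then show ?thesis by (simp add: MvN_def)
qed

text \<open>The row (a b), written as a block matrix whose lower blocks have no rows so that the
  block multiplication rule applies to it.\<close>

definition hcat :: "'a::cstar_algebra_1 mat \<Rightarrow> 'a mat \<Rightarrow> 'a mat" where
  "hcat a b = four_block_mat a b (0\<^sub>m 0 (dim_col a)) (0\<^sub>m 0 (dim_col b))"

lemma hcat_carrier: "a \<in> carrier_mat n m \<Longrightarrow> b \<in> carrier_mat n k \<Longrightarrow> hcat a b \<in> carrier_mat n (m + k)"
  unfolding hcat_def using four_block_carrier_mat[of a n m "0\<^sub>m 0 (dim_col b)" 0 k b] by auto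

lemma hcat_star:
  assumes "a \<in> carrier_mat n m" "b \<in> carrier_mat n k"
  shows "hcat a b * mat_star (hcat a b) = a * mat_star a + b * mat_star b"
    and "mat_star (hcat a b) * hcat a b =
      four_block_mat (mat_star a * a) (mat_star a * b) (mat_star b * a) (mat_star b * b)"
proof -
  have s: "mat_star (hcat a b) = four_block_mat (mat_star a) (0\<^sub>m m 0) (mat_star b) (0\<^sub>m k 0)"
    unfolding hcat_def using assms by (subst mat_star_four_block[of _ n m _ k _ 0]) auto
  have h: "hcat a b = four_block_mat a b (0\<^sub>m 0 m) (0\<^sub>m 0 k)"
    unfolding hcat_def using assms by simp
  have "hcat a b * mat_star (hcat a b) = four_block_mat (a * mat_star a + b * mat_star b)
     (a * 0\<^sub>m m 0 + b * 0\<^sub>m k 0) (0\<^sub>m 0 m * mat_star a + 0\<^sub>m 0 k * mat_star b) (0\<^sub>m 0 m * 0\<^sub>m m 0 + 0\<^sub>m 0 k * 0\<^sub>m k 0)"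
    unfolding s unfolding h by (rule mult_four_block_mat) (use assms in auto)
  also have "\<dots> = a * mat_star a + b * mat_star b"
    by (rule eq_matI) (use assms in auto)
  finally show "hcat a b * mat_star (hcat a b) = a * mat_star a + b * mat_star b" .
  have "mat_star (hcat a b) * hcat a b = four_block_mat (mat_star a * a + 0\<^sub>m m 0 * 0\<^sub>m 0 m)
     (mat_star a * b + 0\<^sub>m m 0 * 0\<^sub>m 0 k) (mat_star b * a + 0\<^sub>m k 0 * 0\<^sub>m 0 m) (mat_star b * b + 0\<^sub>m k 0 * 0\<^sub>m 0 k)"
    unfolding s unfolding h by (rule mult_four_block_mat) (use assms in auto)
  also have "\<dots> = four_block_mat (mat_star a * a) (mat_star a * b) (mat_star b * a) (mat_star b * b)"
    using assms by (intro cong_four_block_mat) (auto intro!: eq_matI simp: scalar_prod_def)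
  finally show "mat_star (hcat a b) * hcat a b =
      four_block_mat (mat_star a * a) (mat_star a * b) (mat_star b * a) (mat_star b * b)" .
qed

text \<open>The row (p q) is the partial isometry: its cross terms p q and q p vanish, and its range
  projection is p + q. Addition of classes is thereby reduced to orthogonal sums of equal
  size.\<close>

lemma orthogonal_sum_mvn:
  assumes "p \<in> projections n" "q \<in> projections n" "0 < n" "p * q = 0\<^sub>m n n"
  shows "p + q \<in> projections n" "(diag_sum p q, p + (q :: 'a::cstar_algebra_1 mat)) \<in> mvn_rel"
proof -
  note p = projectionsD[OF assms(1)] and q = projectionsD[OF assms(2)]
  have qp: "q * p = 0\<^sub>m n n"
    using mat_star_mult[OF p(1) q(1)] assms(4) p q by simp
  have "(p + q) * (p + q) = p * p + q * p + (p * q + q * q)"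
    using p q by (simp add: add_mult_distrib_mat[of _ n n] mult_add_distrib_mat[of _ n n])
  then show pq: "p + q \<in> projections n"
    unfolding projections_def using p q qp assms(4) by (simp add: mat_star_add[of _ n n])
  show "(diag_sum p q, p + q) \<in> mvn_rel"
  proof (rule mvn_relI[OF diag_sum_projections[OF assms(1,2)] pq])
    show "hcat p q \<in> carrier_mat n (n + n)" by (rule hcat_carrier[OF p(1) q(1)])
    show "mat_star (hcat p q) * hcat p q = diag_sum p q"
      unfolding hcat_star(2)[OF p(1) q(1)] using p q qp assms(4) by (simp add: diag_sum_def)
    show "hcat p q * mat_star (hcat p q) = p + q"
      unfolding hcat_star(1)[OF p(1) q(1)] using p q by simp
  qed (use assms in auto)
qed

text \<open>The row (0 p) is the partial isometry. Sizes are positive, so the neutral class is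
  represented by the zero matrix of size 1 and not by an empty one.\<close>

lemma zero_diag_sum_mvn:
  assumes "p \<in> projections n" "0 < n"
  shows "(diag_sum (0\<^sub>m 1 1) p, p :: 'a::cstar_algebra_1 mat) \<in> mvn_rel"
proof -
  note p = projectionsD[OF assms(1)]
  have z: "(0\<^sub>m 1 1 :: 'a mat) \<in> projections 1" by (simp add: projections_def)
  have c: "(0\<^sub>m n 1 :: 'a mat) \<in> carrier_mat n 1" by simp
  show ?thesis
  proof (rule mvn_relI[OF diag_sum_projections[OF z assms(1)] assms(1)])
    show "hcat (0\<^sub>m n 1) p \<in> carrier_mat n (1 + n)" by (rule hcat_carrier[OF c p(1)])
    show "mat_star (hcat (0\<^sub>m n 1) p) * hcat (0\<^sub>m n 1) p = diag_sum (0\<^sub>m 1 1) p"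
      unfolding hcat_star(2)[OF c p(1)] using p by (simp add: diag_sum_def)
    show "hcat (0\<^sub>m n 1) p * mat_star (hcat (0\<^sub>m n 1) p) = p"
      unfolding hcat_star(1)[OF c p(1)] using p by simp
  qed (use assms in auto)
qed

lemma diag_sum_commute_mvn:
  assumes "p \<in> projections n" "q \<in> projections m" "0 < n" "0 < m"
  shows "(diag_sum p q, diag_sum q (p :: 'a::cstar_algebra_1 mat)) \<in> mvn_rel"
proof -
  note p = projectionsD[OF assms(1)] and q = projectionsD[OF assms(2)]
  \<comment> \<open>The flip of the two summands, cut down to p and q.\<close>
  define v where "v = four_block_mat (0\<^sub>m m n) q p (0\<^sub>m n m)"
  have s: "mat_star v = four_block_mat (0\<^sub>m n m) p q (0\<^sub>m m n)"
    unfolding v_def using p q by (subst mat_star_four_block[of _ m n _ m _ n]) auto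
  show ?thesis
  proof (rule mvn_relI[OF diag_sum_projections[OF assms(1,2)] diag_sum_projections[OF assms(2,1)]])
    show "v \<in> carrier_mat (m + n) (n + m)"
      unfolding v_def by (rule four_block_carrier_mat) auto
    have "mat_star v * v = four_block_mat (0\<^sub>m n m * 0\<^sub>m m n + p * p) (0\<^sub>m n m * q + p * 0\<^sub>m n m)
       (q * 0\<^sub>m m n + 0\<^sub>m m n * p) (q * q + 0\<^sub>m m n * 0\<^sub>m n m)"
      unfolding s unfolding v_def by (rule mult_four_block_mat) (use p q in auto)
    then show "mat_star v * v = diag_sum p q" using p q by (simp add: diag_sum_def)
    have "v * mat_star v = four_block_mat (0\<^sub>m m n * 0\<^sub>m n m + q * q) (0\<^sub>m m n * p + q * 0\<^sub>m m n)
       (p * 0\<^sub>m n m + 0\<^sub>m n m * q) (p * p + 0\<^sub>m n m * 0\<^sub>m m n)"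
      unfolding s unfolding v_def by (rule mult_four_block_mat) (use p q in auto)
    then show "v * mat_star v = diag_sum q p" using p q by (simp add: diag_sum_def)
  qed (use assms in auto)
qed

lemma diag_sum_assoc: "diag_sum (diag_sum a b) c = diag_sum a (diag_sum b c)"
  unfolding diag_sum_def using assoc_four_block_mat[of a b c] by simp

lemma comm_monoid_MvN: "comm_monoid (MvN :: 'a::cstar_algebra_1 mat set monoid)"
proof (rule comm_monoidI)
  have z: "(0\<^sub>m 1 1 :: 'a mat) \<in> projections 1" by (simp add: projections_def)
  show "\<one>\<^bsub>MvN\<^esub> \<in> carrier (MvN :: 'a mat set monoid)"
    using mvn_class_closed[OF z] by (simp add: MvN_def)
  fix X :: "'a mat set" assume "X \<in> carrier MvN"
  then obtain n p where p: "0 < n" "p \<in> projections n" "X = mvn_class p" by (rule carrier_MvNE)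
  note pa = all_projectionsI[OF p(2,1)]
  have "\<one>\<^bsub>MvN\<^esub> = mvn_class (0\<^sub>m 1 1 :: 'a mat)" by (simp add: MvN_def)
  then show "\<one>\<^bsub>MvN\<^esub> \<otimes>\<^bsub>MvN\<^esub> X = X"
    using p mult_MvN[OF all_projectionsI[OF z] pa] mvn_class_eqI[OF zero_diag_sum_mvn[OF p(2,1)]] by simp
  fix Y :: "'a mat set" assume "Y \<in> carrier MvN"
  then obtain m q where q: "0 < m" "q \<in> projections m" "Y = mvn_class q" by (rule carrier_MvNE)
  note qa = all_projectionsI[OF q(2,1)]
  note pq = diag_sum_projections[OF p(2) q(2)]
  show "X \<otimes>\<^bsub>MvN\<^esub> Y \<in> carrier MvN"
    unfolding p q mult_MvN[OF pa qa] using mvn_class_closed[OF pq] p(1) by simp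
  show "X \<otimes>\<^bsub>MvN\<^esub> Y = Y \<otimes>\<^bsub>MvN\<^esub> X"
    unfolding p q mult_MvN[OF pa qa] mult_MvN[OF qa pa]
    by (rule mvn_class_eqI[OF diag_sum_commute_mvn[OF p(2) q(2) p(1) q(1)]])
  fix Z :: "'a mat set" assume "Z \<in> carrier MvN"
  then obtain k r where r: "0 < k" "r \<in> projections k" "Z = mvn_class r" by (rule carrier_MvNE)
  note ra = all_projectionsI[OF r(2,1)]
  have "diag_sum p q \<in> all_projections" "diag_sum q r \<in> all_projections"
    using all_projectionsI[OF pq] all_projectionsI[OF diag_sum_projections[OF q(2) r(2)]] p q by auto
  then show "X \<otimes>\<^bsub>MvN\<^esub> Y \<otimes>\<^bsub>MvN\<^esub> Z = X \<otimes>\<^bsub>MvN\<^esub> (Y \<otimes>\<^bsub>MvN\<^esub> Z)"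
    unfolding p q r using pa qa ra by (simp add: mult_MvN diag_sum_assoc)
qed

interpretation MvN: comm_monoid "MvN :: 'a::cstar_algebra_1 mat set monoid"
  by (rule comm_monoid_MvN)

lemma mult_MvN_projections:
  "p \<in> projections n \<Longrightarrow> q \<in> projections m \<Longrightarrow> 0 < n \<Longrightarrow> 0 < m \<Longrightarrow>
   mvn_class p \<otimes>\<^bsub>MvN\<^esub> mvn_class q = mvn_class (diag_sum p q)"
  by (rule mult_MvN) (auto intro: all_projectionsI)

lemma mvn_class_zero: "0 < n \<Longrightarrow> mvn_class (0\<^sub>m n n :: 'a::cstar_algebra_1 mat) = \<one>\<^bsub>MvN\<^esub>"
proof -
  assume n: "0 < n"
  have "((0\<^sub>m n n :: 'a mat), 0\<^sub>m 1 1) \<in> mvn_rel"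
    by (rule mvn_relI[of _ n _ 1 "0\<^sub>m 1 n"]) (use n in \<open>auto simp: projections_def\<close>)
  then show ?thesis using mvn_class_eqI by (fastforce simp: MvN_def)
qed

section \<open>Finitely supported infinite matrices\<close>

text \<open>
  Matrices of all sizes are embedded into one algebra without unit, so that the perturbation
  arguments can be carried out in the class of normed algebras.
\<close>

definition supported :: "nat \<Rightarrow> (nat \<Rightarrow> nat \<Rightarrow> 'a::zero) \<Rightarrow> bool" where
  "supported n f \<longleftrightarrow> (\<forall>i j. n \<le> i \<or> n \<le> j \<longrightarrow> f i j = 0)"

typedef (overloaded) 'a fmat = "{f :: nat \<Rightarrow> nat \<Rightarrow> 'a::cstar_algebra_1. \<exists>n. supported n f}"
  morphisms entry Abs_fmat
  by (rule exI[of _ "\<lambda>_ _. 0"]) (simp add: supported_def)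

abbreviation fits :: "nat \<Rightarrow> 'a::cstar_algebra_1 fmat \<Rightarrow> bool" where
  "fits n a \<equiv> supported n (entry a)"

lemma fmat_eqI: "(\<And>i j. entry a i j = entry b i j) \<Longrightarrow> a = b"
  using entry_inject[of a b] by blast

lemma entry_Abs_fmat: "supported n f \<Longrightarrow> entry (Abs_fmat f) = f"
  using Abs_fmat_inverse by blast

text \<open>An arbitrary bound, not the least one. The sums that define product and norm do not
  depend on it, by \<open>entry_times\<close> and \<open>norm_fmat_eq\<close>.\<close>

definition extent :: "'a::cstar_algebra_1 fmat \<Rightarrow> nat" where
  "extent a = (SOME n. fits n a)"

lemma fits_extent: "fits (extent a) a"
  using entry[of a] unfolding extent_def by (auto intro: someI_ex)

lemma fits_mono: "fits n a \<Longrightarrow> n \<le> m \<Longrightarrow> fits m a"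
  unfolding supported_def by auto

lemma common_extent: obtains n where "fits n a" "fits n b" "fits n c"
  using fits_extent[of a] fits_extent[of b] fits_extent[of c]
    fits_mono[of _ _ "max (extent a) (max (extent b) (extent c))"] by (metis max.cobounded1 max.cobounded2 max.coboundedI2)

lemma supported_outside: "supported n f \<Longrightarrow> n \<le> i \<or> n \<le> j \<Longrightarrow> f i j = 0"
  unfolding supported_def by blast

lemma supported_inside: "supported n f \<Longrightarrow> f i j \<noteq> 0 \<Longrightarrow> i < n \<and> j < n"
  by (meson not_less supported_outside)

instantiation fmat :: (cstar_algebra_1) ab_group_add
begin

definition zero_fmat where "0 = Abs_fmat (\<lambda>_ _. 0)"
definition plus_fmat where "a + b = Abs_fmat (\<lambda>i j. entry a i j + entry b i j)"
definition uminus_fmat where "- a = Abs_fmat (\<lambda>i j. - entry a i j)"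
definition minus_fmat where "a - b = Abs_fmat (\<lambda>i j. entry a i j - entry b i j)"

lemma entry_zero [simp]: "entry 0 i j = 0"
  unfolding zero_fmat_def by (subst entry_Abs_fmat[of 0]) (auto simp: supported_def)

lemma entry_plus [simp]: "entry (a + b) i j = entry a i j + entry b i j"
proof -
  obtain n where "fits n a" "fits n b" by (rule common_extent)
  then show ?thesis unfolding plus_fmat_def by (subst entry_Abs_fmat[of n]) (auto simp: supported_def)
qed

lemma entry_uminus [simp]: "entry (- a) i j = - entry a i j"
  unfolding uminus_fmat_def using fits_extent[of a]
  by (subst entry_Abs_fmat[of "extent a"]) (auto simp: supported_def)

lemma entry_minus [simp]: "entry (a - b) i j = entry a i j - entry b i j"
proof -
  obtain n where "fits n a" "fits n b" by (rule common_extent)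
  then show ?thesis unfolding minus_fmat_def by (subst entry_Abs_fmat[of n]) (auto simp: supported_def)
qed

instance by standard (auto intro!: fmat_eqI)

end

lemma fits_plus: "fits n a \<Longrightarrow> fits n b \<Longrightarrow> fits n (a + b)"
  by (simp add: supported_def)

lemma fits_minus: "fits n a \<Longrightarrow> fits n b \<Longrightarrow> fits n (a - b)"
  by (simp add: supported_def)

instantiation fmat :: (cstar_algebra_1) ring
begin

definition times_fmat where
  "a * b = Abs_fmat (\<lambda>i j. \<Sum>k<extent a. entry a i k * entry b k j)"

text \<open>It is enough that the left factor fits, because its vanishing columns remove the
  remaining terms. The two summation bounds are compared through their maximum.\<close>

lemma entry_times:
  assumes "fits n a"
  shows "entry (a * b) i j = (\<Sum>k<n. entry a i k * entry b k j)"
proof -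
  obtain m where m: "fits m a" "fits m b" by (rule common_extent)
  have "supported m (\<lambda>i j. \<Sum>k<extent a. entry a i k * entry b k j)"
    using m by (auto simp: supported_def)
  then have "entry (a * b) i j = (\<Sum>k<extent a. entry a i k * entry b k j)"
    unfolding times_fmat_def by (simp add: entry_Abs_fmat)
  also have "\<dots> = (\<Sum>k<max n (extent a). entry a i k * entry b k j)"
    by (rule sum.mono_neutral_left) (auto simp: supported_outside[OF fits_extent])
  also have "\<dots> = (\<Sum>k<n. entry a i k * entry b k j)"
    by (rule sum.mono_neutral_right) (auto simp: supported_outside[OF assms])
  finally show ?thesis .
qed

lemma fits_times: "fits n a \<Longrightarrow> fits n b \<Longrightarrow> fits n (a * b)"
  by (auto simp: supported_def entry_times)

instance
proof
  fix a b c :: "'a fmat"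
  obtain n where n: "fits n a" "fits n b" "fits n c" by (rule common_extent)
  note nab = fits_times[OF n(1,2)]
  show "a * b * c = a * (b * c)"
  proof (rule fmat_eqI)
    fix i j
    have "entry (a * b * c) i j = (\<Sum>k<n. entry (a * b) i k * entry c k j)"
      by (rule entry_times[OF nab])
    also have "\<dots> = (\<Sum>k<n. \<Sum>l<n. entry a i l * entry b l k * entry c k j)"
      by (simp add: entry_times[OF n(1)] sum_distrib_right)
    also have "\<dots> = (\<Sum>l<n. \<Sum>k<n. entry a i l * entry b l k * entry c k j)"
      by (rule sum.swap)
    also have "\<dots> = entry (a * (b * c)) i j"
      by (simp add: entry_times[OF n(2)] entry_times[OF n(1)] sum_distrib_left mult.assoc)
    finally show "entry (a * b * c) i j = entry (a * (b * c)) i j" .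
  qed
  show "(a + b) * c = a * c + b * c"
    by (rule fmat_eqI)
      (simp add: entry_times[OF fits_plus[OF n(1,2)]] entry_times[OF n(1)] entry_times[OF n(2)]
        distrib_right sum.distrib)
  show "a * (b + c) = a * b + a * c"
    by (rule fmat_eqI) (simp add: entry_times[OF n(1)] distrib_left sum.distrib)
qed

end

instantiation fmat :: (cstar_algebra_1) real_vector
begin

definition scaleR_fmat where "r *\<^sub>R a = Abs_fmat (\<lambda>i j. r *\<^sub>R entry a i j)"

lemma entry_scaleR [simp]: "entry (r *\<^sub>R a) i j = r *\<^sub>R entry a i j"
  unfolding scaleR_fmat_def using fits_extent[of a]
  by (subst entry_Abs_fmat[of "extent a"]) (auto simp: supported_def)

instance
  by standard (auto intro!: fmat_eqI simp: scaleR_add_right scaleR_add_left)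

end

instantiation fmat :: (cstar_algebra_1) real_normed_vector
begin

text \<open>This is not the C*-norm of matrices. It is submultiplicative, the adjoint is isometric
  for it, and convergence within a fixed size is convergence of the entries, which is what the
  perturbation arguments rely on.\<close>

definition norm_fmat :: "'a fmat \<Rightarrow> real" where
  "norm_fmat a = (\<Sum>i<extent a. \<Sum>j<extent a. norm (entry a i j))"
definition sgn_fmat :: "'a fmat \<Rightarrow> 'a fmat" where "sgn_fmat a = a /\<^sub>R norm a"
definition dist_fmat :: "'a fmat \<Rightarrow> 'a fmat \<Rightarrow> real" where "dist_fmat a b = norm (a - b)"
definition uniformity_fmat :: "('a fmat \<times> 'a fmat) filter" where
  "uniformity_fmat = (INF e\<in>{0 <..}. principal {(x, y). dist x y < e})"
definition open_fmat :: "'a fmat set \<Rightarrow> bool" where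
  "open_fmat U \<longleftrightarrow> (\<forall>x\<in>U. \<forall>\<^sub>F (x', y) in uniformity. x' = x \<longrightarrow> y \<in> U)"

lemma norm_fmat_eq:
  assumes "fits n a"
  shows "norm a = (\<Sum>i<n. \<Sum>j<n. norm (entry a i j))"
proof -
  have "norm a = (\<Sum>(i, j)\<in>{..<extent a} \<times> {..<extent a}. norm (entry a i j))"
    by (simp add: norm_fmat_def sum.cartesian_product)
  also have "\<dots> = (\<Sum>(i, j)\<in>{..<max n (extent a)} \<times> {..<max n (extent a)}. norm (entry a i j))"
    by (rule sum.mono_neutral_left) (auto dest: supported_inside[OF fits_extent])
  also have "\<dots> = (\<Sum>(i, j)\<in>{..<n} \<times> {..<n}. norm (entry a i j))"
    by (rule sum.mono_neutral_right) (auto dest: supported_inside[OF assms])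
  finally show ?thesis by (simp add: sum.cartesian_product)
qed

instance
proof
  fix a b :: "'a fmat" and r s :: real
  obtain n where n: "fits n a" "fits n b" by (rule common_extent)
  show "norm (a + b) \<le> norm a + norm b"
    unfolding norm_fmat_eq[OF n(1)] norm_fmat_eq[OF n(2)] norm_fmat_eq[OF fits_plus[OF n]]
    by (simp flip: sum.distrib) (intro sum_mono norm_triangle_ineq)
  have "fits n (r *\<^sub>R a)" using n(1) by (simp add: supported_def)
  then show "norm (r *\<^sub>R a) = \<bar>r\<bar> * norm a"
    unfolding norm_fmat_eq[OF n(1)] by (simp add: norm_fmat_eq sum_distrib_left)
  show "norm a = 0 \<longleftrightarrow> a = 0"
  proof
    assume "norm a = 0"
    then have "\<forall>i<n. \<forall>j<n. entry a i j = 0"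
      unfolding norm_fmat_eq[OF n(1)] by (simp add: sum_nonneg_eq_0_iff sum_nonneg)
    then show "a = 0" using supported_outside[OF n(1)] by (intro fmat_eqI) (metis entry_zero not_less)
  qed (simp add: norm_fmat_def)
qed (simp_all add: sgn_fmat_def dist_fmat_def uniformity_fmat_def open_fmat_def)

end

instance fmat :: (cstar_algebra_1) real_normed_algebra
proof
  fix a b :: "'a fmat" and r :: real
  obtain n where n: "fits n a" "fits n b" by (rule common_extent)
  show "norm (a * b) \<le> norm a * norm b"
  proof -
    have "norm (a * b) = (\<Sum>i<n. \<Sum>j<n. norm (\<Sum>k<n. entry a i k * entry b k j))"
      by (simp add: norm_fmat_eq[OF fits_times[OF n]] entry_times[OF n(1)])
    also have "\<dots> \<le> (\<Sum>i<n. \<Sum>j<n. \<Sum>k<n. norm (entry a i k) * norm (entry b k j))"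
      by (intro sum_mono sum_norm_le norm_mult_ineq)
    also have "\<dots> = (\<Sum>i<n. \<Sum>k<n. norm (entry a i k) * (\<Sum>j<n. norm (entry b k j)))"
      by (subst sum.swap) (simp add: sum_distrib_left)
    also have "\<dots> \<le> (\<Sum>i<n. \<Sum>k<n. norm (entry a i k) * norm b)"
      unfolding norm_fmat_eq[OF n(2)]
      by (intro sum_mono mult_left_mono member_le_sum[of _ _ "\<lambda>k. \<Sum>j<n. norm (entry b k j)"] sum_nonneg) auto
    also have "\<dots> = norm a * norm b"
      by (simp add: norm_fmat_eq[OF n(1)] sum_distrib_right)
    finally show ?thesis .
  qed
  show "(r *\<^sub>R a) * b = r *\<^sub>R (a * b)"
  proof -
    have "fits n (r *\<^sub>R a)" using n(1) by (simp add: supported_def)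
    then show ?thesis
      by (intro fmat_eqI) (simp add: entry_times entry_times[OF n(1)] scaleR_sum_right)
  qed
  show "a * (r *\<^sub>R b) = r *\<^sub>R (a * b)"
    by (intro fmat_eqI) (simp add: entry_times[OF n(1)] scaleR_sum_right)
qed

lemma norm_entry_le: "norm (entry a i j) \<le> norm a"
proof (cases "i < extent a \<and> j < extent a")
  case True
  have "norm (entry a i j) \<le> (\<Sum>j<extent a. norm (entry a i j))"
    using True by (intro member_le_sum) auto
  also have "\<dots> \<le> norm a"
    unfolding norm_fmat_def using True by (intro member_le_sum[of i]) (auto intro: sum_nonneg)
  finally show ?thesis .
next
  case False
  then show ?thesis using supported_outside[OF fits_extent[of a], of i j] by auto
qed

lemma bounded_linear_entry: "bounded_linear (\<lambda>a. entry a i j)"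
  by (rule bounded_linear_intro[of _ 1]) (auto simp: norm_entry_le)

lemmas tendsto_entry = bounded_linear.tendsto[OF bounded_linear_entry]

definition fstar :: "'a::cstar_algebra_1 fmat \<Rightarrow> 'a fmat" where
  "fstar a = Abs_fmat (\<lambda>i j. star (entry a j i))"

lemma entry_fstar [simp]: "entry (fstar a) i j = star (entry a j i)"
  unfolding fstar_def using fits_extent[of a]
  by (subst entry_Abs_fmat[of "extent a"]) (auto simp: supported_def)

lemma fits_fstar: "fits n a \<Longrightarrow> fits n (fstar a)"
  by (simp add: supported_def)

lemma fstar_add: "fstar (a + b) = fstar a + fstar b"
  by (rule fmat_eqI) (simp add: star_add)

lemma fstar_diff: "fstar (a - b) = fstar a - fstar b"
  by (rule fmat_eqI) (simp add: star_diff)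

lemma star_scaleR: "star (r *\<^sub>R x) = r *\<^sub>R star (x::'a::cstar_algebra_1)"
  using star_cscale[of "complex_of_real r" x] by (simp add: cscale_of_real)

lemma fstar_scaleR: "fstar (r *\<^sub>R a) = r *\<^sub>R fstar a"
  by (rule fmat_eqI) (simp add: star_scaleR)

lemma fstar_fstar [simp]: "fstar (fstar a) = a"
  by (rule fmat_eqI) (simp add: star_star)

lemma fstar_times: "fstar (a * b) = fstar b * fstar a"
proof -
  obtain n where n: "fits n a" "fits n b" by (rule common_extent)
  show ?thesis
    by (rule fmat_eqI)
      (simp add: entry_times[OF n(1)] entry_times[OF fits_fstar[OF n(2)]] star_sum star_mult)
qed

lemma norm_fstar: "norm (fstar a) = norm a"
  unfolding norm_fmat_eq[OF fits_extent[of a]] norm_fmat_eq[OF fits_fstar[OF fits_extent[of a]]]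
  by simp (rule sum.swap)

lemma bounded_linear_fstar: "bounded_linear fstar"
  by (rule bounded_linear_intro[of _ 1]) (simp_all add: fstar_add fstar_scaleR norm_fstar)

text \<open>The whole type is not complete, since supports may grow along a Cauchy sequence. With a
  common size n the entries converge in the complete algebra, and the norm is a finite sum over
  them.\<close>

lemma fmat_convergent:
  fixes z :: "nat \<Rightarrow> 'a::cstar_algebra_1 fmat"
  assumes n: "\<And>k. fits n (z k)" and step: "\<And>k. norm (z (Suc k) - z k) \<le> C * (1/2) ^ k"
  obtains l where "z \<longlonglongrightarrow> l" "fits n l"
proof -
  have "convergent (\<lambda>k. entry (z k) i j)" for i j
  proof -
    have "summable (\<lambda>k. C * (1/2::real) ^ k)" by (intro summable_mult summable_geometric) simp
    moreover have "norm (entry (z (Suc k)) i j - entry (z k) i j) \<le> C * (1/2) ^ k" for k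
      using norm_entry_le[of "z (Suc k) - z k" i j] step[of k] by simp
    ultimately have "summable (\<lambda>k. entry (z (Suc k)) i j - entry (z k) i j)"
      by (rule summable_comparison_test'[where N = 0])
    then have "convergent (\<lambda>m. \<Sum>k<m. entry (z (Suc k)) i j - entry (z k) i j)"
      by (simp add: summable_iff_convergent)
    then have "convergent (\<lambda>m. entry (z m) i j - entry (z 0) i j)"
      by (simp only: sum_lessThan_telescope[of "\<lambda>k. entry (z k) i j"])
    then have "convergent (\<lambda>m. entry (z m) i j - entry (z 0) i j + entry (z 0) i j)"
      by (intro convergent_add convergent_const)
    then show ?thesis by simp
  qed
  then obtain f where f: "\<And>i j. (\<lambda>k. entry (z k) i j) \<longlonglongrightarrow> f i j"
    unfolding convergent_def by metis
  have "supported n f"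
    unfolding supported_def
  proof (intro allI impI)
    fix i j assume "n \<le> i \<or> n \<le> j"
    then have "(\<lambda>k. entry (z k) i j) = (\<lambda>k. 0)" using supported_outside[OF n] by auto
    with f[of i j] show "f i j = 0" by (simp add: LIMSEQ_const_iff)
  qed
  define l where "l = Abs_fmat f"
  have l: "entry l = f" unfolding l_def by (rule entry_Abs_fmat[OF \<open>supported n f\<close>])
  then have wl: "fits n l" using \<open>supported n f\<close> by simp
  have "(\<lambda>k. \<Sum>i<n. \<Sum>j<n. norm (entry (z k) i j - f i j)) \<longlonglongrightarrow> (\<Sum>i<n. \<Sum>j<n. 0)"
    using f by (intro tendsto_sum tendsto_norm_zero) (simp add: LIM_zero_iff)
  then have "(\<lambda>k. norm (z k - l)) \<longlonglongrightarrow> 0"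
    unfolding norm_fmat_eq[OF fits_minus[OF n wl]] by (simp add: l)
  then have "z \<longlonglongrightarrow> l" by (simp add: tendsto_norm_zero_iff LIM_zero_iff)
  then show ?thesis using that wl by blast
qed

section \<open>Perturbation of projections\<close>

text \<open>Neither unit nor adjoint is asked for, and scalars are real. This covers at once
  matrices of bounded size, matrices with entries at one level, selfadjoint elements of a
  bicommutant and corners of a projection; a limit of expressions in x inherits membership from
  x.\<close>

definition closed_subalgebra :: "'a::real_normed_algebra set \<Rightarrow> bool" where
  "closed_subalgebra S \<longleftrightarrow> (\<forall>f l. (\<forall>n::nat. f n \<in> S) \<longrightarrow> f \<longlonglongrightarrow> l \<longrightarrow> l \<in> S) \<and> 0 \<in> S \<and>
     (\<forall>a\<in>S. \<forall>b\<in>S. a + b \<in> S \<and> a * b \<in> S) \<and> (\<forall>r. \<forall>a\<in>S. r *\<^sub>R a \<in> S)"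

lemma closed_subalgebraI:
  assumes "\<And>f l. (\<And>n::nat. f n \<in> S) \<Longrightarrow> f \<longlonglongrightarrow> l \<Longrightarrow> l \<in> S"
    and "0 \<in> S" "\<And>a b. a \<in> S \<Longrightarrow> b \<in> S \<Longrightarrow> a + b \<in> S" "\<And>a b. a \<in> S \<Longrightarrow> b \<in> S \<Longrightarrow> a * b \<in> S"
    "\<And>r a. a \<in> S \<Longrightarrow> r *\<^sub>R a \<in> S"
  shows "closed_subalgebra S"
  using assms unfolding closed_subalgebra_def by blast

lemma closed_subalgebraD:
  assumes "closed_subalgebra S"
  shows "0 \<in> S" "a \<in> S \<Longrightarrow> b \<in> S \<Longrightarrow> a + b \<in> S" "a \<in> S \<Longrightarrow> b \<in> S \<Longrightarrow> a * b \<in> S"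
    "a \<in> S \<Longrightarrow> r *\<^sub>R a \<in> S" "a \<in> S \<Longrightarrow> b \<in> S \<Longrightarrow> a - b \<in> S"
    "(\<And>n::nat. f n \<in> S) \<Longrightarrow> f \<longlonglongrightarrow> l \<Longrightarrow> l \<in> S"
proof -
  show *: "a + b \<in> S" if "a \<in> S" "b \<in> S" for a b using assms that unfolding closed_subalgebra_def by blast
  show **: "r *\<^sub>R a \<in> S" if "a \<in> S" for r a using assms that unfolding closed_subalgebra_def by blast
  show "a \<in> S \<Longrightarrow> b \<in> S \<Longrightarrow> a - b \<in> S" using *[of a "(-1) *\<^sub>R b"] **[of b "-1"] by simp
qed (use assms in \<open>unfold closed_subalgebra_def, blast+\<close>)

lemma closed_subalgebra_fits: "closed_subalgebra {a :: 'a::cstar_algebra_1 fmat. fits n a}"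
proof (rule closed_subalgebraI)
  fix f and l :: "'a fmat" assume f: "\<And>k. f k \<in> {a. fits n a}" "f \<longlonglongrightarrow> l"
  have "entry l i j = 0" if "n \<le> i \<or> n \<le> j" for i j
    using tendsto_entry[OF f(2), of i j] supported_outside[of n "entry (f _)" i j] f(1) that
    by (simp add: LIMSEQ_const_iff)
  then show "l \<in> {a. fits n a}" by (simp add: supported_def)
qed (use fits_plus fits_times in \<open>auto simp: supported_def entry_times\<close>)

lemma norm_add_half_diff:
  fixes u :: "'a::real_normed_vector"
  shows "norm (u + (1/2) *\<^sub>R (w - t)) \<le> norm u + (1/2) * (norm w + norm t)"
proof -
  have "norm (u + (1/2) *\<^sub>R (w - t)) \<le> norm u + norm ((1/2) *\<^sub>R (w - t))"
    by (rule norm_triangle_ineq)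
  also have "norm ((1/2) *\<^sub>R (w - t)) = (1/2) * norm (w - t)" by simp
  also have "\<dots> \<le> (1/2) * (norm w + norm t)" by (intro mult_left_mono norm_triangle_ineq4) simp
  finally show ?thesis by simp
qed

text \<open>
  The element \<open>1 + z\<close> plays the role of \<open>(1 - x)\<^sup>-\<^sup>1\<^sup>/\<^sup>2\<close>; the equation \<open>(1 + z)\<^sup>2 (1 - x) = 1\<close> is
  solved as a fixed point problem for \<open>z\<close>.
\<close>

lemma inverse_sqrt:
  fixes x :: "'a::cstar_algebra_1 fmat"
  assumes x: "norm x \<le> 1/8"
  obtains z where "norm z \<le> norm x" "2 *\<^sub>R z + z * z = x + 2 *\<^sub>R (x * z) + x * z * z"
    "\<And>S. closed_subalgebra S \<Longrightarrow> x \<in> S \<Longrightarrow> z \<in> S"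
proof -
  \<comment> \<open>The equation (1 + z)^2 (1 - x) = 1, multiplied out and solved for the linear
    term 2 z.\<close>
  define T where "T z = (1/2) *\<^sub>R (x + 2 *\<^sub>R (x * z) + x * z * z - z * z)" for z
  define y where "y k = (T ^^ k) 0" for k
  have yS: "y k \<in> S" if "closed_subalgebra S" "x \<in> S" for S k
    using closed_subalgebraD(1-5)[OF that(1)] that(2)
    by (induction k) (simp_all add: y_def T_def)
  \<comment> \<open>T maps the ball of radius 1/4 into itself. On that ball its Lipschitz constant
    is at most 1/8 + 1/32 + 1/4, which is below 1/2.\<close>
  have bound: "norm (T z) \<le> 1/4" if "norm z \<le> 1/4" for z
  proof -
    have zz: "norm (z * z) \<le> 1/4 * (1/4)"
      using norm_mult_ineq[of z z] mult_mono[OF that that] by simp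
    have xz: "norm (x * z) \<le> 1/8 * (1/4)"
      using norm_mult_ineq[of x z] mult_mono[OF x that] by simp
    have xzz: "norm (x * z * z) \<le> 1/8 * (1/4) * (1/4)"
      using norm_mult_ineq[of "x * z" z] mult_mono[OF xz that] by simp
    have "norm (x + 2 *\<^sub>R (x * z) + x * z * z - z * z) \<le>
        norm x + 2 * norm (x * z) + norm (x * z * z) + norm (z * z)"
      using norm_triangle_ineq4[of "x + 2 *\<^sub>R (x * z) + x * z * z" "z * z"]
        norm_triangle_ineq[of "x + 2 *\<^sub>R (x * z)" "x * z * z"] norm_triangle_ineq[of x "2 *\<^sub>R (x * z)"]
      by simp
    then show ?thesis unfolding T_def using x xz xzz zz by simp
  qed
  have lip: "norm (T a - T b) \<le> 1/2 * norm (a - b)" if a: "norm a \<le> 1/4" and b: "norm b \<le> 1/4" for a b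
  proof -
    let ?d = "a - b"
    \<comment> \<open>The difference of the squares of a and b is a (a - b) + (a - b) b, also when a
      and b do not commute.\<close>
    have eq: "T a - T b = x * ?d + (1/2) *\<^sub>R (x * (a * ?d + ?d * b) - (a * ?d + ?d * b))"
      unfolding T_def by (simp add: algebra_simps flip: scaleR_add_left)
    have d: "norm (a * ?d + ?d * b) \<le> 1/2 * norm ?d"
      using norm_triangle_ineq[of "a * ?d" "?d * b"] norm_mult_ineq[of a ?d] norm_mult_ineq[of ?d b]
        mult_right_mono[OF a norm_ge_zero[of ?d]] mult_left_mono[OF b norm_ge_zero[of ?d]] by simp
    have "norm (x * (a * ?d + ?d * b)) \<le> 1/8 * (1/2 * norm ?d)"
      using norm_mult_ineq[of x "a * ?d + ?d * b"] mult_mono[OF x d] by simp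
    moreover have "norm (x * ?d) \<le> 1/8 * norm ?d"
      using norm_mult_ineq[of x ?d] mult_right_mono[OF x norm_ge_zero[of ?d]] by simp
    moreover have "s + 1/2 * (t + u) \<le> 1/2 * r"
      if "t \<le> 1/8 * (1/2 * r)" "s \<le> 1/8 * r" "u \<le> 1/2 * r" "0 \<le> r" for r s t u :: real
      using that by argo
    ultimately have "norm (x * ?d) + (1/2) * (norm (x * (a * ?d + ?d * b)) + norm (a * ?d + ?d * b)) \<le>
        1/2 * norm ?d"
      using d norm_ge_zero[of ?d] by blast
    with norm_add_half_diff show ?thesis unfolding eq by (rule order_trans)
  qed
  have y0: "y 0 = 0" and ySuc: "y (Suc k) = T (y k)" for k by (simp_all add: y_def)
  have yb: "norm (y k) \<le> 1/4" for k
  proof (induction k)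
    case (Suc k)
    then show ?case unfolding ySuc by (rule bound)
  qed (simp add: y0)
  have ystep: "norm (y (Suc k) - y k) \<le> 1/4 * (1/2) ^ k" for k
  proof (induction k)
    case 0
    show ?case using yb[of 1] by (simp add: y0)
  next
    case (Suc k)
    then show ?case using lip[OF yb[of "Suc k"] yb[of k]] by (simp add: ySuc)
  qed
  \<comment> \<open>All iterates have the size of x, as \<open>fmat_convergent\<close>
    demands.\<close>
  have "fits (extent x) (y k)" for k using yS[OF closed_subalgebra_fits, of "extent x" k] fits_extent[of x] by simp
  then obtain z where z: "y \<longlonglongrightarrow> z" using fmat_convergent[of "extent x" y "1/4"] ystep by blast
  have "(\<lambda>k. T (y k)) \<longlonglongrightarrow> T z"
    unfolding T_def by (intro tendsto_intros z)
  moreover have "(\<lambda>k. T (y k)) \<longlonglongrightarrow> z"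
    using LIMSEQ_Suc[OF z] by (simp add: ySuc)
  ultimately have Tz: "T z = z" by (rule LIMSEQ_unique)
  have zb: "norm z \<le> 1/4"
    using tendsto_norm[OF z] yb by (intro Lim_bounded) auto
  show ?thesis
  proof (rule that)
    have "2 *\<^sub>R T z = x + 2 *\<^sub>R (x * z) + x * z * z - z * z" by (simp add: T_def)
    then show eq: "2 *\<^sub>R z + z * z = x + 2 *\<^sub>R (x * z) + x * z * z" unfolding Tz by simp
    have "norm (2 *\<^sub>R z) \<le> norm x + 2 * norm (x * z) + norm (x * z * z) + norm (z * z)"
    proof -
      have "2 *\<^sub>R z = x + 2 *\<^sub>R (x * z) + x * z * z - z * z" using eq by (simp add: algebra_simps)
      then show ?thesis
        using norm_triangle_ineq4[of "x + 2 *\<^sub>R (x * z) + x * z * z" "z * z"]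
          norm_triangle_ineq[of "x + 2 *\<^sub>R (x * z)" "x * z * z"] norm_triangle_ineq[of x "2 *\<^sub>R (x * z)"]
        by simp
    qed
    moreover have xz: "norm (x * z) \<le> norm x * (1/4)"
      using norm_mult_ineq[of x z] mult_left_mono[OF zb norm_ge_zero[of x]] by simp
    moreover have "norm (x * z * z) \<le> norm x * (1/4) * (1/4)"
      using norm_mult_ineq[of "x * z" z] mult_mono[OF xz zb] by simp
    moreover have "norm (z * z) \<le> 1/4 * norm z"
      using norm_mult_ineq[of z z] mult_right_mono[OF zb norm_ge_zero[of z]] by simp
    moreover have "norm (2 *\<^sub>R z) = 2 * norm z" by simp
    \<comment> \<open>One factor z is estimated by 1/4 in each product, so 2 norm z is at most 25/16
      norm x plus 1/4 norm z.\<close>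
    ultimately show "norm z \<le> norm x" using norm_ge_zero[of x] by argo
    show "z \<in> S" if "closed_subalgebra S" "x \<in> S" for S
      using closed_subalgebraD(6)[OF that(1) yS[OF that] z] .
  qed
qed

definition fproj :: "'a::cstar_algebra_1 fmat \<Rightarrow> bool" where
  "fproj p \<longleftrightarrow> p * p = p \<and> fstar p = p"

text \<open>For selfadjoint x this is a commutative closed real subalgebra containing x. It replaces
  functional calculus: z from \<open>inverse_sqrt\<close> lies in it, hence is selfadjoint and
  commutes with everything that commutes with x.\<close>

definition sa_bicommutant :: "'a::cstar_algebra_1 fmat \<Rightarrow> 'a fmat set" where
  "sa_bicommutant x = {a. fstar a = a \<and> (\<forall>y. y * x = x * y \<longrightarrow> y * a = a * y)}"

lemma sa_bicommutantD:
  "a \<in> sa_bicommutant x \<Longrightarrow> fstar a = a"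
  "a \<in> sa_bicommutant x \<Longrightarrow> y * x = x * y \<Longrightarrow> y * a = a * y"
  unfolding sa_bicommutant_def by blast+

lemma sa_bicommutantI:
  "fstar a = a \<Longrightarrow> (\<And>y. y * x = x * y \<Longrightarrow> y * a = a * y) \<Longrightarrow> a \<in> sa_bicommutant x"
  unfolding sa_bicommutant_def by blast

lemma closed_sa_bicommutant: "closed_subalgebra (sa_bicommutant x)"
proof (rule closed_subalgebraI)
  fix f and l :: "'a fmat"
  assume f: "\<And>n. f n \<in> sa_bicommutant x" "f \<longlonglongrightarrow> l"
  show "l \<in> sa_bicommutant x"
  proof (rule sa_bicommutantI)
    have "(\<lambda>n. fstar (f n)) \<longlonglongrightarrow> fstar l"
      by (rule bounded_linear.tendsto[OF bounded_linear_fstar f(2)])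
    then have "f \<longlonglongrightarrow> fstar l" by (simp only: sa_bicommutantD(1)[OF f(1)])
    then show "fstar l = l" using f(2) by (rule LIMSEQ_unique)
    fix y assume y: "y * x = x * y"
    have "(\<lambda>n. f n * y) \<longlonglongrightarrow> y * l"
      using tendsto_mult_left[OF f(2), of y] by (simp only: sa_bicommutantD(2)[OF f(1) y])
    then show "y * l = l * y" using tendsto_mult_right[OF f(2), of y] by (rule LIMSEQ_unique)
  qed
next
  fix a b assume a: "a \<in> sa_bicommutant x" and b: "b \<in> sa_bicommutant x"
  note a' = sa_bicommutantD[OF a] and b' = sa_bicommutantD[OF b]
  \<comment> \<open>As b commutes with x, it also commutes with every element of the bicommutant.
    Without this a product of selfadjoint elements would not be selfadjoint.\<close>
  have ab: "b * a = a * b"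
  proof (rule a'(2))
    show "b * x = x * b" using b'(2)[of x] by simp
  qed
  show "a * b \<in> sa_bicommutant x"
  proof (rule sa_bicommutantI)
    show "fstar (a * b) = a * b" by (simp add: fstar_times a'(1) b'(1) ab)
    fix y assume y: "y * x = x * y"
    have "y * (a * b) = a * (y * b)" using a'(2)[OF y] by (metis mult.assoc)
    then show "y * (a * b) = a * b * y" using b'(2)[OF y] by (simp add: mult.assoc)
  qed
  show "a + b \<in> sa_bicommutant x"
    by (rule sa_bicommutantI)
      (simp_all add: fstar_add a'(1) b'(1) a'(2)[symmetric] b'(2)[symmetric] distrib_left distrib_right)
next
  fix a r assume a: "a \<in> sa_bicommutant x"
  show "r *\<^sub>R a \<in> sa_bicommutant x"
    by (rule sa_bicommutantI)
      (simp_all add: fstar_scaleR sa_bicommutantD(1)[OF a] sa_bicommutantD(2)[OF a, symmetric])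
next
  show "0 \<in> sa_bicommutant x"
    by (rule sa_bicommutantI) (auto intro: fmat_eqI)
qed

text \<open>
  The projection is \<open>(1 + s (s\<^sup>2)\<^sup>-\<^sup>1\<^sup>/\<^sup>2) / 2\<close> for \<open>s = 2 b - 1\<close>, where \<open>s\<^sup>2 = 1 - 4 (b - b\<^sup>2)\<close>.
\<close>

lemma projection_near_almost_projection:
  fixes b :: "'a::cstar_algebra_1 fmat"
  assumes "fstar b = b" "norm (4 *\<^sub>R (b - b * b)) \<le> 1/8" "closed_subalgebra S" "b \<in> S"
  obtains e where "fproj e" "e \<in> S" "norm (e - b) \<le> (norm b + 1/2) * norm (4 *\<^sub>R (b - b * b))"
proof -
  define x where "x = 4 *\<^sub>R (b - b * b)"
  have xx: "fstar x = x" by (simp add: x_def fstar_diff fstar_times fstar_scaleR assms(1))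
  obtain z where z: "norm z \<le> norm x" "2 *\<^sub>R z + z * z = x + 2 *\<^sub>R (x * z) + x * z * z"
    "\<And>S. closed_subalgebra S \<Longrightarrow> x \<in> S \<Longrightarrow> z \<in> S"
    using inverse_sqrt[of x] assms(2) x_def by blast
  have bx: "b * x = x * b" by (simp add: x_def algebra_simps)
  have "x \<in> sa_bicommutant x" by (rule sa_bicommutantI[OF xx])
  then have zC: "z \<in> sa_bicommutant x" by (rule z(3)[OF closed_sa_bicommutant])
  then have zs: "fstar z = z" and zb: "z * b = b * z" and zx: "z * x = x * z"
    using sa_bicommutantD(1)[OF zC] sa_bicommutantD(2)[OF zC, of b] sa_bicommutantD(2)[OF zC, of x] bx
    by simp_all
  have zb': "z * (b * w) = b * (z * w)" for w using zb by (metis mult.assoc)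
  \<comment> \<open>This is (1 + (2 b - 1) (1 + z)) / 2, multiplied out so that no unit
    occurs.\<close>
  define e where "e = b + b * z - (1/2) *\<^sub>R z"
  show ?thesis
  proof (rule that)
    \<comment> \<open>For s = 2 b - 1 the two sides are (2 e - 1)^2 - 1 and s^2 (1 + z)^2 - 1, where
      s^2 = 1 - x.\<close>
    have "4 *\<^sub>R (e * e - e) = 2 *\<^sub>R z + z * z - (x + 2 *\<^sub>R (x * z) + x * z * z)"
    proof -
      have "x = 4 *\<^sub>R b - 4 *\<^sub>R (b * b)" by (simp add: x_def algebra_simps)
      then show ?thesis
        unfolding e_def by (simp only:) (simp add: algebra_simps zb zb' flip: scaleR_add_left)
    qed
    then have "e * e = e" using z(2) by simp
    moreover have "fstar e = e"
      by (simp add: e_def fstar_add fstar_diff fstar_times fstar_scaleR assms(1) zs zb)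
    ultimately show "fproj e" by (simp add: fproj_def)
    have "x \<in> S" unfolding x_def by (intro closed_subalgebraD(2-5)[OF assms(3)] assms(4))
    then have "z \<in> S" using z(3) assms(3) by blast
    then show "e \<in> S" unfolding e_def by (intro closed_subalgebraD(2-5)[OF assms(3)] assms(4))
    have "e - b = b * z - (1/2) *\<^sub>R z" by (simp add: e_def)
    then have "norm (e - b) \<le> norm b * norm z + 1/2 * norm z"
      using norm_triangle_ineq4[of "b * z" "(1/2) *\<^sub>R z"] norm_mult_ineq[of b z] by simp
    also have "\<dots> \<le> (norm b + 1/2) * norm x"
      using mult_left_mono[OF z(1), of "norm b + 1/2"] by (simp add: distrib_right)
    finally show "norm (e - b) \<le> (norm b + 1/2) * norm (4 *\<^sub>R (b - b * b))" by (simp add: x_def)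
  qed
qed

text \<open>In the corner of p the element p e p = p - x is close to the unit p, and p + z is its
  inverse square root there. Hence v = e (p + z) is the polar part of e p, with initial projection
  p.\<close>

lemma close_projections_equivalent:
  fixes p e :: "'a::cstar_algebra_1 fmat"
  assumes "fproj p" "fproj e" "norm (p - e) < 1" "norm p * norm p * norm (p - e) \<le> 1/8"
    and n: "fits n p" "fits n e"
  obtains v where "fits n v" "fstar v * v = p" "v * fstar v = e"
proof -
  have p: "p * p = p" "fstar p = p" and e: "e * e = e" "fstar e = e"
    using assms(1,2) by (auto simp: fproj_def)
  have pp: "p * (p * w) = p * w" and ee: "e * (e * w) = e * w" for w
    using p e by (metis mult.assoc)+
  define x where "x = p - p * e * p"
  have "x = p * (p - e) * p" by (simp add: x_def algebra_simps p)
  then have "norm x \<le> norm p * norm (p - e) * norm p"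
    using norm_mult_ineq[of "p * (p - e)" p] norm_mult_ineq[of p "p - e"]
    by (meson mult_right_mono norm_ge_zero order_trans)
  then have "norm x \<le> 1/8" using assms(4) by (simp add: mult_ac)
  then obtain z where z: "2 *\<^sub>R z + z * z = x + 2 *\<^sub>R (x * z) + x * z * z"
    "\<And>S. closed_subalgebra S \<Longrightarrow> x \<in> S \<Longrightarrow> z \<in> S"
    using inverse_sqrt[of x] by blast
  have xs: "fstar x = x" by (simp add: x_def fstar_diff fstar_times p e mult.assoc)
  have "x \<in> sa_bicommutant x" by (rule sa_bicommutantI[OF xs])
  then have zC: "z \<in> sa_bicommutant x" by (rule z(2)[OF closed_sa_bicommutant])
  then have zs: "fstar z = z" and zx: "z * x = x * z"
    using sa_bicommutantD(1)[OF zC] sa_bicommutantD(2)[OF zC, of x] by simp_all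
  \<comment> \<open>The corner of p. Membership of z in it makes p act as a unit on z.\<close>
  let ?T = "{a. p * a = a \<and> a * p = a}"
  have "closed_subalgebra ?T"
  proof (rule closed_subalgebraI)
    fix f and l :: "'a fmat" assume f: "\<And>n. f n \<in> ?T" "f \<longlonglongrightarrow> l"
    then have eq: "(\<lambda>n. p * f n) = f" "(\<lambda>n. f n * p) = f" by auto
    show "l \<in> ?T"
      using LIMSEQ_unique[OF tendsto_mult_left[OF f(2), of p, unfolded eq] f(2)]
        LIMSEQ_unique[OF tendsto_mult_right[OF f(2), of p, unfolded eq] f(2)] by simp
  next
    show "a * b \<in> ?T"
      if "a \<in> ?T" "b \<in> ?T" for a b
      using that by (simp add: mult.assoc) (metis mult.assoc)
  qed (auto simp: distrib_left distrib_right)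
  moreover have "x \<in> ?T"
    by (simp add: x_def algebra_simps p pp)
  ultimately have "z \<in> ?T" by (rule z(2))
  then have pz: "p * z = z" "z * p = z" by auto
  have px: "p * x = x" "x * p = x" by (simp_all add: x_def algebra_simps p pp)
  define v where "v = e * (p + z)"
  have vs: "fstar v = (p + z) * e" by (simp add: v_def fstar_times fstar_add p e zs)
  have "p * e * p = p - x" by (simp add: x_def)
  have pxz: "(p + z) * (p - x) * (p + z) = p"
  proof -
    have zxz: "z * (x * w) = x * (z * w)" for w using zx by (metis mult.assoc)
    have "(p + z) * (p - x) * (p + z) = p + (2 *\<^sub>R z + z * z) - (x + 2 *\<^sub>R (x * z) + x * z * z)"
      by (simp add: algebra_simps p pz px pp zx zxz scaleR_2)
    then show ?thesis using z(1) by simp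
  qed
  have pzp: "p * (p + z) = p + z" "(p + z) * p = p + z" by (simp_all add: algebra_simps p pz)
  have 1: "fstar v * v = p"
  proof -
    have "fstar v * v = (p + z) * (e * (e * (p + z)))" by (simp only: vs) (simp only: v_def mult.assoc)
    also have "\<dots> = ((p + z) * p) * e * (p * (p + z))" by (simp only: ee pzp mult.assoc)
    also have "\<dots> = (p + z) * (p * e * p) * (p + z)" by (simp only: mult.assoc)
    finally show ?thesis using pxz \<open>p * e * p = p - x\<close> by simp
  qed
  \<comment> \<open>The part of e missed by v. It annihilates v on the left, hence p, so r = r (e -
    p), and norm (p - e) < 1 forces r = 0.\<close>
  define r where "r = e - v * fstar v"
  have ev: "e * v = v" by (simp add: v_def ee)
  have "v * p = v" by (simp add: v_def mult.assoc pzp)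
  have "r * v = 0"
    by (simp add: r_def left_diff_distrib ev mult.assoc 1 \<open>v * p = v\<close>)
  have re: "r * e = r"
  proof -
    have "fstar v * e = fstar v" by (simp add: vs mult.assoc e)
    then show ?thesis by (simp add: r_def left_diff_distrib e mult.assoc)
  qed
  have "r * (p + z) = 0"
    using \<open>r * v = 0\<close> re unfolding v_def by (metis mult.assoc)
  then have "r * p = 0" using pxz by (metis mult.assoc mult_zero_left)
  then have "r = r * (e - p)" using re by (simp add: right_diff_distrib)
  then have "norm r \<le> norm r * norm (p - e)"
    using norm_mult_ineq[of r "e - p"] by (simp add: norm_minus_commute)
  then have "norm r = 0"
    using assms(3) mult_strict_left_mono[of "norm (p - e)" 1 "norm r"] by fastforce
  then have 2: "v * fstar v = e" by (simp add: r_def)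
  have "fits n x" unfolding x_def by (intro fits_minus fits_times n)
  then have "fits n z" using z(2)[OF closed_subalgebra_fits[of n]] by simp
  then have "fits n v" unfolding v_def by (intro fits_times fits_plus n)
  then show ?thesis using 1 2 by (rule that)
qed

text \<open>Here \<delta> depends on p alone, so the approximation b and a subalgebra S around it
  may be chosen afterwards. Since p is idempotent, b - b^2 is small; this gives a projection e in S
  near b, which is then close enough to p to be equivalent to it.\<close>

lemma projection_near:
  fixes p :: "'a::cstar_algebra_1 fmat"
  assumes "fproj p"
  obtains \<delta> where "0 < \<delta>"
    "\<And>b S n. fstar b = b \<Longrightarrow> norm (b - p) \<le> \<delta> \<Longrightarrow> closed_subalgebra S \<Longrightarrow> b \<in> S \<Longrightarrow>
       fits n p \<Longrightarrow> (\<And>a. a \<in> S \<Longrightarrow> fits n a) \<Longrightarrow>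
       \<exists>e v. fproj e \<and> e \<in> S \<and> fits n v \<and> fstar v * v = p \<and> v * fstar v = e"
proof -
  define K where "K = norm p"
  \<comment> \<open>M is the factor in norm (p - e) \<le> \<delta> M: one \<delta> for the distance
    of b to p, the rest for the distance of e to b.\<close>
  define M where "M = 1 + 8 * (K + 3/2) * (K + 1)"
  \<comment> \<open>The factor 1 + K^2 dominates both 1 and K^2, so one choice of \<delta> serves
    the bound 1/8 on the defect of b and both closeness conditions on e.\<close>
  define \<delta> where "\<delta> = 1 / (8 * M * (1 + K * K))"
  have K: "0 \<le> K" by (simp add: K_def)
  have "12 * (K + 1) \<le> 8 * (K + 3/2) * (K + 1)" using K by (intro mult_right_mono) auto
  then have M: "1 \<le> M" "8 * (K + 1) \<le> M" using K by (auto simp: M_def)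
  have KK: "1 \<le> 1 + K * K" by simp
  have pos: "0 < 8 * M * (1 + K * K)" using M KK by (intro mult_pos_pos) linarith+
  then have \<delta>: "0 < \<delta>" by (simp add: \<delta>_def)
  have d1: "\<delta> * M * (1 + K * K) = 1/8" using pos by (simp add: \<delta>_def field_simps)
  have d2: "\<delta> * M \<le> 1/8"
    using mult_left_mono[OF KK, of "\<delta> * M"] \<delta> M d1 by simp
  have d3: "\<delta> \<le> 1/8" using mult_left_mono[OF M(1) less_imp_le[OF \<delta>]] d2 by linarith
  show ?thesis
  proof (rule that[OF \<delta>])
    fix b S n
    assume b: "fstar b = b" "norm (b - p) \<le> \<delta>" "closed_subalgebra S" "b \<in> S"
      and n: "fits n p" "\<And>a. a \<in> S \<Longrightarrow> fits n a"
    have nb: "norm b \<le> K + \<delta>"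
      using norm_triangle_ineq[of p "b - p"] b(2) by (simp add: K_def)
    have pp: "p * p = p" using assms by (simp add: fproj_def)
    have eq: "b - b * b = (b - p) - (b * (b - p) + (b - p) * p)"
      by (simp add: algebra_simps pp)
    have "norm (b - b * b) \<le> norm (b - p) + (norm b * norm (b - p) + norm (b - p) * norm p)"
      unfolding eq using norm_triangle_ineq4[of "b - p" "b * (b - p) + (b - p) * p"]
        norm_triangle_ineq[of "b * (b - p)" "(b - p) * p"] norm_mult_ineq[of b "b - p"]
        norm_mult_ineq[of "b - p" p] by linarith
    also have "\<dots> = norm (b - p) * (1 + norm b + norm p)" by (simp add: algebra_simps)
    also have "\<dots> \<le> \<delta> * (2 * (K + 1))"
      using nb b(2) d3 K \<delta> by (intro mult_mono) (auto simp: K_def)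
    finally have "norm (b - b * b) \<le> \<delta> * (2 * (K + 1))" .
    moreover have "\<delta> * (8 * (K + 1)) = 4 * (\<delta> * (2 * (K + 1)))" by simp
    ultimately have x: "norm (4 *\<^sub>R (b - b * b)) \<le> \<delta> * (8 * (K + 1))"
      unfolding norm_scaleR by linarith
    also have "\<delta> * (8 * (K + 1)) \<le> \<delta> * M" using M \<delta> by (intro mult_left_mono) auto
    finally have "norm (4 *\<^sub>R (b - b * b)) \<le> 1/8" using d2 by linarith
    then obtain e where e: "fproj e" "e \<in> S" "norm (e - b) \<le> (norm b + 1/2) * norm (4 *\<^sub>R (b - b * b))"
      using projection_near_almost_projection[OF b(1) _ b(3,4)] by blast
    note e(3)
    also have "(norm b + 1/2) * norm (4 *\<^sub>R (b - b * b)) \<le> (K + 3/2) * (\<delta> * (8 * (K + 1)))"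
      using nb d3 x K by (intro mult_mono) auto
    finally have "norm (p - e) \<le> \<delta> + (K + 3/2) * (\<delta> * (8 * (K + 1)))"
      using norm_triangle_ineq[of "p - b" "b - e"] b(2) by (simp add: norm_minus_commute)
    also have "\<dots> = \<delta> * M" by (simp add: M_def algebra_simps)
    finally have pe: "norm (p - e) \<le> \<delta> * M" .
    have "norm p * norm p * norm (p - e) \<le> (1 + K * K) * (\<delta> * M)"
      using pe by (intro mult_mono) (auto simp: K_def)
    also have "\<dots> = 1/8" using d1 by (simp add: mult_ac)
    finally have "norm p * norm p * norm (p - e) \<le> 1/8" .
    moreover have "norm (p - e) < 1" using pe d2 by linarith
    ultimately obtain v where "fits n v" "fstar v * v = p" "v * fstar v = e"
      using close_projections_equivalent[OF assms e(1)] n(1) n(2)[OF e(2)] by blast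
    with e show "\<exists>e v. fproj e \<and> e \<in> S \<and> fits n v \<and> fstar v * v = p \<and> v * fstar v = e" by blast
  qed
qed

section \<open>Passage between matrices and finitely supported infinite matrices\<close>

definition of_mat :: "'a::cstar_algebra_1 mat \<Rightarrow> 'a fmat" where
  "of_mat M = Abs_fmat (\<lambda>i j. if i < dim_row M \<and> j < dim_col M then M $$ (i, j) else 0)"

definition to_mat :: "nat \<Rightarrow> 'a::cstar_algebra_1 fmat \<Rightarrow> 'a mat" where
  "to_mat n a = mat n n (\<lambda>(i, j). entry a i j)"

lemma entry_of_mat: "entry (of_mat M) i j = (if i < dim_row M \<and> j < dim_col M then M $$ (i, j) else 0)"
  unfolding of_mat_def
  by (subst entry_Abs_fmat[of "max (dim_row M) (dim_col M)"]) (auto simp: supported_def)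

lemma fits_of_mat: "M \<in> carrier_mat n n \<Longrightarrow> fits n (of_mat M)"
  by (auto simp: supported_def entry_of_mat)

lemma of_mat_mult:
  assumes "A \<in> carrier_mat n m" "B \<in> carrier_mat m k"
  shows "of_mat (A * B) = of_mat A * of_mat (B :: 'a::cstar_algebra_1 mat)"
proof (rule fmat_eqI)
  fix i j
  define l where "l = n + m"
  have l: "fits l (of_mat A)" using assms by (auto simp: supported_def entry_of_mat l_def)
  have "entry (of_mat A * of_mat B) i j = (\<Sum>t<l. entry (of_mat A) i t * entry (of_mat B) t j)"
    by (rule entry_times[OF l])
  also have "\<dots> = (\<Sum>t<m. entry (of_mat A) i t * entry (of_mat B) t j)"
    by (rule sum.mono_neutral_right) (use assms in \<open>auto simp: l_def entry_of_mat\<close>)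
  also have "\<dots> = entry (of_mat (A * B)) i j"
  proof (cases "i < n \<and> j < k")
    case True
    then show ?thesis using assms
      by (simp add: entry_of_mat index_mult_mat_sum[OF assms] del: index_mult_mat(1))
  next
    case False
    then have "entry (of_mat A) i t * entry (of_mat B) t j = 0" for t
      using assms by (auto simp: entry_of_mat)
    then show ?thesis using False assms by (auto simp: entry_of_mat)
  qed
  finally show "entry (of_mat (A * B)) i j = entry (of_mat A * of_mat B) i j" by simp
qed

lemma of_mat_minus:
  "A \<in> carrier_mat n m \<Longrightarrow> B \<in> carrier_mat n m \<Longrightarrow>
   of_mat (A - B) = of_mat A - of_mat (B :: 'a::cstar_algebra_1 mat)"
  by (rule fmat_eqI) (auto simp: entry_of_mat)

lemma of_mat_star: "of_mat (mat_star A) = fstar (of_mat A)"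
  by (rule fmat_eqI) (auto simp: entry_of_mat)

text \<open>Padding with zeros forgets the size, so both matrices must have the same one.\<close>

lemma of_mat_inject:
  "A \<in> carrier_mat n m \<Longrightarrow> B \<in> carrier_mat n m \<Longrightarrow> of_mat A = of_mat B \<Longrightarrow> A = B"
proof (rule eq_matI)
  fix i j assume *: "A \<in> carrier_mat n m" "B \<in> carrier_mat n m" "of_mat A = of_mat B"
    "i < dim_row B" "j < dim_col B"
  have "entry (of_mat A) i j = entry (of_mat B) i j" using *(3) by simp
  then show "A $$ (i, j) = B $$ (i, j)"
    using carrier_matD[OF *(1)] carrier_matD[OF *(2)] *(4,5) by (simp add: entry_of_mat)
qed auto

lemma to_mat_carrier [simp]: "to_mat n a \<in> carrier_mat n n"
  by (simp add: to_mat_def)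

lemma of_mat_to_mat: "fits n a \<Longrightarrow> of_mat (to_mat n a) = a"
  by (rule fmat_eqI) (auto simp: entry_of_mat to_mat_def supported_def)

lemma to_mat_times: "fits n a \<Longrightarrow> fits n b \<Longrightarrow> to_mat n (a * b) = to_mat n a * to_mat n b"
  using mult_carrier_mat[OF to_mat_carrier[of n a] to_mat_carrier[of n b]]
  by (intro of_mat_inject[of _ n n]) (simp_all add: of_mat_mult[of _ n n _ n] of_mat_to_mat fits_times)

lemma to_mat_fstar: "fits n a \<Longrightarrow> to_mat n (fstar a) = mat_star (to_mat n a)"
  by (rule of_mat_inject[of _ n n]) (simp_all add: of_mat_star of_mat_to_mat fits_fstar)

lemma to_mat_of_mat: "M \<in> carrier_mat n n \<Longrightarrow> to_mat n (of_mat M) = M"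
  by (rule of_mat_inject[of _ n n]) (simp_all add: of_mat_to_mat fits_of_mat)

lemma fproj_of_mat: "p \<in> projections n \<Longrightarrow> fproj (of_mat p)"
  using projectionsD[of p n] of_mat_mult[of p n n p n] of_mat_star[of p] by (simp add: fproj_def)

lemma projection_to_mat: "fproj e \<Longrightarrow> fits n e \<Longrightarrow> to_mat n e \<in> projections n"
  using to_mat_times[of n e e] to_mat_fstar[of n e] by (simp add: fproj_def projections_def)

text \<open>This puts the condition that all entries lie at one level into the form that
  \<open>projection_near\<close> preserves.\<close>

lemma closed_subalgebra_entries:
  assumes "closed_subalgebra (B :: 'a::cstar_algebra_1 set)"
  shows "closed_subalgebra {a :: 'a fmat. fits n a \<and> (\<forall>i j. entry a i j \<in> B)}"
    (is "closed_subalgebra ?S")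
proof (rule closed_subalgebraI)
  note B = closed_subalgebraD[OF assms]
  fix f and l :: "'a fmat"
  assume f: "\<And>k. f k \<in> ?S" "f \<longlonglongrightarrow> l"
  have "entry l i j \<in> B" for i j
    using B(6)[OF _ tendsto_entry[OF f(2), of i j]] f(1) by blast
  moreover have "entry l i j = 0" if "n \<le> i \<or> n \<le> j" for i j
    using tendsto_entry[OF f(2), of i j] supported_outside[of n "entry (f _)" i j] f(1) that
    by (simp add: LIMSEQ_const_iff)
  ultimately show "l \<in> ?S" by (simp add: supported_def)
next
  note B = closed_subalgebraD[OF assms]
  fix a b :: "'a fmat"
  assume a: "a \<in> ?S" and b: "b \<in> ?S"
  show "a + b \<in> ?S"
    using a b by (simp add: fits_plus B(2))
  have sum: "(\<Sum>k<m. g k) \<in> B" if "\<And>k. g k \<in> B" for g and m :: nat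
    by (induction m) (simp_all add: B(1,2) that)
  have "entry (a * b) i j \<in> B" for i j
  proof -
    have "entry (a * b) i j = (\<Sum>k<n. entry a i k * entry b k j)" by (rule entry_times) (use a in simp)
    then show ?thesis using sum[of "\<lambda>k. entry a i k * entry b k j"] a b B(3) by simp
  qed
  then show "a * b \<in> ?S"
    using a b by (simp add: fits_times)
next
  note B = closed_subalgebraD[OF assms]
  show "r *\<^sub>R a \<in> ?S"
    if "a \<in> ?S" for r a
    using that B(4) by (simp add: supported_def)
  show "0 \<in> ?S"
    using B(1) by (simp add: supported_def)
qed

section \<open>Matrix units\<close>

lemma sum_div_mod:
  assumes "0 < (d::nat)"
  shows "(\<Sum>a<n * d. g (a div d) (a mod d)) = (\<Sum>s<n. \<Sum>i<d. g s i)"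
proof -
  have "(\<Sum>s<n. \<Sum>i<d. g s i) = (\<Sum>(s, i)\<in>{..<n} \<times> {..<d}. g s i)"
    by (rule sum.cartesian_product)
  also have "\<dots> = (\<Sum>a<n * d. g (a div d) (a mod d))"
  proof (rule sum.reindex_bij_witness[where j = "\<lambda>(s, i). s * d + i" and i = "\<lambda>a. (a div d, a mod d)"])
    fix x assume "x \<in> {..<n} \<times> {..<d}"
    then obtain s i where x: "x = (s, i)" "s < n" "i < d" by auto
    have "s * d + i < Suc s * d" using x by simp
    also have "\<dots> \<le> n * d" using x by (intro mult_right_mono) auto
    finally show "(case x of (s, i) \<Rightarrow> s * d + i) \<in> {..<n * d}" by (simp add: x)
  qed (use assms in \<open>auto simp: less_mult_imp_div_less\<close>)
  finally show ?thesis by simp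
qed

locale matrix_units =
  fixes d :: nat and e :: "nat \<Rightarrow> nat \<Rightarrow> 'a::cstar_algebra_1"
  assumes d_pos: "0 < d"
    and e_mult: "\<And>i j k l. i < d \<Longrightarrow> j < d \<Longrightarrow> k < d \<Longrightarrow> l < d \<Longrightarrow>
      e i j * e k l = (if j = k then e i l else 0)"
    and e_star: "\<And>i j. i < d \<Longrightarrow> j < d \<Longrightarrow> star (e i j) = e j i"
    and e_sum: "(\<Sum>i<d. e i i) = 1"
begin

abbreviation f where "f \<equiv> e 0 0"

lemma f_idem: "f * f = f" and f_star: "star f = f"
  using d_pos by (simp_all add: e_mult e_star)

lemma f_nonzero: "f \<noteq> 0"
proof
  assume f: "f = 0"
  have "e i i = 0" if "i < d" for i
  proof -
    have "e i i = e i 0 * f * e 0 i" using that d_pos by (simp add: e_mult)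
    then show ?thesis using f by simp
  qed
  then have "(1::'a) = 0" using e_sum by simp
  then show False by simp
qed

lemma norm_f: "norm f = 1"
  by (rule norm_projection) (simp_all add: f_star f_idem f_nonzero)

lemma norm_cscale_f: "norm (cscale c f) = cmod c"
  by (simp add: norm_cscale norm_f)

lemma cscale_f_inject: "cscale c f = cscale c' f \<longleftrightarrow> c = c'"
proof
  assume "cscale c f = cscale c' f"
  then have "cscale (c - c') f = 0" by (simp add: cscale_diff_left)
  then have "cmod (c - c') = 0" by (metis norm_cscale_f norm_zero)
  then show "c = c'" by simp
qed simp

text \<open>The linear span of the matrix units, described through corners: inserting 1 as the sum
  of the diagonal units on both sides recovers x from them. In this form closedness under limits
  reduces to multiples of one element.\<close>

definition span_set :: "'a set" where
  "span_set = {x. \<forall>i<d. \<forall>j<d. \<exists>c. e 0 i * x * e j 0 = cscale c f}"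

lemma span_setI: "(\<And>i j. i < d \<Longrightarrow> j < d \<Longrightarrow> \<exists>c. e 0 i * x * e j 0 = cscale c f) \<Longrightarrow> x \<in> span_set"
  unfolding span_set_def by blast

lemma span_setD: "x \<in> span_set \<Longrightarrow> i < d \<Longrightarrow> j < d \<Longrightarrow> \<exists>c. e 0 i * x * e j 0 = cscale c f"
  unfolding span_set_def by blast

lemma sum_scalars: "(\<And>i. i \<in> I \<Longrightarrow> \<exists>c. g i = cscale c f) \<Longrightarrow> \<exists>c. sum g I = cscale c f"
proof -
  assume "\<And>i. i \<in> I \<Longrightarrow> \<exists>c. g i = cscale c f"
  then obtain c where "\<And>i. i \<in> I \<Longrightarrow> g i = cscale (c i) f" by metis
  then have "sum g I = (\<Sum>i\<in>I. cscale (c i) f)" by (intro sum.cong) auto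
  then show ?thesis by (metis cscale_sum_left)
qed

text \<open>The map from c to c f is isometric because f has norm 1, so the coefficients form a
  Cauchy sequence of complex numbers.\<close>

lemma scalars_closed:
  assumes "\<And>n. \<exists>c. g n = cscale c f" "g \<longlonglongrightarrow> l"
  shows "\<exists>c. l = cscale c f"
proof -
  obtain c where c: "\<And>n. g n = cscale (c n) f" using assms(1) by metis
  have "dist (c m) (c n) = dist (g m) (g n)" for m n
    unfolding c dist_norm cscale_diff_left[symmetric] norm_cscale_f ..
  then have "Cauchy c"
    using LIMSEQ_imp_Cauchy[OF assms(2)] unfolding Cauchy_def by simp
  then obtain c0 where c0: "c \<longlonglongrightarrow> c0" using Cauchy_convergent_iff convergent_def by blast
  have "(\<lambda>n. norm (g n - cscale c0 f)) = (\<lambda>n. norm (c n - c0))"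
    unfolding c cscale_diff_left[symmetric] norm_cscale_f ..
  moreover have "(\<lambda>n. norm (c n - c0)) \<longlonglongrightarrow> 0"
    using c0 by (simp add: LIM_zero_iff tendsto_norm_zero)
  ultimately have "(\<lambda>n. norm (g n - cscale c0 f)) \<longlonglongrightarrow> 0" by simp
  then have "g \<longlonglongrightarrow> cscale c0 f"
    by (rule LIM_zero_cancel[OF tendsto_norm_zero_cancel])
  with assms(2) have "l = cscale c0 f" by (rule LIMSEQ_unique)
  then show ?thesis ..
qed

lemma closed_subalgebra_span_set: "closed_subalgebra span_set"
proof (rule closed_subalgebraI)
  fix g l assume g: "\<And>n::nat. g n \<in> span_set" "g \<longlonglongrightarrow> l"
  show "l \<in> span_set"
  proof (rule span_setI)
    fix i j assume ij: "i < d" "j < d"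
    show "\<exists>c. e 0 i * l * e j 0 = cscale c f"
    proof (rule scalars_closed)
      show "\<exists>c. e 0 i * g n * e j 0 = cscale c f" for n by (rule span_setD[OF g(1) ij])
      show "(\<lambda>n. e 0 i * g n * e j 0) \<longlonglongrightarrow> e 0 i * l * e j 0"
        by (intro tendsto_mult_left tendsto_mult_right g(2))
    qed
  qed
next
  show "0 \<in> span_set" by (rule span_setI, rule exI[of _ 0]) simp
  fix a b assume a: "a \<in> span_set" and b: "b \<in> span_set"
  show "a + b \<in> span_set"
  proof (rule span_setI)
    fix i j assume ij: "i < d" "j < d"
    obtain c c' where "e 0 i * a * e j 0 = cscale c f" "e 0 i * b * e j 0 = cscale c' f"
      using span_setD[OF a ij] span_setD[OF b ij] by blast
    then show "\<exists>c. e 0 i * (a + b) * e j 0 = cscale c f"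
      by (intro exI[of _ "c + c'"]) (simp add: algebra_simps cscale_add_left)
  qed
  show "a * b \<in> span_set"
  proof (rule span_setI)
    fix i j assume ij: "i < d" "j < d"
    \<comment> \<open>Inserting 1 as the sum of e l 0 * e 0 l between a and b factors each term into
      two corners.\<close>
    have "e 0 i * (a * b) * e j 0 = e 0 i * a * (\<Sum>l<d. e l l) * b * e j 0"
      by (simp add: e_sum mult.assoc)
    also have "\<dots> = (\<Sum>l<d. e 0 i * a * e l l * b * e j 0)"
      by (simp add: sum_distrib_left sum_distrib_right)
    also have "\<dots> = (\<Sum>l<d. (e 0 i * a * e l 0) * (e 0 l * b * e j 0))"
    proof (rule sum.cong)
      fix l assume "l \<in> {..<d}"
      then have "e l l = e l 0 * e 0 l" using d_pos by (simp add: e_mult)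
      then show "e 0 i * a * e l l * b * e j 0 = (e 0 i * a * e l 0) * (e 0 l * b * e j 0)"
        by (simp add: mult.assoc)
    qed simp
    finally have eq: "e 0 i * (a * b) * e j 0 = (\<Sum>l<d. (e 0 i * a * e l 0) * (e 0 l * b * e j 0))" .
    have "\<exists>c. (e 0 i * a * e l 0) * (e 0 l * b * e j 0) = cscale c f" if "l \<in> {..<d}" for l
    proof -
      have l: "l < d" using that by simp
      obtain c c' where "e 0 i * a * e l 0 = cscale c f" "e 0 l * b * e j 0 = cscale c' f"
        using span_setD[OF a ij(1) l] span_setD[OF b l ij(2)] by blast
      then have "(e 0 i * a * e l 0) * (e 0 l * b * e j 0) = cscale (c * c') f"
        by (simp only: cscale_mult_left cscale_mult_right cscale_cscale f_idem mult.commute)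
      then show ?thesis by blast
    qed
    then show "\<exists>c. e 0 i * (a * b) * e j 0 = cscale c f" unfolding eq by (rule sum_scalars)
  qed
next
  fix a r assume a: "a \<in> span_set"
  show "r *\<^sub>R a \<in> span_set"
  proof (rule span_setI)
    fix i j assume ij: "i < d" "j < d"
    obtain c where "e 0 i * a * e j 0 = cscale c f" using span_setD[OF a ij] by blast
    then have "e 0 i * (r *\<^sub>R a) * e j 0 = cscale (complex_of_real r * c) f"
      by (simp add: cscale_cscale[symmetric] cscale_of_real)
    then show "\<exists>c. e 0 i * (r *\<^sub>R a) * e j 0 = cscale c f" by blast
  qed
qed

text \<open>The embedding of c as the tensor product of c with f. It respects products, sums and
  adjoints and is injective, but sends 1 to a diagonal of copies of f.\<close>

definition scalar_mat :: "complex mat \<Rightarrow> 'a mat" where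
  "scalar_mat c = map_mat (\<lambda>z. cscale z f) c"

lemma scalar_mat_carrier [simp]: "scalar_mat c \<in> carrier_mat n m \<longleftrightarrow> c \<in> carrier_mat n m"
  by (simp add: scalar_mat_def)

lemma scalar_mat_mult:
  assumes "a \<in> carrier_mat n m" "b \<in> carrier_mat m k"
  shows "scalar_mat (a * b) = scalar_mat a * scalar_mat b"
proof (rule eq_matI)
  fix i j assume "i < dim_row (scalar_mat a * scalar_mat b)" "j < dim_col (scalar_mat a * scalar_mat b)"
  then have ij: "i < n" "j < k" using assms by (auto simp: scalar_mat_def)
  have "scalar_mat (a * b) $$ (i, j) = cscale (\<Sum>l<m. a $$ (i, l) * b $$ (l, j)) f"
    using ij assms by (simp add: scalar_mat_def index_mult_mat_sum[OF assms] del: index_mult_mat(1))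
  also have "\<dots> = (\<Sum>l<m. cscale (a $$ (i, l)) f * cscale (b $$ (l, j)) f)"
    by (simp only: cscale_sum_left cscale_mult_left cscale_mult_right cscale_cscale f_idem mult.commute)
  also have "\<dots> = (scalar_mat a * scalar_mat b) $$ (i, j)"
    using ij assms by (subst index_mult_mat_sum[of _ n m _ k]) (auto simp: scalar_mat_def)
  finally show "scalar_mat (a * b) $$ (i, j) = (scalar_mat a * scalar_mat b) $$ (i, j)" .
qed (use assms in \<open>auto simp: scalar_mat_def\<close>)

lemma scalar_mat_star: "scalar_mat (mat_star c) = mat_star (scalar_mat c)"
  by (rule eq_matI) (auto simp: scalar_mat_def star_cscale f_star star_complex_def)

lemma scalar_mat_add:
  "a \<in> carrier_mat n m \<Longrightarrow> b \<in> carrier_mat n m \<Longrightarrow> scalar_mat (a + b) = scalar_mat a + scalar_mat b"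
  by (rule eq_matI) (auto simp: scalar_mat_def cscale_add_left)

lemma scalar_mat_zero: "scalar_mat (0\<^sub>m n m) = 0\<^sub>m n m"
  by (rule eq_matI) (auto simp: scalar_mat_def)

lemma scalar_mat_inject:
  assumes "a \<in> carrier_mat n m" "b \<in> carrier_mat n m" "scalar_mat a = scalar_mat b"
  shows "a = b"
proof (rule eq_matI)
  fix i j assume ij: "i < dim_row b" "j < dim_col b"
  have "scalar_mat a $$ (i, j) = scalar_mat b $$ (i, j)" using assms(3) by simp
  then show "a $$ (i, j) = b $$ (i, j)"
    using ij assms(1,2) by (simp add: scalar_mat_def cscale_f_inject)
qed (use assms in auto)

lemma scalar_mat_projection:
  assumes "q \<in> projections n"
  shows "scalar_mat q \<in> projections n"
proof -
  note q = projectionsD[OF assms]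
  have "scalar_mat q * scalar_mat q = scalar_mat q"
    unfolding scalar_mat_mult[OF q(1,1), symmetric] q(2) ..
  moreover have "mat_star (scalar_mat q) = scalar_mat q"
    unfolding scalar_mat_star[symmetric] q(3) ..
  ultimately show ?thesis using q(1) by (simp add: projections_def)
qed

text \<open>A column of the units e 0 i, repeated in n diagonal blocks. This matrix C is an isometry
  whose range projection is the image of the complex identity of size n d; it trades matrices over
  the level for complex matrices d times as large.\<close>

definition unit_column :: "nat \<Rightarrow> 'a mat" where
  "unit_column n = mat (n * d) n (\<lambda>(a, s). if a div d = s then e 0 (a mod d) else 0)"

lemma unit_column_carrier [simp]: "unit_column n \<in> carrier_mat (n * d) n"
  by (simp add: unit_column_def)

lemma star_unit_column_carrier [simp]: "mat_star (unit_column n) \<in> carrier_mat n (n * d)"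
  by simp

lemma unit_column_mult:
  assumes "w \<in> carrier_mat n k" "a < n * d" "j < k"
  shows "(unit_column n * w) $$ (a, j) = e 0 (a mod d) * w $$ (a div d, j)"
proof -
  have "a div d < n" using assms(2) by (rule less_mult_imp_div_less)
  have "(unit_column n * w) $$ (a, j) = (\<Sum>s<n. unit_column n $$ (a, s) * w $$ (s, j))"
    by (rule index_mult_mat_sum[OF unit_column_carrier assms(1-3)])
  also have "\<dots> = (\<Sum>s<n. if s = a div d then e 0 (a mod d) * w $$ (s, j) else 0)"
    using assms(2) by (intro sum.cong) (auto simp: unit_column_def)
  also have "\<dots> = e 0 (a mod d) * w $$ (a div d, j)" using \<open>a div d < n\<close> by simp
  finally show ?thesis .
qed

lemma mult_star_unit_column:
  assumes "w \<in> carrier_mat k n" "i < k" "b < n * d"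
  shows "(w * mat_star (unit_column n)) $$ (i, b) = w $$ (i, b div d) * e (b mod d) 0"
proof -
  have b: "b div d < n" using assms(3) by (rule less_mult_imp_div_less)
  have "(w * mat_star (unit_column n)) $$ (i, b) =
      (\<Sum>s<n. w $$ (i, s) * mat_star (unit_column n) $$ (s, b))"
    by (rule index_mult_mat_sum[OF assms(1) star_unit_column_carrier assms(2,3)])
  also have "\<dots> = (\<Sum>s<n. if s = b div d then w $$ (i, s) * e (b mod d) 0 else 0)"
    using assms(3) d_pos by (intro sum.cong) (auto simp: unit_column_def e_star)
  also have "\<dots> = w $$ (i, b div d) * e (b mod d) 0" using b by simp
  finally show ?thesis .
qed

lemma star_unit_column_mult: "mat_star (unit_column n) * unit_column n = 1\<^sub>m n"
proof (rule eq_matI)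
  fix s t assume "s < dim_row (1\<^sub>m n :: 'a mat)" "t < dim_col (1\<^sub>m n :: 'a mat)"
  then have st: "s < n" "t < n" by auto
  have "(mat_star (unit_column n) * unit_column n) $$ (s, t) =
      (\<Sum>a<n * d. mat_star (unit_column n) $$ (s, a) * unit_column n $$ (a, t))"
    by (rule index_mult_mat_sum[OF star_unit_column_carrier unit_column_carrier st])
  also have "\<dots> = (\<Sum>a<n * d. if a div d = s \<and> s = t then e (a mod d) (a mod d) else 0)"
    using st d_pos by (intro sum.cong) (auto simp: unit_column_def e_star e_mult)
  also have "\<dots> = (\<Sum>u<n. \<Sum>i<d. if u = s \<and> s = t then e i i else 0)"
    by (rule sum_div_mod[OF d_pos, of "\<lambda>u i. if u = s \<and> s = t then e i i else 0"])
  also have "\<dots> = (\<Sum>u<n. if u = s then (if s = t then 1 else 0) else 0)"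
    by (intro sum.cong) (auto simp: e_sum)
  also have "\<dots> = 1\<^sub>m n $$ (s, t)" using st by simp
  finally show "(mat_star (unit_column n) * unit_column n) $$ (s, t) = 1\<^sub>m n $$ (s, t)" .
qed (auto simp: unit_column_def)

lemma unit_column_mult_star: "unit_column n * mat_star (unit_column n) = scalar_mat (1\<^sub>m (n * d))"
proof (rule eq_matI)
  fix a b assume "a < dim_row (scalar_mat (1\<^sub>m (n * d)))" "b < dim_col (scalar_mat (1\<^sub>m (n * d)))"
  then have ab: "a < n * d" "b < n * d" by (auto simp: scalar_mat_def)
  have bd: "b div d < n" using ab(2) by (rule less_mult_imp_div_less)
  have "(unit_column n * mat_star (unit_column n)) $$ (a, b) =
      (if a div d = b div d then e 0 (a mod d) else 0) * e (b mod d) 0"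
    unfolding mult_star_unit_column[OF unit_column_carrier ab] using ab(1) bd
    by (simp add: unit_column_def)
  also have "\<dots> = (if a = b then f else 0)"
    using d_pos by (simp add: e_mult) (metis div_mult_mod_eq)
  also have "\<dots> = scalar_mat (1\<^sub>m (n * d)) $$ (a, b)" using ab by (simp add: scalar_mat_def)
  finally show "(unit_column n * mat_star (unit_column n)) $$ (a, b) = scalar_mat (1\<^sub>m (n * d)) $$ (a, b)" .
qed (auto simp: unit_column_def scalar_mat_def)

text \<open>Each entry of the product is one of the corners by which \<open>span_set\<close> is
  defined, hence a multiple of f.\<close>

lemma corner_scalar:
  assumes w: "w \<in> carrier_mat m n" and B: "\<And>i j. i < m \<Longrightarrow> j < n \<Longrightarrow> w $$ (i, j) \<in> span_set"
  obtains c where "c \<in> carrier_mat (m * d) (n * d)"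
    "unit_column m * w * mat_star (unit_column n) = scalar_mat c"
proof -
  have uw: "unit_column m * w \<in> carrier_mat (m * d) n" by (rule mult_carrier_mat[OF unit_column_carrier w])
  have entry: "(unit_column m * w * mat_star (unit_column n)) $$ (a, b) =
      e 0 (a mod d) * w $$ (a div d, b div d) * e (b mod d) 0" if "a < m * d" "b < n * d" for a b
    using that less_mult_imp_div_less[OF that(2)]
    by (simp add: mult_star_unit_column[OF uw] unit_column_mult[OF w] del: index_mult_mat(1))
  have "\<exists>c. e 0 (a mod d) * w $$ (a div d, b div d) * e (b mod d) 0 = cscale c f"
    if "a < m * d" "b < n * d" for a b
    by (intro span_setD B less_mult_imp_div_less that mod_less_divisor d_pos)
  then obtain c where c: "\<And>a b. a < m * d \<Longrightarrow> b < n * d \<Longrightarrow>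
      e 0 (a mod d) * w $$ (a div d, b div d) * e (b mod d) 0 = cscale (c a b) f" by metis
  show ?thesis
  proof (rule that[of "mat (m * d) (n * d) (\<lambda>(a, b). c a b)"])
    show "unit_column m * w * mat_star (unit_column n) = scalar_mat (mat (m * d) (n * d) (\<lambda>(a, b). c a b))"
    proof (rule eq_matI)
      fix a b assume "a < dim_row (scalar_mat (mat (m * d) (n * d) (\<lambda>(a, b). c a b)))"
        "b < dim_col (scalar_mat (mat (m * d) (n * d) (\<lambda>(a, b). c a b)))"
      then have "a < m * d" "b < n * d" by (simp_all add: scalar_mat_def)
      then show "(unit_column m * w * mat_star (unit_column n)) $$ (a, b) =
          scalar_mat (mat (m * d) (n * d) (\<lambda>(a, b). c a b)) $$ (a, b)"
        unfolding entry[OF \<open>a < m * d\<close> \<open>b < n * d\<close>] c[OF \<open>a < m * d\<close> \<open>b < n * d\<close>]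
        by (simp add: scalar_mat_def)
    qed (simp_all add: unit_column_def scalar_mat_def)
  qed simp
qed

text \<open>The partial isometry is C p for the isometry C = \<open>unit_column n\<close>. Its range
  projection is a scalar matrix by \<open>corner_scalar\<close>, and injectivity of the embedding
  makes the complex matrix itself a projection.\<close>

lemma projection_equivalent_scalar:
  assumes p: "p \<in> projections n" "0 < n" and B: "\<And>i j. i < n \<Longrightarrow> j < n \<Longrightarrow> p $$ (i, j) \<in> span_set"
  obtains q where "q \<in> projections (n * d)" "(p, scalar_mat q) \<in> mvn_rel"
proof -
  note p' = projectionsD[OF p(1)]
  let ?C = "unit_column n"
  note C = unit_column_carrier[of n] and C' = star_unit_column_carrier[of n]
  obtain c where c: "c \<in> carrier_mat (n * d) (n * d)" "?C * p * mat_star ?C = scalar_mat c"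
    using corner_scalar[OF p'(1) B] by blast
  have Cp: "?C * p \<in> carrier_mat (n * d) n" by (rule mult_carrier_mat[OF C p'(1)])
  have pC: "p * mat_star ?C \<in> carrier_mat n (n * d)" by (rule mult_carrier_mat[OF p'(1) C'])
  have s: "mat_star (?C * p) = p * mat_star ?C" using mat_star_mult[OF C p'(1)] p'(3) by simp
  have "mat_star (?C * p) * (?C * p) = p * (mat_star ?C * (?C * p))"
    unfolding s by (rule assoc_mult_mat[OF p'(1) C' Cp])
  also have "mat_star ?C * (?C * p) = p"
    using assoc_mult_mat[OF C' C p'(1)] star_unit_column_mult[of n] p' by simp
  finally have 1: "mat_star (?C * p) * (?C * p) = p" using p' by simp
  have "?C * p * mat_star (?C * p) = ?C * (p * (p * mat_star ?C))"
    unfolding s by (rule assoc_mult_mat[OF C p'(1) pC])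
  also have "p * (p * mat_star ?C) = p * mat_star ?C"
    using assoc_mult_mat[OF p'(1) p'(1) C'] p'(2) by simp
  also have "?C * (p * mat_star ?C) = scalar_mat c"
    using assoc_mult_mat[OF C p'(1) C'] c(2) by simp
  finally have 2: "?C * p * mat_star (?C * p) = scalar_mat c" .
  have "mat_star (scalar_mat c) = scalar_mat c"
    unfolding 2[symmetric] using mat_star_mult[of "?C * p" "n * d" n "mat_star (?C * p)" "n * d"] Cp by simp
  then have "mat_star c = c"
    using scalar_mat_star[of c] c(1) by (intro scalar_mat_inject[of _ "n * d" "n * d"]) auto
  moreover have "scalar_mat c * scalar_mat c = scalar_mat c"
  proof -
    have "scalar_mat c * scalar_mat c = ?C * p * (mat_star (?C * p) * (?C * p * mat_star (?C * p)))"
      unfolding 2[symmetric] by (rule assoc_mult_mat[of _ "n * d" n _ "n * d" _ "n * d"]) (use Cp in auto)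
    also have "mat_star (?C * p) * (?C * p * mat_star (?C * p)) = p * mat_star (?C * p)"
      using assoc_mult_mat[of "mat_star (?C * p)" n "n * d" "?C * p" n "mat_star (?C * p)" "n * d"] Cp 1 by simp
    also have "?C * p * (p * mat_star (?C * p)) = ?C * p * p * mat_star (?C * p)"
      by (rule assoc_mult_mat[OF Cp p'(1), symmetric]) (use Cp in simp)
    also have "?C * p * p = ?C * p" using assoc_mult_mat[OF C p'(1) p'(1)] p'(2) by simp
    finally show ?thesis using 2 by simp
  qed
  then have "c * c = c"
    using scalar_mat_mult[OF c(1) c(1)] c(1) by (intro scalar_mat_inject[of _ "n * d" "n * d"]) auto
  ultimately have q: "c \<in> projections (n * d)" using c(1) by (simp add: projections_def)
  show ?thesis
    by (rule that[OF q mvn_relI[OF p(1) scalar_mat_projection[OF q] p(2) _ Cp 1 2]])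
      (use p(2) d_pos in simp)
qed

definition unit_class :: "'a mat set" where
  "unit_class = mvn_class (scalar_mat (1\<^sub>m 1))"

lemma one_projection: "(1\<^sub>m n :: 'b::cstar_algebra_1 mat) \<in> projections n"
  by (simp add: projections_def)

lemma unit_class_closed: "unit_class \<in> carrier MvN"
  unfolding unit_class_def by (rule mvn_class_closed[OF scalar_mat_projection[OF one_projection]]) simp

text \<open>The row adjoint to x, tensored with f, maps the rank one projection onto f.\<close>

lemma rank_one_mvn:
  assumes x: "x \<in> carrier_mat n 1" "mat_star x * x = 1\<^sub>m 1" and "0 < n"
  shows "x * mat_star x \<in> projections n" "(scalar_mat (x * mat_star x), scalar_mat (1\<^sub>m 1)) \<in> mvn_rel"
proof -
  have x': "mat_star x \<in> carrier_mat 1 n" using x by simp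
  have "x * mat_star x * (x * mat_star x) = x * (mat_star x * (x * mat_star x))"
    by (rule assoc_mult_mat[OF x(1) x' mult_carrier_mat[OF x(1) x']])
  also have "mat_star x * (x * mat_star x) = mat_star x"
    using assoc_mult_mat[OF x' x(1) x'] x by simp
  finally show P: "x * mat_star x \<in> projections n"
    using x mat_star_mult[OF x(1) x'] by (simp add: projections_def)
  show "(scalar_mat (x * mat_star x), scalar_mat (1\<^sub>m 1)) \<in> mvn_rel"
  proof (rule mvn_relI[OF scalar_mat_projection[OF P] scalar_mat_projection[OF one_projection] \<open>0 < n\<close>])
    show "scalar_mat (mat_star x) \<in> carrier_mat 1 n" using x by simp
    show "mat_star (scalar_mat (mat_star x)) * scalar_mat (mat_star x) = scalar_mat (x * mat_star x)"
      using scalar_mat_mult[OF x(1) x'] by (simp add: scalar_mat_star)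
    show "scalar_mat (mat_star x) * mat_star (scalar_mat (mat_star x)) = scalar_mat (1\<^sub>m 1)"
      using scalar_mat_mult[OF x' x(1)] x(2) by (simp add: scalar_mat_star)
  qed simp
qed

end

section \<open>Complex projections and their trace\<close>

definition diag_total :: "complex mat \<Rightarrow> complex" where
  "diag_total q = (\<Sum>i<dim_row q. q $$ (i, i))"

text \<open>It compares the diagonals of q and of its adjoint times q. The trace is therefore
  nonnegative, which stops the splitting of projections.\<close>

lemma complex_projection_diag:
  assumes q: "q \<in> projections n" and j: "j < n"
  shows "q $$ (j, j) = complex_of_real (\<Sum>i<n. (cmod (q $$ (i, j)))\<^sup>2)"
proof -
  note q' = projectionsD[OF q]
  have "q $$ (j, j) = (mat_star q * q) $$ (j, j)" using q' by simp
  also have "\<dots> = (\<Sum>i<n. mat_star q $$ (j, i) * q $$ (i, j))"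
    by (rule index_mult_mat_sum[of _ n n _ n]) (use q' j in auto)
  also have "\<dots> = (\<Sum>i<n. complex_of_real ((cmod (q $$ (i, j)))\<^sup>2))"
  proof (rule sum.cong)
    fix i assume "i \<in> {..<n}"
    then have "mat_star q $$ (j, i) = cnj (q $$ (i, j))" using q'(4,5) j by (simp add: star_complex_def)
    then show "mat_star q $$ (j, i) * q $$ (i, j) = complex_of_real ((cmod (q $$ (i, j)))\<^sup>2)"
      by (simp only: complex_norm_square mult.commute)
  qed simp
  finally show ?thesis by simp
qed

text \<open>Every column of q is fixed by q, because q is idempotent. A normalised nonzero column
  thus spans a rank one subprojection, and removing it lowers the trace by 1.\<close>

lemma complex_projection_split:
  assumes q: "q \<in> projections n" and nz: "q \<noteq> 0\<^sub>m n n"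
  obtains x where "x \<in> carrier_mat n 1" "mat_star x * x = 1\<^sub>m 1"
    "q - x * mat_star x \<in> projections n" "x * mat_star x * (q - x * mat_star x) = 0\<^sub>m n n"
    "diag_total (q - x * mat_star x) = diag_total q - 1"
proof -
  note q' = projectionsD[OF q]
  obtain i j where ij: "i < n" "j < n" "q $$ (i, j) \<noteq> 0"
  proof (rule ccontr)
    assume "\<not> thesis"
    then have "q = 0\<^sub>m n n" using that q' by (intro eq_matI) auto
    with nz show False by simp
  qed
  \<comment> \<open>The squared length of the column j, by whose root the column is
    normalised.\<close>
  define s where "s = (\<Sum>i<n. (cmod (q $$ (i, j)))\<^sup>2)"
  have "(cmod (q $$ (i, j)))\<^sup>2 \<le> s" unfolding s_def using ij(1) by (intro member_le_sum) auto
  moreover have "0 < (cmod (q $$ (i, j)))\<^sup>2" using ij by simp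
  ultimately have s: "0 < s" by linarith
  define x where "x = mat n 1 (\<lambda>(i, _). q $$ (i, j) / complex_of_real (sqrt s))"
  have x: "x \<in> carrier_mat n 1" by (simp add: x_def)
  have x': "mat_star x \<in> carrier_mat 1 n" using x by simp
  have xx: "mat_star x * x = 1\<^sub>m 1"
  proof (rule eq_matI)
    fix a b assume "a < dim_row (1\<^sub>m 1 :: complex mat)" "b < dim_col (1\<^sub>m 1 :: complex mat)"
    then have ab: "a = 0" "b = 0" by auto
    have "(mat_star x * x) $$ (0, 0) = (\<Sum>i<n. mat_star x $$ (0, i) * x $$ (i, 0))"
      by (rule index_mult_mat_sum[OF x' x]) auto
    also have "\<dots> = (\<Sum>i<n. complex_of_real ((cmod (q $$ (i, j)))\<^sup>2 / s))"
    proof (rule sum.cong)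
      fix i assume "i \<in> {..<n}"
      have "complex_of_real (sqrt s) * complex_of_real (sqrt s) = complex_of_real s"
        using s by (simp flip: of_real_mult)
      then show "mat_star x $$ (0, i) * x $$ (i, 0) = complex_of_real ((cmod (q $$ (i, j)))\<^sup>2 / s)"
        using \<open>i \<in> {..<n}\<close> by (simp add: x_def star_complex_def complex_norm_square[symmetric] mult.commute)
    qed simp
    also have "\<dots> = complex_of_real (s / s)"
      unfolding of_real_sum[symmetric] sum_divide_distrib[symmetric] s_def[symmetric] ..
    finally show "(mat_star x * x) $$ (a, b) = 1\<^sub>m 1 $$ (a, b)" using s ab by simp
  qed (use x in auto)
  have qx: "q * x = x"
  proof (rule eq_matI)
    fix a b assume "a < dim_row x" "b < dim_col x"
    then have ab: "a < n" "b = 0" using x by auto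
    have "(q * x) $$ (a, 0) = (\<Sum>l<n. q $$ (a, l) * x $$ (l, 0))"
      by (rule index_mult_mat_sum[OF q'(1) x ab(1)]) simp
    also have "\<dots> = (\<Sum>l<n. q $$ (a, l) * q $$ (l, j)) / complex_of_real (sqrt s)"
      by (simp add: x_def sum_divide_distrib)
    also have "(\<Sum>l<n. q $$ (a, l) * q $$ (l, j)) = q $$ (a, j)"
      using index_mult_mat_sum[OF q'(1) q'(1) ab(1) ij(2)] q'(2) by simp
    finally show "(q * x) $$ (a, b) = x $$ (a, b)" using ab by (simp add: x_def)
  qed (use q' x in auto)
  define P where "P = x * mat_star x"
  have P: "P \<in> carrier_mat n n" unfolding P_def using x by simp
  have PP: "P * P = P"
  proof -
    have "P * P = x * (mat_star x * P)" unfolding P_def by (rule assoc_mult_mat[OF x x' mult_carrier_mat[OF x x']])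
    also have "mat_star x * P = mat_star x" unfolding P_def using assoc_mult_mat[OF x' x x'] x xx by simp
    finally show ?thesis by (simp add: P_def)
  qed
  have Ps: "mat_star P = P" unfolding P_def using mat_star_mult[OF x x'] by simp
  have qP: "q * P = P" unfolding P_def using assoc_mult_mat[OF q'(1) x x'] qx by simp
  have Pq: "P * q = P"
    using mat_star_mult[OF q'(1) P] qP Ps q'(3) by simp
  have PqP: "P * (q - P) = 0\<^sub>m n n"
    using mult_minus_distrib_mat[OF P q'(1) P] Pq PP P by simp
  have "(q - P) * (q - P) = q * (q - P) - P * (q - P)"
    by (rule minus_mult_distrib_mat[OF q'(1) P]) (use q' P in auto)
  also have "\<dots> = q * (q - P)" using PqP q' P by (intro eq_matI) auto
  also have "\<dots> = q - P" using mult_minus_distrib_mat[OF q'(1) q'(1) P] q'(2) qP by simp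
  finally have "(q - P) * (q - P) = q - P" .
  then have proj: "q - P \<in> projections n"
    using q'(3) Ps mat_star_minus[OF q'(1) P] minus_carrier_mat[OF P] by (simp add: projections_def)
  have "diag_total (q - P) = diag_total q - (\<Sum>i<n. P $$ (i, i))"
    using q' P by (simp add: diag_total_def sum_subtractf)
  moreover have "(\<Sum>i<n. P $$ (i, i)) = (mat_star x * x) $$ (0, 0)"
  proof -
    have "(\<Sum>i<n. P $$ (i, i)) = (\<Sum>i<n. x $$ (i, 0) * mat_star x $$ (0, i))"
      unfolding P_def by (intro sum.cong refl)
        (subst index_mult_mat_sum[OF x x'], auto simp: lessThan_Suc)
    also have "\<dots> = (\<Sum>i<n. mat_star x $$ (0, i) * x $$ (i, 0))" by (simp add: mult.commute)
    also have "\<dots> = (mat_star x * x) $$ (0, 0)"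
      by (rule index_mult_mat_sum[OF x' x, symmetric]) auto
    finally show ?thesis .
  qed
  ultimately have "diag_total (q - P) = diag_total q - 1" using xx by simp
  with x xx proj PqP show ?thesis using that unfolding P_def by blast
qed

context matrix_units
begin

text \<open>Rank one projections are split off, each contributing one \<open>unit_class\<close>. The
  induction is on a natural upper bound of the trace, because its integrality is only a result of
  the splitting.\<close>

lemma scalar_projection_class:
  assumes "q \<in> projections n" "0 < n"
  shows "\<exists>r. diag_total q = of_nat r \<and> mvn_class (scalar_mat q) = unit_class [^]\<^bsub>MvN\<^esub> r"
proof -
  have "Re (diag_total q) < real K \<Longrightarrow> q \<in> projections n \<Longrightarrow>
      \<exists>r. diag_total q = of_nat r \<and> mvn_class (scalar_mat q) = unit_class [^]\<^bsub>MvN\<^esub> r" for K q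
  proof (induction K arbitrary: q)
    case 0
    have "0 \<le> Re (diag_total q)"
      using complex_projection_diag[OF 0(2)] projectionsD[OF 0(2)]
      by (simp add: diag_total_def) (auto intro!: sum_nonneg)
    with 0 show ?case by simp
  next
    case (Suc K)
    show ?case
    proof (cases "q = 0\<^sub>m n n")
      case True
      then show ?thesis using mvn_class_zero[OF assms(2), where 'a = 'a]
        by (intro exI[of _ 0]) (simp add: scalar_mat_zero diag_total_def)
    next
      case False
      from complex_projection_split[OF Suc(3) False] obtain x
        where x: "x \<in> carrier_mat n 1" "mat_star x * x = 1\<^sub>m 1"
          "q - x * mat_star x \<in> projections n" "x * mat_star x * (q - x * mat_star x) = 0\<^sub>m n n"
          "diag_total (q - x * mat_star x) = diag_total q - 1" by blast
      define P where "P = x * mat_star x"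
      have P: "P \<in> projections n" "(scalar_mat P, scalar_mat (1\<^sub>m 1)) \<in> mvn_rel"
        unfolding P_def by (rule rank_one_mvn[OF x(1,2) assms(2)])+
      have qP: "q - P \<in> projections n" "P * (q - P) = 0\<^sub>m n n" "diag_total (q - P) = diag_total q - 1"
        using x by (simp_all add: P_def)
      have "Re (diag_total (q - P)) < real K" using Suc(2) qP(3) by simp
      from Suc.IH[OF this qP(1)] obtain r where r: "diag_total (q - P) = of_nat r"
        "mvn_class (scalar_mat (q - P)) = unit_class [^]\<^bsub>MvN\<^esub> r" by blast
      note P' = projectionsD[OF P(1)] and qP' = projectionsD[OF qP(1)] and q' = projectionsD[OF Suc(3)]
      note sP = scalar_mat_projection[OF P(1)] and sqP = scalar_mat_projection[OF qP(1)]
      have "P + (q - P) = q" using P' q' by (intro eq_matI) auto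
      then have "scalar_mat q = scalar_mat P + scalar_mat (q - P)"
        using scalar_mat_add[OF P'(1) qP'(1)] by simp
      moreover have "scalar_mat P * scalar_mat (q - P) = 0\<^sub>m n n"
        using scalar_mat_mult[OF P'(1) qP'(1)] qP(2) by (simp add: scalar_mat_zero)
      ultimately have "mvn_class (scalar_mat q) = mvn_class (diag_sum (scalar_mat P) (scalar_mat (q - P)))"
        using mvn_class_eqI[OF orthogonal_sum_mvn(2)[OF sP sqP assms(2)]] by simp
      also have "\<dots> = mvn_class (scalar_mat P) \<otimes>\<^bsub>MvN\<^esub> mvn_class (scalar_mat (q - P))"
        by (rule mult_MvN_projections[OF sP sqP assms(2) assms(2), symmetric])
      also have "\<dots> = unit_class [^]\<^bsub>MvN\<^esub> (Suc r)"
        using mvn_class_eqI[OF P(2), folded unit_class_def] r(2)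
          MvN.m_comm[OF unit_class_closed MvN.nat_pow_closed[OF unit_class_closed]]
        by simp
      finally show ?thesis using r(1) qP(3) by (intro exI[of _ "Suc r"]) (simp add: algebra_simps)
    qed
  qed
  moreover obtain K :: nat where "Re (diag_total q) < real K" using reals_Archimedean2 by blast
  ultimately show ?thesis using assms(1) by blast
qed

lemma projection_class:
  assumes "p \<in> projections n" "0 < n" "\<And>i j. i < n \<Longrightarrow> j < n \<Longrightarrow> p $$ (i, j) \<in> span_set"
  shows "\<exists>r. mvn_class p = unit_class [^]\<^bsub>MvN\<^esub> (r::nat)"
proof -
  obtain q where q: "q \<in> projections (n * d)" "(p, scalar_mat q) \<in> mvn_rel"
    using projection_equivalent_scalar[OF assms] by blast
  have "0 < n * d" using assms(2) d_pos by simp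
  from scalar_projection_class[OF q(1) this] obtain r
    where "mvn_class (scalar_mat q) = unit_class [^]\<^bsub>MvN\<^esub> (r::nat)" by (elim exE conjE)
  then have "mvn_class p = unit_class [^]\<^bsub>MvN\<^esub> r" using mvn_class_eqI[OF q(2)] by simp
  then show ?thesis by (rule exI)
qed

text \<open>For n = 1 the unit column relates 1 to the image of the complex identity of size d,
  whose trace is d.\<close>

lemma class_one: "mvn_class (1\<^sub>m 1) = unit_class [^]\<^bsub>MvN\<^esub> d"
proof -
  have "(1\<^sub>m 1, scalar_mat (1\<^sub>m d)) \<in> mvn_rel"
    using unit_column_mult_star[of 1] star_unit_column_mult[of 1] d_pos unit_column_carrier[of 1]
    by (intro mvn_relI[OF one_projection scalar_mat_projection[OF one_projection], of _ _ "unit_column 1"]) simp_all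
  then have "mvn_class (1\<^sub>m 1) = mvn_class (scalar_mat (1\<^sub>m d))" by (rule mvn_class_eqI)
  moreover obtain r where r: "diag_total (1\<^sub>m d) = of_nat r"
    "mvn_class (scalar_mat (1\<^sub>m d)) = unit_class [^]\<^bsub>MvN\<^esub> r"
    using scalar_projection_class[OF one_projection d_pos] by blast
  moreover have "diag_total (1\<^sub>m d) = of_nat d" by (simp add: diag_total_def)
  ultimately show ?thesis by simp
qed

end

section \<open>Kernels of wide matrices\<close>

lemma complex_kernel_vector:
  assumes c: "c \<in> carrier_mat m n" and "m < n"
  obtains x :: "complex mat" where "x \<in> carrier_mat n 1" "x \<noteq> 0\<^sub>m n 1" "c * x = 0\<^sub>m m 1"
proof -
  \<comment> \<open>Padding with zero rows makes the matrix square. Row m is zero because m < n, so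
    the transpose kills the unit vector at m and the determinant vanishes.\<close>
  define c' where "c' = mat n n (\<lambda>(i, j). if i < m then c $$ (i, j) else 0)"
  have c': "c' \<in> carrier_mat n n" by (simp add: c'_def)
  have "transpose_mat c' *\<^sub>v unit_vec n m = 0\<^sub>v n"
    using \<open>m < n\<close> by (intro eq_vecI) (auto simp: c'_def)
  moreover have "unit_vec n m \<noteq> (0\<^sub>v n :: complex vec)" using \<open>m < n\<close> by simp
  ultimately have "det (transpose_mat c') = 0"
    using c' by (subst det_0_iff_vec_prod_zero[of _ n]) (auto intro!: exI[of _ "unit_vec n m"])
  then have "det c' = 0" using det_transpose[OF c'] by simp
  then obtain v where v: "v \<in> carrier_vec n" "v \<noteq> 0\<^sub>v n" "c' *\<^sub>v v = 0\<^sub>v n"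
    using det_0_iff_vec_prod_zero[OF c'] by blast
  define x where "x = mat n 1 (\<lambda>(i, _). v $ i)"
  have x: "x \<in> carrier_mat n 1" by (simp add: x_def)
  show ?thesis
  proof (rule that[OF x])
    show "x \<noteq> 0\<^sub>m n 1"
    proof
      assume x0: "x = 0\<^sub>m n 1"
      have "v $ i = 0" if "i < n" for i
      proof -
        have "x $$ (i, 0) = 0" using x0 that by simp
        then show ?thesis using that by (simp add: x_def)
      qed
      with v(1,2) show False by (metis carrier_vecD eq_vecI index_zero_vec)
    qed
    show "c * x = 0\<^sub>m m 1"
    proof (rule eq_matI)
      fix i j assume "i < dim_row (0\<^sub>m m 1 :: complex mat)" "j < dim_col (0\<^sub>m m 1 :: complex mat)"
      then have ij: "i < m" "j = 0" by auto
      have "(c * x) $$ (i, 0) = (\<Sum>l<n. c $$ (i, l) * x $$ (l, 0))"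
        by (rule index_mult_mat_sum[OF c x]) (use ij in auto)
      also have "\<dots> = (c' *\<^sub>v v) $ i"
        using ij \<open>m < n\<close> v(1) by (simp add: x_def c'_def scalar_prod_def lessThan_atLeast0)
      finally show "(c * x) $$ (i, j) = 0\<^sub>m m 1 $$ (i, j)" using v(3) ij \<open>m < n\<close> by simp
    qed (use c x in auto)
  qed
qed

text \<open>The scalar form of w has size m d times n d, so it has a complex kernel vector. Pulling
  it back by the adjoint of the unit column keeps it nonzero, because the column maps the result to
  the embedded vector again.\<close>

lemma (in matrix_units) kernel_column:
  assumes w: "w \<in> carrier_mat m n" "m < n" and B: "\<And>i j. i < m \<Longrightarrow> j < n \<Longrightarrow> w $$ (i, j) \<in> span_set"
  obtains y where "y \<in> carrier_mat n 1" "y \<noteq> 0\<^sub>m n 1" "w * y = 0\<^sub>m m 1"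
proof -
  let ?C = "unit_column n" and ?D = "unit_column m"
  note C = unit_column_carrier[of n] star_unit_column_carrier[of n]
  note D = unit_column_carrier[of m] star_unit_column_carrier[of m]
  obtain c where c: "c \<in> carrier_mat (m * d) (n * d)" "?D * w * mat_star ?C = scalar_mat c"
    using corner_scalar[OF w(1) B] by blast
  have "m * d < n * d" using w(2) d_pos by simp
  then obtain x where x: "x \<in> carrier_mat (n * d) 1" "x \<noteq> 0\<^sub>m (n * d) 1" "c * x = 0\<^sub>m (m * d) 1"
    using complex_kernel_vector[OF c(1)] by blast
  have sx: "scalar_mat x \<in> carrier_mat (n * d) 1" using x by simp
  define y where "y = mat_star ?C * scalar_mat x"
  have y: "y \<in> carrier_mat n 1" unfolding y_def by (rule mult_carrier_mat[OF C(2) sx])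
  show ?thesis
  proof (rule that[OF y])
    have "?C * y = ?C * mat_star ?C * scalar_mat x"
      unfolding y_def by (rule assoc_mult_mat[OF C sx, symmetric])
    also have "\<dots> = scalar_mat (1\<^sub>m (n * d) * x)"
      unfolding unit_column_mult_star by (rule scalar_mat_mult[OF one_carrier_mat x(1), symmetric])
    finally have Cy: "?C * y = scalar_mat x" using x(1) by simp
    show "y \<noteq> 0\<^sub>m n 1"
    proof
      assume "y = 0\<^sub>m n 1"
      then have "scalar_mat x = scalar_mat (0\<^sub>m (n * d) 1)"
        using Cy right_mult_zero_mat[OF C(1), of 1] by (simp add: scalar_mat_zero)
      then show False using scalar_mat_inject[OF x(1)] x(2) by simp
    qed
    have wy: "w * y \<in> carrier_mat m 1" by (rule mult_carrier_mat[OF w(1) y])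
    have wC: "w * mat_star ?C \<in> carrier_mat m (n * d)" by (rule mult_carrier_mat[OF w(1) C(2)])
    have "w * y = (mat_star ?D * ?D) * (w * y)" unfolding star_unit_column_mult left_mult_one_mat[OF wy] ..
    also have "\<dots> = mat_star ?D * (?D * (w * y))" by (rule assoc_mult_mat[OF D(2,1) wy])
    also have "?D * (w * y) = ?D * (w * mat_star ?C * scalar_mat x)"
      unfolding y_def assoc_mult_mat[OF w(1) C(2) sx] ..
    also have "?D * (w * mat_star ?C * scalar_mat x) = ?D * (w * mat_star ?C) * scalar_mat x"
      by (rule assoc_mult_mat[OF D(1) wC sx, symmetric])
    also have "?D * (w * mat_star ?C) = scalar_mat c"
      using assoc_mult_mat[OF D(1) w(1) C(2)] c(2) by simp
    also have "scalar_mat c * scalar_mat x = 0\<^sub>m (m * d) 1"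
      using scalar_mat_mult[OF c(1) x(1)] x(3) by (simp add: scalar_mat_zero)
    finally show "w * y = 0\<^sub>m m 1" using right_mult_zero_mat[OF D(2), of 1] by simp
  qed
qed

section \<open>The semigroup of a UHF algebra\<close>

lemma norm_of_mat_le:
  assumes M: "M \<in> carrier_mat n m" and \<delta>: "0 \<le> \<delta>" "\<And>i j. i < n \<Longrightarrow> j < m \<Longrightarrow> norm (M $$ (i, j)) \<le> \<delta>"
  shows "norm (of_mat M) \<le> real (n + m) * (real (n + m) * \<delta>)"
proof -
  have "fits (n + m) (of_mat M)" using M by (auto simp: supported_def entry_of_mat)
  then have "norm (of_mat M) = (\<Sum>i<n + m. \<Sum>j<n + m. norm (entry (of_mat M) i j))"
    by (rule norm_fmat_eq)
  also have "\<dots> \<le> (\<Sum>i<n + m. \<Sum>j<n + m. \<delta>)"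
    using M \<delta> by (intro sum_mono) (auto simp: entry_of_mat)
  finally show ?thesis by simp
qed

text \<open>R k stands for the image of the k-th matrix algebra. It carries nesting, density and the
  adjoint, while the surrounding \<open>span_set\<close> carries closedness under products and
  limits.\<close>

locale uhf_system =
  fixes d :: "nat \<Rightarrow> nat" and e :: "nat \<Rightarrow> nat \<Rightarrow> nat \<Rightarrow> 'a::cstar_algebra_1" and R :: "nat \<Rightarrow> 'a set"
  assumes units: "\<And>k. matrix_units (d k) (e k)"
    and R_span: "\<And>k. R k \<subseteq> matrix_units.span_set (d k) (e k)"
    and R_unit: "\<And>k. e k 0 0 \<in> R k"
    and R_add: "\<And>k a b. a \<in> R k \<Longrightarrow> b \<in> R k \<Longrightarrow> a + b \<in> R k"
    and R_scaleR: "\<And>k r a. a \<in> R k \<Longrightarrow> r *\<^sub>R a \<in> R k"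
    and R_star: "\<And>k a. a \<in> R k \<Longrightarrow> star a \<in> R k"
    and R_Suc: "\<And>k. R k \<subseteq> R (Suc k)"
    and R_dense: "\<And>a \<epsilon>. 0 < \<epsilon> \<Longrightarrow> \<exists>k. \<exists>b\<in>R k. norm (b - a) < \<epsilon>"
begin

lemma R_mono: "k \<le> l \<Longrightarrow> R k \<subseteq> R l"
  by (rule lift_Suc_mono_le[of R]) (rule R_Suc)

lemma approximate_matrix:
  assumes p: "p \<in> carrier_mat n m" and "0 < \<epsilon>"
  obtains k b where "b \<in> carrier_mat n m" "\<forall>i<n. \<forall>j<m. b $$ (i, j) \<in> R k"
    "norm (of_mat b - of_mat p) < \<epsilon>"
proof -
  define N where "N = real (n + m)"
  \<comment> \<open>The error is divided among the at most N^2 entries; adding 1 keeps the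
    denominator positive and the final estimate strict.\<close>
  define \<delta> where "\<delta> = \<epsilon> / (N * N + 1)"
  have pos: "0 < N * N + 1" by (simp add: add_nonneg_pos)
  then have \<delta>: "0 < \<delta>" using \<open>0 < \<epsilon>\<close> by (simp add: \<delta>_def)
  have "\<forall>i j. \<exists>k. \<exists>b\<in>R k. norm (b - p $$ (i, j)) < \<delta>" using R_dense[OF \<delta>] by blast
  then obtain K f where f: "\<And>i j. f i j \<in> R (K i j)" "\<And>i j. norm (f i j - p $$ (i, j)) < \<delta>" by metis
  \<comment> \<open>The sum is an upper bound of the finitely many levels used by the
    entries.\<close>
  define k where "k = (\<Sum>i<n. \<Sum>j<m. K i j)"
  have k: "K i j \<le> k" if "i < n" "j < m" for i j
  proof -
    have "K i j \<le> (\<Sum>j<m. K i j)" using that by (intro member_le_sum) auto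
    also have "\<dots> \<le> k" unfolding k_def using that by (intro member_le_sum[of i]) auto
    finally show ?thesis .
  qed
  define b where "b = mat n m (\<lambda>(i, j). f i j)"
  have b: "b \<in> carrier_mat n m" by (simp add: b_def)
  have bp: "b - p \<in> carrier_mat n m" by (rule minus_carrier_mat[OF p])
  show ?thesis
  proof (rule that[OF b])
    show "\<forall>i<n. \<forall>j<m. b $$ (i, j) \<in> R k"
    proof (intro allI impI)
      fix i j assume ij: "i < n" "j < m"
      have "f i j \<in> R k" using R_mono[OF k[OF ij]] f(1)[of i j] by (rule subsetD)
      then show "b $$ (i, j) \<in> R k" using ij by (simp add: b_def)
    qed
    have "norm ((b - p) $$ (i, j)) \<le> \<delta>" if "i < n" "j < m" for i j
    proof -
      have "(b - p) $$ (i, j) = f i j - p $$ (i, j)" using that p by (simp add: b_def)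
      then show ?thesis using f(2)[of i j] by simp
    qed
    then have "norm (of_mat (b - p)) \<le> N * (N * \<delta>)"
      unfolding N_def by (intro norm_of_mat_le[OF bp less_imp_le[OF \<delta>]])
    also have "N * (N * \<delta>) < (N * N + 1) * \<delta>" using \<delta> by (simp add: algebra_simps)
    also have "\<dots> = \<epsilon>" using pos by (simp add: \<delta>_def)
    finally show "norm (of_mat b - of_mat p) < \<epsilon>" unfolding of_mat_minus[OF b p] .
  qed
qed

lemma projection_equivalent_level:
  assumes p: "p \<in> projections n" "0 < n"
  obtains k q where "q \<in> projections n" "(p, q) \<in> mvn_rel"
    "\<forall>i<n. \<forall>j<n. q $$ (i, j) \<in> matrix_units.span_set (d k) (e k)"
proof -
  note p' = projectionsD[OF p(1)]
  note fp = fproj_of_mat[OF p(1)] and fits_p = fits_of_mat[OF p'(1)]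
  have fsp: "fstar (of_mat p) = of_mat p" using fp by (simp add: fproj_def)
  show ?thesis
  proof (rule projection_near[OF fp])
    fix \<delta> assume \<delta>: "0 < \<delta>"
      "\<And>b S n. fstar b = b \<Longrightarrow> norm (b - of_mat p) \<le> \<delta> \<Longrightarrow> closed_subalgebra S \<Longrightarrow> b \<in> S \<Longrightarrow>
         fits n (of_mat p) \<Longrightarrow> (\<And>a. a \<in> S \<Longrightarrow> fits n a) \<Longrightarrow>
         \<exists>e v. fproj e \<and> e \<in> S \<and> fits n v \<and> fstar v * v = of_mat p \<and> v * fstar v = e"
    obtain k b where b: "b \<in> carrier_mat n n" "\<forall>i<n. \<forall>j<n. b $$ (i, j) \<in> R k"
      "norm (of_mat b - of_mat p) < \<delta>"
      by (rule approximate_matrix[OF p'(1) \<delta>(1)]) (rule that)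
    interpret M: matrix_units "d k" "e k" by (rule units)
    define S where "S = {a :: 'a fmat. fits n a \<and> (\<forall>i j. entry a i j \<in> M.span_set)}"
    have S: "closed_subalgebra S"
      unfolding S_def by (rule closed_subalgebra_entries[OF M.closed_subalgebra_span_set])
    have Sfits: "\<And>a. a \<in> S \<Longrightarrow> fits n a" by (simp add: S_def)
    \<comment> \<open>The approximation is made selfadjoint by averaging. As p is selfadjoint and
      the adjoint is isometric, the distance to p does not grow.\<close>
    define c where "c = (1/2) *\<^sub>R (of_mat b + fstar (of_mat b))"
    have c1: "fstar c = c" by (simp add: c_def fstar_scaleR fstar_add add.commute)
    have "c - of_mat p = (1/2) *\<^sub>R ((of_mat b - of_mat p) + fstar (of_mat b - of_mat p))"
    proof -
      have "c - of_mat p = c - ((1/2) *\<^sub>R of_mat p + (1/2) *\<^sub>R of_mat p)"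
        by (simp flip: scaleR_add_left)
      also have "\<dots> = (1/2) *\<^sub>R ((of_mat b - of_mat p) + fstar (of_mat b - of_mat p))"
        unfolding c_def fstar_diff fsp by (simp add: algebra_simps)
      finally show ?thesis .
    qed
    then have "norm (c - of_mat p) = (1/2) * norm ((of_mat b - of_mat p) + fstar (of_mat b - of_mat p))"
      by simp
    also have "\<dots> \<le> (1/2) * (norm (of_mat b - of_mat p) + norm (fstar (of_mat b - of_mat p)))"
      by (intro mult_left_mono norm_triangle_ineq) simp
    also have "\<dots> = norm (of_mat b - of_mat p)" by (simp add: norm_fstar)
    finally have c2: "norm (c - of_mat p) \<le> \<delta>" using b(3) by simp
    have c3: "c \<in> S"
    proof -
      have fb: "fits n (of_mat b)" by (rule fits_of_mat[OF b(1)])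
      then have fc: "fits n c" by (simp add: c_def supported_def)
      have "entry c i j \<in> M.span_set" for i j
      proof (cases "i < n \<and> j < n")
        case True
        then have "entry c i j = (1/2) *\<^sub>R (b $$ (i, j) + star (b $$ (j, i)))"
          using b(1) by (simp add: c_def entry_of_mat)
        also have "\<dots> \<in> R k" using True by (intro R_scaleR R_add R_star b(2)[rule_format]) auto
        finally show ?thesis using R_span by blast
      next
        case False
        then have "entry c i j = 0" using supported_outside[OF fc] by (simp add: not_less)
        then show ?thesis using closed_subalgebraD(1)[OF M.closed_subalgebra_span_set] by simp
      qed
      then show ?thesis using fc by (simp add: S_def)
    qed
    have "\<exists>e v. fproj e \<and> e \<in> S \<and> fits n v \<and> fstar v * v = of_mat p \<and> v * fstar v = e"
      by (rule \<delta>(2)[OF c1 c2 S c3 fits_p]) (rule Sfits)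
    then obtain E v
      where E: "fproj E" "E \<in> S" "fits n v" "fstar v * v = of_mat p" "v * fstar v = E"
      by (elim exE conjE)
    have fE: "fits n E" by (rule Sfits[OF E(2)])
    have E': "to_mat n E \<in> projections n" by (rule projection_to_mat[OF E(1) fE])
    show ?thesis
    proof (rule that[OF E'])
      show "(p, to_mat n E) \<in> mvn_rel"
      proof (rule mvn_relI[OF p(1) E' p(2) p(2) to_mat_carrier])
        show "mat_star (to_mat n v) * to_mat n v = p"
          unfolding to_mat_fstar[OF E(3), symmetric] to_mat_times[OF fits_fstar[OF E(3)] E(3), symmetric] E(4)
          by (rule to_mat_of_mat[OF p'(1)])
        show "to_mat n v * mat_star (to_mat n v) = to_mat n E"
          unfolding to_mat_fstar[OF E(3), symmetric] to_mat_times[OF E(3) fits_fstar[OF E(3)], symmetric] E(5) ..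
      qed
      show "\<forall>i<n. \<forall>j<n. to_mat n E $$ (i, j) \<in> M.span_set"
        using E(2) by (simp add: S_def to_mat_def)
    qed
  qed
qed

text \<open>
  A partial isometry from \<open>1\<^sub>n\<close> to \<open>1\<^sub>m\<close> with \<open>m < n\<close> would be close to a matrix with entries in a
  matrix algebra, which has a kernel for dimension reasons.
\<close>

lemma identity_mvn_le:
  assumes "((1\<^sub>m n :: 'a mat), 1\<^sub>m m) \<in> mvn_rel"
  shows "n \<le> m"
proof (rule ccontr)
  assume "\<not> n \<le> m"
  have "\<exists>v\<in>carrier_mat m n. 1\<^sub>m n = mat_star v * v \<and> 1\<^sub>m m = v * mat_star (v :: 'a mat)"
    using assms unfolding mvn_rel_def by simp
  then obtain v where v: "v \<in> carrier_mat m n" "1\<^sub>m n = mat_star v * (v :: 'a mat)" by blast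
  have vs: "mat_star v \<in> carrier_mat n m" using v by simp
  \<comment> \<open>The added 1 makes L positive and the product of the norm of the adjoint of v
    with 1 / L smaller than 1.\<close>
  define L where "L = norm (fstar (of_mat v)) + 1"
  have L: "0 < L" by (simp add: L_def add_nonneg_pos)
  then have "0 < 1 / L" by simp
  then obtain k w where w: "w \<in> carrier_mat m n" "\<forall>i<m. \<forall>j<n. w $$ (i, j) \<in> R k"
    "norm (of_mat w - of_mat v) < 1 / L"
    by (rule approximate_matrix[OF v(1)]) (rule that)
  interpret M: matrix_units "d k" "e k" by (rule units)
  have "m < n" using \<open>\<not> n \<le> m\<close> by simp
  moreover have "\<And>i j. i < m \<Longrightarrow> j < n \<Longrightarrow> w $$ (i, j) \<in> M.span_set" using w(2) R_span by blast
  ultimately obtain y where y: "y \<in> carrier_mat n 1" "y \<noteq> 0\<^sub>m n 1" "w * y = 0\<^sub>m m 1"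
    using M.kernel_column[OF w(1)] by blast
  let ?V = "of_mat v" and ?W = "of_mat w" and ?Y = "of_mat y"
  have zero: "of_mat (0\<^sub>m a b) = (0 :: 'a fmat)" for a b by (rule fmat_eqI) (simp add: entry_of_mat)
  have WY: "?W * ?Y = 0" using of_mat_mult[OF w(1) y(1)] y(3) zero by simp
  have "fstar ?V * ?V * ?Y = ?Y"
    unfolding of_mat_star[symmetric] of_mat_mult[OF vs v(1), symmetric] v(2)[symmetric]
      of_mat_mult[OF one_carrier_mat y(1), symmetric] left_mult_one_mat[OF y(1)] ..
  \<comment> \<open>W annihilates Y while V is an isometry, so Y is recovered from (V - W) Y; a
    factor of norm below 1 then forces Y = 0.\<close>
  then have "?Y = fstar ?V * ((?V - ?W) * ?Y)"
    by (simp add: left_diff_distrib WY mult.assoc)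
  then have "norm ?Y \<le> norm (fstar ?V) * (norm (?V - ?W) * norm ?Y)"
    using norm_mult_ineq[of "fstar ?V" "(?V - ?W) * ?Y"] norm_mult_ineq[of "?V - ?W" ?Y]
    by (metis (no_types, lifting) mult_left_mono norm_ge_zero order_trans)
  also have "\<dots> = (norm (fstar ?V) * norm (?V - ?W)) * norm ?Y" by simp
  finally have le: "norm ?Y \<le> (norm (fstar ?V) * norm (?V - ?W)) * norm ?Y" .
  have "norm (fstar ?V) * norm (?V - ?W) < 1"
  proof -
    have "norm (fstar ?V) * norm (?V - ?W) \<le> norm (fstar ?V) * (1 / L)"
      using w(3) by (intro mult_left_mono) (simp_all add: norm_minus_commute)
    also have "\<dots> < L * (1 / L)" using L by (intro mult_strict_right_mono) (simp_all add: L_def)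
    finally show ?thesis using L by simp
  qed
  then have "norm ?Y = 0"
    using le mult_strict_right_mono[of "norm (fstar ?V) * norm (?V - ?W)" 1 "norm ?Y"] by fastforce
  then have "of_mat y = of_mat (0\<^sub>m n 1)" by (simp add: zero)
  then show False using of_mat_inject[OF y(1)] y(2) by simp
qed

section \<open>Classes of minimal projections and their comparison\<close>

abbreviation \<zeta> where "\<zeta> k \<equiv> matrix_units.unit_class (e k)"
abbreviation U :: "'a mat set" where "U \<equiv> mvn_class (1\<^sub>m 1)"

lemma \<zeta>_closed: "\<zeta> k \<in> carrier MvN"
  by (rule matrix_units.unit_class_closed[OF units])

lemma U_closed: "U \<in> carrier MvN"
  by (rule mvn_class_closed[OF matrix_units.one_projection[OF units]]) simp

lemma d_pos: "0 < d k"
  by (rule matrix_units.d_pos[OF units])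

lemma \<zeta>_pow_d: "\<zeta> k [^]\<^bsub>MvN\<^esub> d k = U"
  by (rule matrix_units.class_one[OF units, symmetric])

text \<open>Exponents start at 1 because matrices of size 0 represent no class.\<close>

lemma U_pow: "U [^]\<^bsub>MvN\<^esub> (Suc n) = mvn_class (1\<^sub>m (Suc n))"
proof (induction n)
  case 0
  show ?case using U_closed by simp
next
  case (Suc n)
  have one: "(1\<^sub>m l :: 'a mat) \<in> projections l" for l by (rule matrix_units.one_projection[OF units])
  have "U [^]\<^bsub>MvN\<^esub> Suc (Suc n) = mvn_class (1\<^sub>m (Suc n)) \<otimes>\<^bsub>MvN\<^esub> U"
    using Suc by simp
  also have "\<dots> = mvn_class (diag_sum (1\<^sub>m (Suc n)) (1\<^sub>m 1))"
    by (rule mult_MvN_projections[OF one one]) simp_all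
  also have "diag_sum (1\<^sub>m (Suc n)) (1\<^sub>m 1) = (1\<^sub>m (Suc (Suc n)) :: 'a mat)"
    using four_block_one_mat[of "Suc n" 1] by (simp add: diag_sum_def)
  finally show ?case .
qed

lemma U_pow_inject:
  assumes "U [^]\<^bsub>MvN\<^esub> n = U [^]\<^bsub>MvN\<^esub> (m::nat)"
  shows "n = m"
proof -
  have one: "(1\<^sub>m (Suc l) :: 'a mat) \<in> all_projections" for l
    by (rule all_projectionsI[OF matrix_units.one_projection[OF units]]) simp
  have "n \<le> m" if "U [^]\<^bsub>MvN\<^esub> n = U [^]\<^bsub>MvN\<^esub> m" for n m :: nat
  proof -
    \<comment> \<open>One more factor on both sides brings the exponent 0 under
      \<open>U_pow\<close>.\<close>
    have "U [^]\<^bsub>MvN\<^esub> Suc n = U [^]\<^bsub>MvN\<^esub> Suc m" using that by simp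
    then have "((1\<^sub>m (Suc n) :: 'a mat), 1\<^sub>m (Suc m)) \<in> mvn_rel"
      unfolding U_pow mvn_class_eq_iff[OF one one] .
    from identity_mvn_le[OF this] show ?thesis by simp
  qed
  from this[OF assms] this[OF assms[symmetric]] show ?thesis by simp
qed

lemma class_is_power:
  assumes "X \<in> carrier MvN"
  obtains k and r :: nat where "X = \<zeta> k [^]\<^bsub>MvN\<^esub> r"
proof -
  obtain n p where p: "0 < n" "p \<in> projections n" "X = mvn_class p" by (rule carrier_MvNE[OF assms])
  obtain k q where q: "q \<in> projections n" "(p, q) \<in> mvn_rel"
    "\<forall>i<n. \<forall>j<n. q $$ (i, j) \<in> matrix_units.span_set (d k) (e k)"
    by (rule projection_equivalent_level[OF p(2,1)]) (rule that)
  have "\<exists>r. mvn_class q = \<zeta> k [^]\<^bsub>MvN\<^esub> (r::nat)"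
    by (rule matrix_units.projection_class[OF units q(1) p(1)]) (rule q(3)[rule_format])
  then obtain r where "mvn_class q = \<zeta> k [^]\<^bsub>MvN\<^esub> (r::nat)" by (elim exE)
  then have "X = \<zeta> k [^]\<^bsub>MvN\<^esub> r" using mvn_class_eqI[OF q(2)] p(3) by simp
  then show ?thesis by (rule that)
qed

text \<open>The minimal projection of level k is a matrix of size 1 with its entry at level l, so
  \<open>projection_class\<close> applies to it there.\<close>

lemma \<zeta>_is_power:
  assumes "k \<le> l"
  obtains t :: nat where "\<zeta> k = \<zeta> l [^]\<^bsub>MvN\<^esub> t"
proof -
  interpret M: matrix_units "d k" "e k" by (rule units)
  note proj = M.scalar_mat_projection[OF M.one_projection[of 1]]
  have "e k 0 0 \<in> matrix_units.span_set (d l) (e l)"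
    using R_unit R_mono[OF assms] R_span by blast
  then have "\<And>i j. i < 1 \<Longrightarrow> j < 1 \<Longrightarrow>
      M.scalar_mat (1\<^sub>m 1) $$ (i, j) \<in> matrix_units.span_set (d l) (e l)"
    by (simp add: M.scalar_mat_def)
  then have "\<exists>t. \<zeta> k = \<zeta> l [^]\<^bsub>MvN\<^esub> (t::nat)"
    unfolding M.unit_class_def by (intro matrix_units.projection_class[OF units proj]) simp_all
  then obtain t where "\<zeta> k = \<zeta> l [^]\<^bsub>MvN\<^esub> (t::nat)" by (elim exE)
  then show ?thesis by (rule that)
qed

lemma raise_level:
  assumes "k \<le> l"
  obtains s :: nat where "\<zeta> k [^]\<^bsub>MvN\<^esub> (r::nat) = \<zeta> l [^]\<^bsub>MvN\<^esub> s"
proof -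
  obtain t :: nat where "\<zeta> k = \<zeta> l [^]\<^bsub>MvN\<^esub> t" by (rule \<zeta>_is_power[OF assms])
  then have "\<zeta> k [^]\<^bsub>MvN\<^esub> r = \<zeta> l [^]\<^bsub>MvN\<^esub> (t * r)" using MvN.nat_pow_pow[OF \<zeta>_closed] by simp
  then show ?thesis by (rule that)
qed

text \<open>Any two classes are multiples of one generator, so addition, order and equality of
  classes become statements about exponents.\<close>

lemma common_level:
  assumes "X \<in> carrier MvN" "Y \<in> carrier MvN"
  obtains k and r s :: nat where "X = \<zeta> k [^]\<^bsub>MvN\<^esub> r" "Y = \<zeta> k [^]\<^bsub>MvN\<^esub> s"
proof -
  obtain k l and r s :: nat where X: "X = \<zeta> k [^]\<^bsub>MvN\<^esub> r" and Y: "Y = \<zeta> l [^]\<^bsub>MvN\<^esub> s"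
  proof -
    obtain k and r :: nat where 1: "X = \<zeta> k [^]\<^bsub>MvN\<^esub> r" by (rule class_is_power[OF assms(1)])
    obtain l and s :: nat where 2: "Y = \<zeta> l [^]\<^bsub>MvN\<^esub> s" by (rule class_is_power[OF assms(2)])
    show ?thesis by (rule that[OF 1 2])
  qed
  obtain r' :: nat where r': "\<zeta> k [^]\<^bsub>MvN\<^esub> r = \<zeta> (max k l) [^]\<^bsub>MvN\<^esub> r'"
    by (rule raise_level[of k "max k l" r]) simp_all
  obtain s' :: nat where s': "\<zeta> l [^]\<^bsub>MvN\<^esub> s = \<zeta> (max k l) [^]\<^bsub>MvN\<^esub> s'"
    by (rule raise_level[of l "max k l" s]) simp_all
  show ?thesis by (rule that[of "max k l" r' s']) (simp_all add: X Y r' s')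
qed

lemma power_eqD:
  assumes "\<zeta> k [^]\<^bsub>MvN\<^esub> r = \<zeta> l [^]\<^bsub>MvN\<^esub> (s::nat)"
  shows "r * d l = s * d k"
proof -
  \<comment> \<open>Multiplying r \<zeta> k by d k turns it into a multiple of U; applied at both
    levels, this leaves an equality of multiples of U.\<close>
  have pow: "(\<zeta> k [^]\<^bsub>MvN\<^esub> r) [^]\<^bsub>MvN\<^esub> (d k * m) = U [^]\<^bsub>MvN\<^esub> (r * m)" for k and r m :: nat
  proof -
    have "(\<zeta> k [^]\<^bsub>MvN\<^esub> r) [^]\<^bsub>MvN\<^esub> (d k * m) = \<zeta> k [^]\<^bsub>MvN\<^esub> (d k * (r * m))"
      using MvN.nat_pow_pow[OF \<zeta>_closed] by (simp add: mult_ac)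
    also have "\<dots> = U [^]\<^bsub>MvN\<^esub> (r * m)"
      using MvN.nat_pow_pow[OF \<zeta>_closed, of k "d k" "r * m"] \<zeta>_pow_d by simp
    finally show ?thesis .
  qed
  have "U [^]\<^bsub>MvN\<^esub> (r * d l) = U [^]\<^bsub>MvN\<^esub> (s * d k)"
    using pow[of k r "d l"] pow[of l s "d k"] assms by (simp add: mult.commute)
  then show ?thesis by (rule U_pow_inject)
qed

definition rank :: "'a mat set \<Rightarrow> real" where
  "rank X = (THE a. \<exists>k (r::nat). X = \<zeta> k [^]\<^bsub>MvN\<^esub> r \<and> a = real r / real (d k))"

lemma rank_power: "rank (\<zeta> k [^]\<^bsub>MvN\<^esub> (r::nat)) = real r / real (d k)"
  unfolding rank_def
proof (rule the_equality)
  fix a assume "\<exists>l (s::nat). \<zeta> k [^]\<^bsub>MvN\<^esub> r = \<zeta> l [^]\<^bsub>MvN\<^esub> s \<and> a = real s / real (d l)"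
  then obtain l and s :: nat where s: "\<zeta> k [^]\<^bsub>MvN\<^esub> r = \<zeta> l [^]\<^bsub>MvN\<^esub> s" "a = real s / real (d l)"
    by blast
  have "real r * real (d l) = real s * real (d k)"
    using power_eqD[OF s(1)] by (metis of_nat_mult)
  then show "a = real r / real (d k)"
    unfolding s(2) using d_pos[of k] d_pos[of l] by (subst frac_eq_eq) simp_all
qed blast

end

section \<open>Grothendieck groups of rank one\<close>

text \<open>Injectivity of \<tau> makes S cancellative, so the Grothendieck relation is equality of
  differences of values. By \<open>\<tau>_le\<close> the order of values is the algebraic order of
  S, which is what identifies the positive cone.\<close>

locale rational_monoid = comm_monoid S for S :: "'s monoid" (structure) +
  fixes \<tau> :: "'s \<Rightarrow> real"
  assumes \<tau>_mult: "x \<in> carrier S \<Longrightarrow> y \<in> carrier S \<Longrightarrow> \<tau> (x \<otimes> y) = \<tau> x + \<tau> y"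
    and \<tau>_inj: "inj_on \<tau> (carrier S)"
    and \<tau>_nonneg: "x \<in> carrier S \<Longrightarrow> 0 \<le> \<tau> x"
    and \<tau>_le: "x \<in> carrier S \<Longrightarrow> y \<in> carrier S \<Longrightarrow> \<tau> x \<le> \<tau> y \<Longrightarrow> \<exists>z\<in>carrier S. y = x \<otimes> z"
    and \<tau>_rat: "x \<in> carrier S \<Longrightarrow> \<tau> x \<in> \<rat>"
begin

abbreviation cls :: "'s \<Rightarrow> 's \<Rightarrow> ('s \<times> 's) set" where
  "cls x y \<equiv> groth_rel S `` {(x, y)}"

lemma groth_rel_iff:
  "((x, y), (x', y')) \<in> groth_rel S \<longleftrightarrow>
     {x, y, x', y'} \<subseteq> carrier S \<and> \<tau> x - \<tau> y = \<tau> x' - \<tau> y'"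
proof (cases "{x, y, x', y'} \<subseteq> carrier S")
  case True
  then have c: "x \<in> carrier S" "y \<in> carrier S" "x' \<in> carrier S" "y' \<in> carrier S" by auto
  have "(x \<otimes> y') \<otimes> z = (x' \<otimes> y) \<otimes> z \<longleftrightarrow> \<tau> x - \<tau> y = \<tau> x' - \<tau> y'" if z: "z \<in> carrier S" for z
  proof -
    have "(x \<otimes> y') \<otimes> z = (x' \<otimes> y) \<otimes> z \<longleftrightarrow> \<tau> ((x \<otimes> y') \<otimes> z) = \<tau> ((x' \<otimes> y) \<otimes> z)"
      using inj_on_eq_iff[OF \<tau>_inj] c z by simp
    also have "\<dots> \<longleftrightarrow> \<tau> x - \<tau> y = \<tau> x' - \<tau> y'"
      using c z by (simp add: \<tau>_mult) linarith
    finally show ?thesis .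
  qed
  then show ?thesis using True one_closed unfolding groth_rel_def by auto
qed (auto simp: groth_rel_def)

lemma equiv_groth_rel: "equiv (carrier S \<times> carrier S) (groth_rel S)"
proof (rule equivI)
  show "groth_rel S \<subseteq> (carrier S \<times> carrier S) \<times> (carrier S \<times> carrier S)"
    by (auto simp: groth_rel_def)
  show "refl_on (carrier S \<times> carrier S) (groth_rel S)"
    by (rule refl_onI) (auto simp: groth_rel_iff)
  show "sym (groth_rel S)" by (rule symI) (auto simp: groth_rel_iff)
  show "trans (groth_rel S)" by (rule transI) (auto simp: groth_rel_iff)
qed

text \<open>The choice of representative is immaterial by \<open>groth_rel_iff\<close>.\<close>

definition diff_value :: "('s \<times> 's) set \<Rightarrow> real" where
  "diff_value Q = (let (x, y) = (SOME q. q \<in> Q) in \<tau> x - \<tau> y)"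

lemma cls_self: "x \<in> carrier S \<Longrightarrow> y \<in> carrier S \<Longrightarrow> (x, y) \<in> cls x y"
  by (simp add: groth_rel_iff)

lemma diff_value_cls:
  assumes "x \<in> carrier S" "y \<in> carrier S"
  shows "diff_value (cls x y) = \<tau> x - \<tau> y"
proof -
  have "(SOME q. q \<in> cls x y) \<in> cls x y" using cls_self[OF assms] by (rule someI)
  then show ?thesis unfolding diff_value_def by (auto simp: groth_rel_iff split: prod.split)
qed

lemma cls_eqI:
  "x \<in> carrier S \<Longrightarrow> y \<in> carrier S \<Longrightarrow> x' \<in> carrier S \<Longrightarrow> y' \<in> carrier S \<Longrightarrow>
   \<tau> x - \<tau> y = \<tau> x' - \<tau> y' \<Longrightarrow> cls x y = cls x' y'"
  by (rule equiv_class_eq[OF equiv_groth_rel]) (simp add: groth_rel_iff)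

lemma groth_carrierE:
  assumes "g \<in> carrier (grothendieck S)"
  obtains x y where "x \<in> carrier S" "y \<in> carrier S" "g = cls x y"
  using assms unfolding grothendieck_def by (auto elim: quotientE)

lemma cls_closed: "x \<in> carrier S \<Longrightarrow> y \<in> carrier S \<Longrightarrow> cls x y \<in> carrier (grothendieck S)"
  unfolding grothendieck_def by (auto intro: quotientI)

lemma cls_mult:
  assumes "x \<in> carrier S" "y \<in> carrier S" "x' \<in> carrier S" "y' \<in> carrier S"
  shows "cls x y \<otimes>\<^bsub>grothendieck S\<^esub> cls x' y' = cls (x \<otimes> x') (y \<otimes> y')"
proof -
  have "cls (a \<otimes> a') (b \<otimes> b') = cls (x \<otimes> x') (y \<otimes> y')"
    if "(a, b) \<in> cls x y" "(a', b') \<in> cls x' y'" for a b a' b'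
  proof -
    have "((x, y), (a, b)) \<in> groth_rel S" "((x', y'), (a', b')) \<in> groth_rel S" using that by auto
    then have c: "a \<in> carrier S" "b \<in> carrier S" "a' \<in> carrier S" "b' \<in> carrier S"
      and eq: "\<tau> x - \<tau> y = \<tau> a - \<tau> b" "\<tau> x' - \<tau> y' = \<tau> a' - \<tau> b'"
      unfolding groth_rel_iff by auto
    show ?thesis using c assms eq by (intro cls_eqI) (simp_all add: \<tau>_mult)
  qed
  moreover have "(x, y) \<in> cls x y" "(x', y') \<in> cls x' y'" using cls_self assms by auto
  ultimately have "(\<Union>(a, b)\<in>cls x y. \<Union>(a', b')\<in>cls x' y'. cls (a \<otimes> a') (b \<otimes> b')) =
      cls (x \<otimes> x') (y \<otimes> y')" by blast
  then show ?thesis by (simp add: grothendieck_def)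
qed

lemma groth_map_eq: "groth_map S x = cls (x \<otimes> x) x"
  by (simp add: groth_map_def)

lemma diff_value_mult:
  assumes "g \<in> carrier (grothendieck S)" "h \<in> carrier (grothendieck S)"
  shows "diff_value (g \<otimes>\<^bsub>grothendieck S\<^esub> h) = diff_value g + diff_value h"
proof -
  obtain x y where g: "x \<in> carrier S" "y \<in> carrier S" "g = cls x y" by (rule groth_carrierE[OF assms(1)])
  obtain x' y' where h: "x' \<in> carrier S" "y' \<in> carrier S" "h = cls x' y'" by (rule groth_carrierE[OF assms(2)])
  show ?thesis unfolding g(3) h(3) using g h by (simp add: cls_mult diff_value_cls \<tau>_mult)
qed

lemma inj_on_diff_value: "inj_on diff_value (carrier (grothendieck S))"
proof (rule inj_onI)
  fix g h assume "g \<in> carrier (grothendieck S)" "h \<in> carrier (grothendieck S)" and eq: "diff_value g = diff_value h"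
  then obtain x y x' y' where g: "x \<in> carrier S" "y \<in> carrier S" "g = cls x y"
    and h: "x' \<in> carrier S" "y' \<in> carrier S" "h = cls x' y'"
    by (metis groth_carrierE)
  then have "\<tau> x - \<tau> y = \<tau> x' - \<tau> y'" using eq by (simp add: diff_value_cls)
  then show "g = h" unfolding g(3) h(3) by (rule cls_eqI[OF g(1,2) h(1,2)])
qed

lemma diff_value_rational:
  assumes "g \<in> carrier (grothendieck S)"
  shows "diff_value g \<in> \<rat>"
proof -
  obtain x y where g: "x \<in> carrier S" "y \<in> carrier S" "g = cls x y" by (rule groth_carrierE[OF assms])
  then show ?thesis by (simp add: diff_value_cls \<tau>_rat)
qed

text \<open>If the difference of x and y has nonnegative value, then x is y plus some z, and the
  class of the pair (x, y) is the image of z.\<close>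

lemma groth_map_image:
  "groth_map S ` carrier S = {g \<in> carrier (grothendieck S). 0 \<le> diff_value g}"
proof (intro equalityI subsetI)
  fix g assume "g \<in> groth_map S ` carrier S"
  then obtain x where x: "x \<in> carrier S" "g = cls (x \<otimes> x) x" unfolding groth_map_eq by auto
  then show "g \<in> {g \<in> carrier (grothendieck S). 0 \<le> diff_value g}"
    using \<tau>_nonneg by (simp add: cls_closed diff_value_cls \<tau>_mult)
next
  fix g assume "g \<in> {g \<in> carrier (grothendieck S). 0 \<le> diff_value g}"
  then have g: "g \<in> carrier (grothendieck S)" "0 \<le> diff_value g" by auto
  obtain x y where xy: "x \<in> carrier S" "y \<in> carrier S" "g = cls x y" by (rule groth_carrierE[OF g(1)])
  then have "\<tau> y \<le> \<tau> x" using g(2) by (simp add: diff_value_cls)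
  then obtain z where z: "z \<in> carrier S" "x = y \<otimes> z" using \<tau>_le xy by blast
  have "g = cls (z \<otimes> z) z" unfolding xy(3) using xy z by (intro cls_eqI) (simp_all add: \<tau>_mult)
  then show "g \<in> groth_map S ` carrier S" unfolding groth_map_eq[symmetric] using z(1) by blast
qed

end

context uhf_system
begin

lemma rational_monoid_MvN: "rational_monoid (MvN :: 'a mat set monoid) rank"
proof -
  have "rational_monoid_axioms (MvN :: 'a mat set monoid) rank"
  proof
    fix X Y :: "'a mat set" assume XY: "X \<in> carrier MvN" "Y \<in> carrier MvN"
    obtain k and r s :: nat where k: "X = \<zeta> k [^]\<^bsub>MvN\<^esub> r" "Y = \<zeta> k [^]\<^bsub>MvN\<^esub> s"
      by (rule common_level[OF XY])
    have "X \<otimes>\<^bsub>MvN\<^esub> Y = \<zeta> k [^]\<^bsub>MvN\<^esub> (r + s)" unfolding k by (rule MvN.nat_pow_mult[OF \<zeta>_closed])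
    then show "rank (X \<otimes>\<^bsub>MvN\<^esub> Y) = rank X + rank Y"
      using k by (simp add: rank_power add_divide_distrib)
    show "\<exists>Z\<in>carrier MvN. Y = X \<otimes>\<^bsub>MvN\<^esub> Z" if "rank X \<le> rank Y"
    proof -
      have "r \<le> s" using that k d_pos[of k] by (simp add: rank_power divide_le_cancel)
      then have "Y = X \<otimes>\<^bsub>MvN\<^esub> \<zeta> k [^]\<^bsub>MvN\<^esub> (s - r)"
        unfolding k by (simp add: MvN.nat_pow_mult[OF \<zeta>_closed])
      then show ?thesis using MvN.nat_pow_closed[OF \<zeta>_closed] by blast
    qed
    show "0 \<le> rank X" "rank X \<in> \<rat>" using k by (simp_all add: rank_power)
  next
    show "inj_on rank (carrier (MvN :: 'a mat set monoid))"
    proof (rule inj_onI)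
      fix X Y :: "'a mat set" assume XY: "X \<in> carrier MvN" "Y \<in> carrier MvN" and eq: "rank X = rank Y"
      obtain k and r s :: nat where k: "X = \<zeta> k [^]\<^bsub>MvN\<^esub> r" "Y = \<zeta> k [^]\<^bsub>MvN\<^esub> s"
        by (rule common_level[OF XY])
      then have "r = s" using eq d_pos[of k] by (simp add: rank_power)
      then show "X = Y" using k by simp
    qed
  qed
  then show ?thesis by (rule rational_monoid.intro[OF comm_monoid_MvN])
qed

end

section \<open>UHF algebras\<close>

definition unit_mat :: "nat \<Rightarrow> nat \<Rightarrow> nat \<Rightarrow> complex mat" where
  "unit_mat d i j = mat d d (\<lambda>(a, b). if a = i \<and> b = j then 1 else 0)"

lemma unit_mat_carrier [simp]: "unit_mat d i j \<in> carrier_mat d d"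
  by (simp add: unit_mat_def)

lemma mult_unit_mat:
  assumes "M \<in> carrier_mat d d" "a < d" "b < d" "k < d"
  shows "(M * unit_mat d k l) $$ (a, b) = (if b = l then M $$ (a, k) else 0)"
proof -
  have "(M * unit_mat d k l) $$ (a, b) = (\<Sum>t<d. M $$ (a, t) * unit_mat d k l $$ (t, b))"
    by (rule index_mult_mat_sum[OF assms(1) unit_mat_carrier assms(2,3)])
  also have "\<dots> = (\<Sum>t<d. if t = k then (if b = l then M $$ (a, k) else 0) else 0)"
    using assms by (intro sum.cong) (auto simp: unit_mat_def)
  finally show ?thesis using assms by simp
qed

lemma unit_mat_mult:
  assumes "M \<in> carrier_mat d d" "a < d" "b < d" "j < d"
  shows "(unit_mat d i j * M) $$ (a, b) = (if a = i then M $$ (j, b) else 0)"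
proof -
  have "(unit_mat d i j * M) $$ (a, b) = (\<Sum>t<d. unit_mat d i j $$ (a, t) * M $$ (t, b))"
    by (rule index_mult_mat_sum[OF unit_mat_carrier assms(1-3)])
  also have "\<dots> = (\<Sum>t<d. if t = j then (if a = i then M $$ (j, b) else 0) else 0)"
    using assms by (intro sum.cong) (auto simp: unit_mat_def)
  finally show ?thesis using assms by simp
qed

lemma unit_mat_unit_mat:
  assumes "i < d" "j < d" "k < d" "l < d"
  shows "unit_mat d i j * unit_mat d k l = (if j = k then unit_mat d i l else 0\<^sub>m d d)"
proof (rule eq_matI)
  fix a b assume "a < dim_row (if j = k then unit_mat d i l else 0\<^sub>m d d)"
    "b < dim_col (if j = k then unit_mat d i l else 0\<^sub>m d d)"
  then have ab: "a < d" "b < d" by (auto simp: unit_mat_def split: if_splits)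
  show "(unit_mat d i j * unit_mat d k l) $$ (a, b) =
      (if j = k then unit_mat d i l else 0\<^sub>m d d) $$ (a, b)"
    unfolding mult_unit_mat[OF unit_mat_carrier ab assms(3)]
    using ab assms by (auto simp: unit_mat_def)
qed (auto simp: unit_mat_def)

text \<open>It yields, after applying a homomorphism, the condition that defines
  \<open>span_set\<close>, with the entries of M as coefficients.\<close>

lemma elementary_corner:
  assumes M: "M \<in> carrier_mat d d" and "i < d" "j < d"
  shows "unit_mat d 0 i * M * unit_mat d j 0 = map_mat (cscale (M $$ (i, j))) (unit_mat d 0 0)"
proof (rule eq_matI)
  have c: "unit_mat d 0 i * M \<in> carrier_mat d d" by (rule mult_carrier_mat[OF unit_mat_carrier M])
  fix a b assume "a < dim_row (map_mat (cscale (M $$ (i, j))) (unit_mat d 0 0))"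
    "b < dim_col (map_mat (cscale (M $$ (i, j))) (unit_mat d 0 0))"
  then have ab: "a < d" "b < d" by (auto simp: unit_mat_def)
  show "(unit_mat d 0 i * M * unit_mat d j 0) $$ (a, b) =
      map_mat (cscale (M $$ (i, j))) (unit_mat d 0 0) $$ (a, b)"
    unfolding mult_unit_mat[OF c ab assms(3)] unit_mat_mult[OF M ab(1) assms(3,2)]
    using ab by (auto simp: unit_mat_def cscale_complex_def)
qed (auto simp: unit_mat_def)

lemma star_unit_mat: "mat_star (unit_mat d i j) = unit_mat d j i"
  by (rule eq_matI) (auto simp: unit_mat_def star_complex_def)

lemma unital_star_homD:
  fixes h :: "complex mat \<Rightarrow> 'a::cstar_algebra_1"
  assumes "h \<in> unital_star_hom (mat_alg d) type_alg"
  shows "a \<in> carrier_mat d d \<Longrightarrow> b \<in> carrier_mat d d \<Longrightarrow> h (a * b) = h a * h b"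
    and "a \<in> carrier_mat d d \<Longrightarrow> b \<in> carrier_mat d d \<Longrightarrow> h (a + b) = h a + h b"
    and "h (1\<^sub>m d) = 1"
    and "a \<in> carrier_mat d d \<Longrightarrow> h (mat_star a) = star (h a)"
    and "a \<in> carrier_mat d d \<Longrightarrow> h (map_mat (cscale c) a) = cscale c (h a)"
proof -
  have h: "h \<in> ring_hom (mat_alg d) type_alg" "\<forall>a\<in>carrier (mat_alg d).
     h (adj (mat_alg d) a) = adj type_alg (h a) \<and> (\<forall>c. h (scal (mat_alg d) c a) = scal type_alg c (h a))"
    using assms unfolding unital_star_hom_def by blast+
  show "a \<in> carrier_mat d d \<Longrightarrow> b \<in> carrier_mat d d \<Longrightarrow> h (a * b) = h a * h b"
    using ring_hom_mult[OF h(1), of a b] by (simp add: mat_alg_def ring_mat_def type_alg_def)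
  show "a \<in> carrier_mat d d \<Longrightarrow> b \<in> carrier_mat d d \<Longrightarrow> h (a + b) = h a + h b"
    using ring_hom_add[OF h(1), of a b] by (simp add: mat_alg_def ring_mat_def type_alg_def)
  show "h (1\<^sub>m d) = 1"
    using ring_hom_one[OF h(1)] by (simp add: mat_alg_def ring_mat_def type_alg_def)
  show "a \<in> carrier_mat d d \<Longrightarrow> h (mat_star a) = star (h a)"
    using h(2) by (simp add: mat_alg_def ring_mat_def type_alg_def)
  show "a \<in> carrier_mat d d \<Longrightarrow> h (map_mat (cscale c) a) = cscale c (h a)"
    using h(2) by (simp add: mat_alg_def ring_mat_def type_alg_def)
qed

lemma matrix_units_of_hom:
  fixes h :: "complex mat \<Rightarrow> 'a::cstar_algebra_1"
  assumes "0 < d" and h: "h \<in> unital_star_hom (mat_alg d) type_alg"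
  shows "matrix_units d (\<lambda>i j. h (unit_mat d i j))"
    and "h ` carrier_mat d d \<subseteq> matrix_units.span_set d (\<lambda>i j. h (unit_mat d i j))"
proof -
  note hom = unital_star_homD[OF h]
  have zero: "h (0\<^sub>m d d) = 0"
    using hom(2)[of "0\<^sub>m d d" "0\<^sub>m d d"] by simp
  \<comment> \<open>The homomorphism is known to respect sums of two matrices, so the identity is
    built up one diagonal unit at a time.\<close>
  have partial: "t \<le> d \<Longrightarrow>
      h (mat d d (\<lambda>(a, b). if a = b \<and> a < t then 1 else 0)) = (\<Sum>i<t. h (unit_mat d i i))" for t
  proof (induction t)
    case 0
    have eq: "mat d d (\<lambda>(a, b). if a = b \<and> a < 0 then 1 else 0) = (0\<^sub>m d d :: complex mat)"
      by (rule eq_matI) auto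
    show ?case unfolding eq using zero by simp
  next
    case (Suc t)
    have "mat d d (\<lambda>(a, b). if a = b \<and> a < Suc t then 1 else 0) =
        mat d d (\<lambda>(a, b). if a = b \<and> a < t then 1 else 0) + unit_mat d t t"
      by (rule eq_matI) (auto simp: unit_mat_def)
    then show ?case using Suc hom(2)[of "mat d d (\<lambda>(a, b). if a = b \<and> a < t then 1 else 0)"] by simp
  qed
  have "mat d d (\<lambda>(a, b). if a = b \<and> a < d then 1 else 0) = (1\<^sub>m d :: complex mat)"
    by (rule eq_matI) auto
  then have sum: "(\<Sum>i<d. h (unit_mat d i i)) = 1" using partial[of d] hom(3) by simp
  show units: "matrix_units d (\<lambda>i j. h (unit_mat d i j))"
  proof
    fix i j k l assume "i < d" "j < d" "k < d" "l < d"
    then show "h (unit_mat d i j) * h (unit_mat d k l) =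
        (if j = k then h (unit_mat d i l) else 0)"
      using hom(1)[of "unit_mat d i j" "unit_mat d k l", symmetric]
      by (simp add: unit_mat_unit_mat zero)
  next
    show "star (h (unit_mat d i j)) = h (unit_mat d j i)" for i j
      using hom(4)[of "unit_mat d i j"] by (simp add: star_unit_mat)
  qed (use \<open>0 < d\<close> sum in auto)
  interpret M: matrix_units d "\<lambda>i j. h (unit_mat d i j)" by (rule units)
  show "h ` carrier_mat d d \<subseteq> M.span_set"
  proof
    fix x assume "x \<in> h ` carrier_mat d d"
    then obtain m where m: "m \<in> carrier_mat d d" "x = h m" by blast
    show "x \<in> M.span_set"
    proof (rule M.span_setI)
      fix i j assume ij: "i < d" "j < d"
      have em: "unit_mat d 0 i * m \<in> carrier_mat d d"
        by (rule mult_carrier_mat[OF unit_mat_carrier m(1)])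
      have "h (unit_mat d 0 i) * x * h (unit_mat d j 0) =
          h (unit_mat d 0 i * m * unit_mat d j 0)"
        unfolding m(2) hom(1)[OF em unit_mat_carrier] hom(1)[OF unit_mat_carrier m(1)] ..
      also have "\<dots> = cscale (m $$ (i, j)) (h (unit_mat d 0 0))"
        unfolding elementary_corner[OF m(1) ij] by (rule hom(5)) simp
      finally show "\<exists>c. h (unit_mat d 0 i) * x * h (unit_mat d j 0) =
          cscale c (h (unit_mat d 0 0))" by blast
    qed
  qed
qed

text \<open>A level enters only through its image in the limit. The images are nested because the
  maps into the limit commute with the connecting maps, and their union is dense.\<close>

lemma UHF_system:
  assumes "UHF TYPE('a::cstar_algebra_1)"
  obtains d e and R :: "nat \<Rightarrow> 'a::cstar_algebra_1 set" where "uhf_system d e R"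
proof -
  obtain d \<phi> and \<mu> :: "nat \<Rightarrow> complex mat \<Rightarrow> 'a"
    where d: "\<And>k. 0 < d k"
      and \<phi>: "\<And>k. \<phi> k \<in> unital_star_hom (mat_alg (d k) :: complex mat star_alg) (mat_alg (d (Suc k)) :: complex mat star_alg)"
      and lim: "inductive_limit (\<lambda>k. mat_alg (d k)) \<phi> type_alg \<mu>"
    using assms unfolding UHF_def by blast
  have \<mu>: "\<mu> k \<in> unital_star_hom (mat_alg (d k)) type_alg" for k
    using lim unfolding inductive_limit_def by blast
  have carrier: "carrier (mat_alg n :: complex mat star_alg) = carrier_mat n n" for n
    by (simp add: mat_alg_def ring_mat_def)
  have \<mu>\<phi>: "\<mu> (Suc k) (\<phi> k a) = \<mu> k a" if "a \<in> carrier_mat (d k) (d k)" for k a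
    using lim that unfolding inductive_limit_def carrier by blast
  have \<phi>_closed: "\<phi> k a \<in> carrier_mat (d (Suc k)) (d (Suc k))" if "a \<in> carrier_mat (d k) (d k)" for k a
    using \<phi>[of k] that unfolding unital_star_hom_def ring_hom_def carrier by auto
  have dense: "\<exists>k. \<exists>b\<in>carrier_mat (d k) (d k). norm (\<mu> k b - a) < \<epsilon>" if "0 < \<epsilon>" for a \<epsilon>
  proof -
    have "\<forall>a\<in>carrier (type_alg :: 'a star_alg). \<forall>\<epsilon>>0. \<exists>k. \<exists>b\<in>carrier_mat (d k) (d k).
        alg_dist type_alg (\<mu> k b) a < \<epsilon>"
      using lim unfolding inductive_limit_def carrier by blast
    then show ?thesis using that by (simp add: alg_dist_def type_alg_def cscale_minus_1)
  qed
  define e where "e k i j = \<mu> k (unit_mat (d k) i j)" for k i j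
  define R where "R k = \<mu> k ` carrier_mat (d k) (d k)" for k
  have e: "e k = (\<lambda>i j. \<mu> k (unit_mat (d k) i j))" for k by (simp add: e_def fun_eq_iff)
  have "uhf_system d e R"
  proof (rule uhf_system.intro)
    show "matrix_units (d k) (e k)" "R k \<subseteq> matrix_units.span_set (d k) (e k)" for k
      unfolding e R_def by (rule matrix_units_of_hom[OF d \<mu>])+
    show "e k 0 0 \<in> R k" for k by (simp add: e_def R_def)
    show "a + b \<in> R k" if ab: "a \<in> R k" "b \<in> R k" for k a b
    proof -
      obtain x y where xy: "x \<in> carrier_mat (d k) (d k)" "a = \<mu> k x" "y \<in> carrier_mat (d k) (d k)" "b = \<mu> k y"
        using ab unfolding R_def by blast
      then have "a + b = \<mu> k (x + y)" using unital_star_homD(2)[OF \<mu>, of x k y] by simp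
      moreover have "x + y \<in> carrier_mat (d k) (d k)" by (rule add_carrier_mat[OF xy(3)])
      ultimately show ?thesis unfolding R_def by (rule image_eqI)
    qed
    show "r *\<^sub>R a \<in> R k" if a: "a \<in> R k" for k r a
    proof -
      obtain x where x: "x \<in> carrier_mat (d k) (d k)" "a = \<mu> k x"
        using a unfolding R_def by blast
      then have "r *\<^sub>R a = \<mu> k (map_mat (cscale (complex_of_real r)) x)"
        using unital_star_homD(5)[OF \<mu>, of x k "complex_of_real r"] by (simp add: cscale_of_real)
      moreover have "map_mat (cscale (complex_of_real r)) x \<in> carrier_mat (d k) (d k)" using x by simp
      ultimately show ?thesis unfolding R_def by (rule image_eqI)
    qed
    show "star a \<in> R k" if a: "a \<in> R k" for k a
    proof -
      obtain x where x: "x \<in> carrier_mat (d k) (d k)" "a = \<mu> k x"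
        using a unfolding R_def by blast
      then have "star a = \<mu> k (mat_star x)" using unital_star_homD(4)[OF \<mu>, of x k] by simp
      moreover have "mat_star x \<in> carrier_mat (d k) (d k)" using x by simp
      ultimately show ?thesis unfolding R_def by (rule image_eqI)
    qed
    show "R k \<subseteq> R (Suc k)" for k
      unfolding R_def using \<mu>\<phi> \<phi>_closed by (metis (no_types, lifting) image_eqI image_subsetI)
    show "\<exists>k. \<exists>b\<in>R k. norm (b - a) < \<epsilon>" if "0 < \<epsilon>" for a \<epsilon>
      using dense[OF that] unfolding R_def by blast
  qed
  then show ?thesis by (rule that)
qed

theorem theorem4p15:
  fixes v :: "nat \<Rightarrow> 'a::cstar_algebra_1"
    and \<kappa> :: "gword \<Rightarrow> ('a mat set \<times> 'a mat set) set"
  assumes "UHF TYPE('a)"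
    and "computable_cstar_presentation type_alg v"
    and "K0_presentation v \<kappa>"
  shows "computable_group_presentation K0 \<kappa> \<and> computable_group_subset K0 \<kappa> K0_pos"
proof -
  obtain d e and R :: "nat \<Rightarrow> 'a set" where "uhf_system d e R" by (rule UHF_system[OF assms(1)])
  then interpret A: uhf_system d e R .
  interpret M: rational_monoid "MvN :: 'a mat set monoid" A.rank by (rule A.rational_monoid_MvN)
  \<comment> \<open>The c.e. kernel is part of what \<open>K0_presentation\<close> provides; the
    embedding into the rational numbers makes it computable.\<close>
  have \<kappa>: "\<kappa> \<in> epi free_group (grothendieck MvN)"
    "ce_set (kernel_codes free_group gword_encode \<kappa>)"
    using assms(3) unfolding K0_presentation_def ce_group_presentation_def K0_def by blast+
  interpret P: rational_group_presentation "grothendieck MvN" \<kappa> M.diff_value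
    by (rule rational_group_presentation.intro[OF \<kappa>(1)])
      (rule M.diff_value_mult M.inj_on_diff_value M.diff_value_rational; assumption)+
  show ?thesis
    unfolding K0_def K0_pos_def by (rule P.computable[OF \<kappa>(2) M.groth_map_image])
qed

end
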